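(* Let $(V;\rho)$ be a representation of a $3$-Lie algebra $(\mathfrak g,[\cdot,\cdot,\cdot]_{\mathfrak g})$. Then there is a $V$-data $(L,F,\mathcal P,\Delta)$ as follows: (1) the graded Lie algebra $(L,[\cdot,\cdot])$ is $(C^*(\mathfrak g\oplus V,\mathfrak g\oplus V),[\cdot,\cdot]_{\mathsf{3Leib}})$; (2) the abelian graded Lie subalgebra $F$ is $F=C^*(V,\mathfrak g)=\bigoplus_{n\ge0}C^n(V,\mathfrak g)=\bigoplus_{n\geq 0}\mathrm{Hom}\big((\otimes^2V)^{\otimes n}\otimes V,\mathfrak g\big)$; (3) $\mathcal P:L\to L$ is the projection onto the subspace $F$; (4) $\Delta=\mu\boxplus\rho$. Consequently, $(C^*(V,\mathfrak g),\{\cdot,\cdot,\cdot\})$ is a Lie $3$-algebra, where the trilinear bracket $\{\cdot,\cdot,\cdot\}:C^p(V,\mathfrak g)\times C^q(V,\mathfrak g)\times C^r(V,\mathfrak g)\to C^{p+q+r+1}(V,\mathfrak g)$ is defined by $$\{P,Q,R\}=[[[\mu\boxplus\rho,P]_{\mathsf{3Leib}},Q]_{\mathsf{3Leib}},R]_{\mathsf{3Leib}}$$ for all $P\in C^p(V,\mathfrak g)$, $Q\in C^q(V,\mathfrak g)$, $R\in C^r(V,\mathfrak g)$.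
   Context: All vector spaces are over an algebraically closed field $\mathbb K$ of characteristic $0$. A $3$-Lie algebra is a vector space $\mathfrak g$ with a skew-symmetric trilinear bracket $[\cdot,\cdot,\cdot]_{\mathfrak g}$ such that $[x_1,x_2,[x_3,x_4,x_5]_{\mathfrak g}]_{\mathfrak g}=[[x_1,x_2,x_3]_{\mathfrak g},x_4,x_5]_{\mathfrak g}+[x_3,[x_1,x_2,x_4]_{\mathfrak g},x_5]_{\mathfrak g}+[x_3,x_4,[x_1,x_2,x_5]_{\mathfrak g}]_{\mathfrak g}$ for all $x_i\in\mathfrak g$. A representation of $\mathfrak g$ on a vector space $V$ is a linear map $\rho:\wedge^2\mathfrak g\to\mathfrak{gl}(V)$ such that for all $x_i\in\mathfrak g$: $\rho(x_1,x_2)\rho(x_3,x_4)=\rho([x_1,x_2,x_3]_{\mathfrak g},x_4)+\rho(x_3,[x_1,x_2,x_4]_{\mathfrak g})+\rho(x_3,x_4)\rho(x_1,x_2)$ and $\rho(x_1,[x_2,x_3,x_4]_{\mathfrak g})=\rho(x_3,x_4)\rho(x_1,x_2)-\rho(x_2,x_4)\rho(x_1,x_3)+\rho(x_2,x_3)\rho(x_1,x_4)$. Graded Lie algebra $C^*(W,W)$. For a vector space $W$, $C^n(W,W)=\mathrm{Hom}((\otimes^2W)^{\otimes n}\otimes W,W)$ has degree $n\ge0$ and $C^*(W,W)=\bigoplus_{n\ge0}C^n(W,W)$. For $P\in C^p(W,W)$, $Q\in C^q(W,W)$, $[P,Q]_{\mathsf{3Leib}}=P\circ Q-(-1)^{pq}Q\circ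 P$, where for $\mathfrak X_i=x_i\otimes y_i\in\otimes^2W$ and $x\in W$, $(P\circ Q)(\mathfrak X_1,\dots,\mathfrak X_{p+q},x)$ $=\sum_{k=1}^p(-1)^{(k-1)q}\sum_{\sigma\in S(k-1,q)}(-1)^\sigma P\big(\mathfrak X_{\sigma(1)},\dots,\mathfrak X_{\sigma(k-1)},Q(\mathfrak X_{\sigma(k)},\dots,\mathfrak X_{\sigma(k+q-1)},x_{k+q})\otimes y_{k+q},\mathfrak X_{k+q+1},\dots,\mathfrak X_{p+q},x\big)$ $+\sum_{k=1}^p(-1)^{(k-1)q}\sum_{\sigma\in S(k-1,q)}(-1)^\sigma P\big(\mathfrak X_{\sigma(1)},\dots,\mathfrak X_{\sigma(k-1)},x_{k+q}\otimes Q(\mathfrak X_{\sigma(k)},\dots,\mathfrak X_{\sigma(k+q-1)},y_{k+q}),\mathfrak X_{k+q+1},\dots,\mathfrak X_{p+q},x\big)$ $+\sum_{\sigma\in S(p,q)}(-1)^{pq}(-1)^\sigma P\big(\mathfrak X_{\sigma(1)},\dots,\mathfrak X_{\sigma(p)},Q(\mathfrak X_{\sigma(p+1)},\dots,\mathfrak X_{\sigma(p+q)},x)\big)$, with $S(i,j)$ the set of $(i,j)$-shuffles and $(-1)^\sigma$ the sign of $\sigma$. It is known (Rotkiewicz) that this is a graded Lie algebra. Here $\mu$ denotes the bracket $[\cdot,\cdot,\cdot]_{\mathfrak g}$, and $\mu\boxplus\rho\in C^1(\mathfrak g\oplus V,\mathfrak g\oplus V)$ is $(\mu\boxplus\rho)(x+u,y+v,z+w)=[x,y,z]_{\mathfrak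 g}+\rho(x,y)w$ for $x,y,z\in\mathfrak g$, $u,v,w\in V$. The space $C^n(V,\mathfrak g)$ is regarded as a subspace of $C^n(\mathfrak g\oplus V,\mathfrak g\oplus V)$ by extending a map by precomposing every argument with the projection $\mathfrak g\oplus V\to V$ and postcomposing with the inclusion $\mathfrak g\subset\mathfrak g\oplus V$; $\mathcal P$ sends $f\in C^n(\mathfrak g\oplus V,\mathfrak g\oplus V)$ to $\mathrm{pr}_{\mathfrak g}\circ f|_{(\otimes^2V)^{\otimes n}\otimes V}$, extended in this way. A $V$-data is a quadruple $(L,F,\mathcal P,\Delta)$ where $(L,[\cdot,\cdot])$ is a graded Lie algebra, $F$ is an abelian graded Lie subalgebra of $L$, $\mathcal P:L\to L$ is a projection ($\mathcal P\circ\mathcal P=\mathcal P$) whose image is $F$ and whose kernel is a graded Lie subalgebra of $L$, and $\Delta\in\ker(\mathcal P)^1$ (degree $1$) satisfies $[\Delta,\Delta]=0$. A Lie $3$-algebra is a $\mathbb Z$-graded vector space $\mathfrak h=\bigoplus_k\mathfrak h^k$ with a trilinear bracket $\{\cdot,\cdot,\cdot\}$ of degree $1$ that is graded symmetric, $\{x_1,x_2,x_3\}=(-1)^{x_1x_2}\{x_2,x_1,x_3\}=(-1)^{x_2x_3}\{x_1,x_3,x_2\}$, and satisfies $\sum_{\sigma\in\mathbb S_5}\varepsilon(\sigma)\{\{x_{\sigma(1)},x_{\sigma(2)},x_{\sigma(3)}\},x_{\sigma(4)},x_{\sigma(5)}\}=0$ for homogeneous elements, $\varepsilon(\sigma)$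 being the Koszul sign. *)

theory Defs
  imports
    "HOL-Analysis.Product_Vector"
    "HOL-Library.Function_Algebras"
    "HOL-Combinatorics.Permutations"
    "HOL-Computational_Algebra.Polynomial"
begin

section \<open>3-Lie algebras and their representations\<close>

definition three_Lie_algebra ::
  "('k::field \<Rightarrow> 'g::ab_group_add \<Rightarrow> 'g) \<Rightarrow> ('g \<Rightarrow> 'g \<Rightarrow> 'g \<Rightarrow> 'g) \<Rightarrow> bool" where
  "three_Lie_algebra s br \<longleftrightarrow>
     vector_space s \<and>
     (\<forall>y z. Vector_Spaces.linear s s (\<lambda>x. br x y z)) \<and>
     (\<forall>x z. Vector_Spaces.linear s s (\<lambda>y. br x y z)) \<and>
     (\<forall>x y. Vector_Spaces.linear s s (\<lambda>z. br x y z)) \<and>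
     (\<forall>x y z. br x y z = - br y x z \<and> br x y z = - br x z y) \<and>
     (\<forall>x1 x2 x3 x4 x5.
        br x1 x2 (br x3 x4 x5) =
          br (br x1 x2 x3) x4 x5 + br x3 (br x1 x2 x4) x5 + br x3 x4 (br x1 x2 x5))"

text \<open>A linear map on the exterior square of \<open>\<gg>\<close> is given as an alternating bilinear map.\<close>

definition three_Lie_representation ::
  "('k::field \<Rightarrow> 'g::ab_group_add \<Rightarrow> 'g) \<Rightarrow> ('g \<Rightarrow> 'g \<Rightarrow> 'g \<Rightarrow> 'g) \<Rightarrow>
   ('k \<Rightarrow> 'v::ab_group_add \<Rightarrow> 'v) \<Rightarrow> ('g \<Rightarrow> 'g \<Rightarrow> 'v \<Rightarrow> 'v) \<Rightarrow> bool" where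
  "three_Lie_representation sG br sV \<rho> \<longleftrightarrow>
     vector_space sV \<and>
     (\<forall>y v. Vector_Spaces.linear sG sV (\<lambda>x. \<rho> x y v)) \<and>
     (\<forall>x v. Vector_Spaces.linear sG sV (\<lambda>y. \<rho> x y v)) \<and>
     (\<forall>x y. Vector_Spaces.linear sV sV (\<rho> x y)) \<and>
     (\<forall>x v. \<rho> x x v = 0) \<and>
     (\<forall>x1 x2 x3 x4 v.
        \<rho> x1 x2 (\<rho> x3 x4 v) =
          \<rho> (br x1 x2 x3) x4 v + \<rho> x3 (br x1 x2 x4) v + \<rho> x3 x4 (\<rho> x1 x2 v)) \<and>
     (\<forall>x1 x2 x3 x4 v.
        \<rho> x1 (br x2 x3 x4) v =
          \<rho> x3 x4 (\<rho> x1 x2 v) - \<rho> x2 x4 (\<rho> x1 x3 v) + \<rho> x2 x3 (\<rho> x1 x4 v))"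


section \<open>Graded Lie algebras, V-data and Lie 3-algebras\<close>

text \<open>
  Graded vector spaces are internal: \<open>G i\<close> is the homogeneous part of degree \<open>i\<close>, and the graded
  space itself is the (direct) sum \<open>total s G\<close> of these parts inside the ambient vector space.
\<close>

definition total :: "('k::field \<Rightarrow> 'a::ab_group_add \<Rightarrow> 'a) \<Rightarrow> (int \<Rightarrow> 'a set) \<Rightarrow> 'a set" where
  "total s G = module.span s (\<Union>i. G i)"

definition graded_vector_space ::
  "('k::field \<Rightarrow> 'a::ab_group_add \<Rightarrow> 'a) \<Rightarrow> (int \<Rightarrow> 'a set) \<Rightarrow> bool" where
  "graded_vector_space s G \<longleftrightarrow>
     vector_space s \<and>
     (\<forall>i. module.subspace s (G i)) \<and>
     (\<forall>I x. finite I \<and> (\<forall>i\<in>I. x i \<in> G i) \<and> (\<Sum>i\<in>I. x i) = 0 \<longrightarrow> (\<forall>i\<in>I. x i = 0))"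

definition graded_Lie_algebra ::
  "('k::field \<Rightarrow> 'a::ab_group_add \<Rightarrow> 'a) \<Rightarrow> (int \<Rightarrow> 'a set) \<Rightarrow> ('a \<Rightarrow> 'a \<Rightarrow> 'a) \<Rightarrow> bool" where
  "graded_Lie_algebra s G br \<longleftrightarrow>
     graded_vector_space s G \<and>
     (\<forall>x\<in>total s G. \<forall>y\<in>total s G. \<forall>z\<in>total s G. \<forall>c.
        br (x + y) z = br x z + br y z \<and> br (s c x) z = s c (br x z) \<and>
        br z (x + y) = br z x + br z y \<and> br z (s c x) = s c (br z x)) \<and>
     (\<forall>i j. \<forall>x\<in>G i. \<forall>y\<in>G j. br x y \<in> G (i + j)) \<and>
     (\<forall>i j. \<forall>x\<in>G i. \<forall>y\<in>G j. br x y = - s ((-1) powi (i * j)) (br y x)) \<and>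
     (\<forall>i j k. \<forall>x\<in>G i. \<forall>y\<in>G j. \<forall>z\<in>G k.
        br x (br y z) = br (br x y) z + s ((-1) powi (i * j)) (br y (br x z)))"

text \<open>
  The condition \<open>H = module.span s (\<Union>i. H \<inter> G i)\<close> says that \<open>H\<close> is a subspace which is the sum of
  its homogeneous parts.
\<close>

definition graded_Lie_subalgebra ::
  "('k::field \<Rightarrow> 'a::ab_group_add \<Rightarrow> 'a) \<Rightarrow> (int \<Rightarrow> 'a set) \<Rightarrow> ('a \<Rightarrow> 'a \<Rightarrow> 'a) \<Rightarrow> 'a set \<Rightarrow> bool"
  where
  "graded_Lie_subalgebra s G br H \<longleftrightarrow>
     H = module.span s (\<Union>i. H \<inter> G i) \<and> (\<forall>x\<in>H. \<forall>y\<in>H. br x y \<in> H)"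

definition V_data ::
  "('k::field \<Rightarrow> 'a::ab_group_add \<Rightarrow> 'a) \<Rightarrow> (int \<Rightarrow> 'a set) \<Rightarrow> ('a \<Rightarrow> 'a \<Rightarrow> 'a) \<Rightarrow>
   'a set \<Rightarrow> ('a \<Rightarrow> 'a) \<Rightarrow> 'a \<Rightarrow> bool" where
  "V_data s G br F \<P> \<Delta> \<longleftrightarrow>
     graded_Lie_algebra s G br \<and>
     graded_Lie_subalgebra s G br F \<and> (\<forall>x\<in>F. \<forall>y\<in>F. br x y = 0) \<and>
     (\<forall>x\<in>total s G. \<forall>y\<in>total s G. \<forall>c. \<P> (x + y) = \<P> x + \<P> y \<and> \<P> (s c x) = s c (\<P> x)) \<and>
     (\<forall>x\<in>total s G. \<P> x \<in> total s G \<and> \<P> (\<P> x) = \<P> x) \<and>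
     \<P> ` total s G = F \<and>
     graded_Lie_subalgebra s G br {x \<in> total s G. \<P> x = 0} \<and>
     \<Delta> \<in> G 1 \<and> \<P> \<Delta> = 0 \<and> br \<Delta> \<Delta> = 0"

text \<open>
  The sign \<open>\<epsilon>(\<sigma>)\<close> with \<open>x\<^bsub>\<sigma>(1)\<^esub> \<odot> \<dots> \<odot> x\<^bsub>\<sigma>(n)\<^esub> = \<epsilon>(\<sigma>) x\<^bsub>1\<^esub> \<odot> \<dots> \<odot> x\<^bsub>n\<^esub>\<close> in the graded symmetric algebra,
  where \<open>x\<^bsub>i\<^esub>\<close> has degree \<open>d i\<close>: each inversion of \<open>\<sigma>\<close> contributes the sign of swapping
  the two elements involved.
\<close>

definition koszul_sign :: "nat \<Rightarrow> (nat \<Rightarrow> int) \<Rightarrow> (nat \<Rightarrow> nat) \<Rightarrow> 'k::field" where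
  "koszul_sign n d \<sigma> =
     (\<Prod>(i, j) \<in> {(i, j). 1 \<le> i \<and> i < j \<and> j \<le> n \<and> \<sigma> j < \<sigma> i}. (-1) powi (d (\<sigma> i) * d (\<sigma> j)))"

definition Lie_3_algebra ::
  "('k::field \<Rightarrow> 'a::ab_group_add \<Rightarrow> 'a) \<Rightarrow> (int \<Rightarrow> 'a set) \<Rightarrow> ('a \<Rightarrow> 'a \<Rightarrow> 'a \<Rightarrow> 'a) \<Rightarrow> bool" where
  "Lie_3_algebra s H t \<longleftrightarrow>
     graded_vector_space s H \<and>
     (\<forall>x\<in>total s H. \<forall>y\<in>total s H. \<forall>u\<in>total s H. \<forall>v\<in>total s H. \<forall>c.
        t (x + y) u v = t x u v + t y u v \<and> t (s c x) u v = s c (t x u v) \<and>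
        t u (x + y) v = t u x v + t u y v \<and> t u (s c x) v = s c (t u x v) \<and>
        t u v (x + y) = t u v x + t u v y \<and> t u v (s c x) = s c (t u v x)) \<and>
     (\<forall>i j k. \<forall>x\<in>H i. \<forall>y\<in>H j. \<forall>z\<in>H k. t x y z \<in> H (i + j + k + 1)) \<and>
     (\<forall>i j k. \<forall>x\<in>H i. \<forall>y\<in>H j. \<forall>z\<in>H k.
        t x y z = s ((-1) powi (i * j)) (t y x z) \<and>
        t x y z = s ((-1) powi (j * k)) (t x z y)) \<and>
     (\<forall>d x. (\<forall>i\<in>{1..5}. x i \<in> H (d i)) \<longrightarrow>
        (\<Sum>\<sigma> | \<sigma> permutes {1..5::nat}.
           s (koszul_sign 5 d \<sigma>) (t (t (x (\<sigma> 1)) (x (\<sigma> 2)) (x (\<sigma> 3))) (x (\<sigma> 4)) (x (\<sigma> 5)))) = 0)"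


section \<open>The graded Lie algebra of multilinear maps\<close>

text \<open>
  A linear map \<open>(\<otimes>\<^sup>2A)\<^sup>\<otimes>\<^sup>n \<otimes> A \<rightarrow> B\<close> is represented by the corresponding map that is linear in each
  of its \<open>2n + 1\<close> arguments: \<open>n\<close> pairs, collected in a list, and a last argument. It is extended by \<open>0\<close>
  to lists of other lengths. In this way the direct sum of these spaces over all \<open>n\<close> is an internal
  one: it consists of the functions that are multilinear on the lists of each fixed
  length and vanish on the lists of all but finitely many lengths.
\<close>

type_synonym ('a, 'b) cochain = "('a \<times> 'a) list \<Rightarrow> 'a \<Rightarrow> 'b"

definition cochain_scale ::
  "('k \<Rightarrow> 'b \<Rightarrow> 'b) \<Rightarrow> 'k \<Rightarrow> ('a, 'b) cochain \<Rightarrow> ('a, 'b) cochain" where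
  "cochain_scale s c f = (\<lambda>Xs x. s c (f Xs x))"

definition cochains ::
  "('k::field \<Rightarrow> 'a::ab_group_add \<Rightarrow> 'a) \<Rightarrow> ('k \<Rightarrow> 'b::ab_group_add \<Rightarrow> 'b) \<Rightarrow> nat \<Rightarrow>
   ('a, 'b) cochain set" where
  "cochains sA sB n = {f.
     (\<forall>Xs x. length Xs \<noteq> n \<longrightarrow> f Xs x = 0) \<and>
     (\<forall>Xs. length Xs = n \<longrightarrow> Vector_Spaces.linear sA sB (f Xs)) \<and>
     (\<forall>Xs i y x. length Xs = n \<and> i < n \<longrightarrow>
        Vector_Spaces.linear sA sB (\<lambda>a. f (Xs[i := (a, y)]) x) \<and>
        Vector_Spaces.linear sA sB (\<lambda>b. f (Xs[i := (y, b)]) x))}"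

definition nonneg_grading :: "(nat \<Rightarrow> 'a::zero set) \<Rightarrow> int \<Rightarrow> 'a set" where
  "nonneg_grading A i = (if i < 0 then {0} else A (nat i))"

definition shuffle_perms :: "nat \<Rightarrow> nat \<Rightarrow> (nat \<Rightarrow> nat) set" where
  "shuffle_perms i j =
     {\<sigma>. \<sigma> permutes {1..i + j} \<and> strict_mono_on {1..i} \<sigma> \<and> strict_mono_on {i + 1..i + j} \<sigma>}"

text \<open>
  The value of \<open>P \<circ> Q\<close>, for the degree \<open>p\<close> part of \<open>P\<close> and the degree \<open>q\<close> part of \<open>Q\<close>, at
  \<open>p + q\<close> pairs and a last argument. Indices are shifted as lists start at index \<open>0\<close>.
\<close>

definition circ ::
  "('k::field \<Rightarrow> 'w::ab_group_add \<Rightarrow> 'w) \<Rightarrow> nat \<Rightarrow> nat \<Rightarrow>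
   ('w, 'w) cochain \<Rightarrow> ('w, 'w) cochain \<Rightarrow> ('w, 'w) cochain" where
  "circ s p q P Q Xs x =
     (let X = (\<lambda>i. Xs ! (i - 1)) in
       (\<Sum>k = 1..p. s ((-1) ^ ((k - 1) * q))
         (\<Sum>\<sigma> \<in> shuffle_perms (k - 1) q. s (of_int (sign \<sigma>))
           (P (map (\<lambda>i. X (\<sigma> i)) [1..<k] @
               [(Q (map (\<lambda>i. X (\<sigma> i)) [k..<k + q]) (fst (X (k + q))), snd (X (k + q)))] @
               map X [k + q + 1..<p + q + 1]) x)))
     + (\<Sum>k = 1..p. s ((-1) ^ ((k - 1) * q))
         (\<Sum>\<sigma> \<in> shuffle_perms (k - 1) q. s (of_int (sign \<sigma>))
           (P (map (\<lambda>i. X (\<sigma> i)) [1..<k] @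
               [(fst (X (k + q)), Q (map (\<lambda>i. X (\<sigma> i)) [k..<k + q]) (snd (X (k + q))))] @
               map X [k + q + 1..<p + q + 1]) x)))
     + (\<Sum>\<sigma> \<in> shuffle_perms p q. s ((-1) ^ (p * q) * of_int (sign \<sigma>))
         (P (map (\<lambda>i. X (\<sigma> i)) [1..<p + 1])
            (Q (map (\<lambda>i. X (\<sigma> i)) [p + 1..<p + q + 1]) x))))"

text \<open>
  The bilinear extension of \<open>[P, Q] = P \<circ> Q - (-1)\<^sup>p\<^sup>q Q \<circ> P\<close> to the direct sum: the degree \<open>n\<close> part
  of \<open>[P, Q]\<close> collects the contributions of the parts of degree \<open>p\<close> and \<open>n - p\<close> of \<open>P\<close> and \<open>Q\<close>; see
  \<open>leib_bracket_homogeneous\<close> below.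
\<close>

definition leib_bracket ::
  "('k::field \<Rightarrow> 'w::ab_group_add \<Rightarrow> 'w) \<Rightarrow>
   ('w, 'w) cochain \<Rightarrow> ('w, 'w) cochain \<Rightarrow> ('w, 'w) cochain" where
  "leib_bracket s P Q Xs x =
     (\<Sum>(p, q) \<in> {(p, q). p + q = length Xs}.
        circ s p q P Q Xs x - s ((-1) ^ (p * q)) (circ s q p Q P Xs x))"

lemma circ_eq_0:
  assumes s: "vector_space s" and P: "P \<in> cochains s s p" and Q: "Q \<in> cochains s s q"
    and ne: "p' \<noteq> p \<or> q' \<noteq> q" and len: "length Xs = p' + q'"
  shows "circ s p' q' P Q Xs x = 0"
proof -
  interpret vector_space s by (rule s)
  have P0: "P Ys y = 0" if "length Ys \<noteq> p" for Ys y using P that by (simp add: cochains_def)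
  have Q0: "Q Ys y = 0" if "length Ys \<noteq> q" for Ys y using Q that by (simp add: cochains_def)
  have lin0: "f 0 = 0" if "Vector_Spaces.linear s s f" for f :: "'b \<Rightarrow> 'b"
    using that by (auto simp: Vector_Spaces.linear_def dest: module_hom.zero)
  have Plast: "P Ys 0 = 0" for Ys
  proof (cases "length Ys = p")
    case True
    then have "Vector_Spaces.linear s s (P Ys)" using P by (simp add: cochains_def)
    then show ?thesis by (rule lin0)
  qed (simp add: P0)
  have Pslot: "P (As @ (0, b) # Bs) y = 0 \<and> P (As @ (b, 0) # Bs) y = 0" for As b Bs y
  proof (cases "length (As @ (0, b) # Bs) = p")
    case True
    then have i: "length As < p" by auto
    have "Vector_Spaces.linear s s (\<lambda>a. P ((As @ (0, b) # Bs)[length As := (a, b)]) y) \<and>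
        Vector_Spaces.linear s s (\<lambda>c. P ((As @ (0, b) # Bs)[length As := (b, c)]) y)"
      using P True i unfolding cochains_def by blast
    then have "P ((As @ (0, b) # Bs)[length As := (0, b)]) y = 0 \<and>
        P ((As @ (0, b) # Bs)[length As := (b, 0)]) y = 0"
      using lin0 by blast
    then show ?thesis by simp
  qed (simp add: P0)
  show ?thesis
  proof (cases "p' = p")
    case True
    then have "q' \<noteq> q" using ne by simp
    then show ?thesis
      by (simp add: circ_def Q0 Plast Pslot)
  next
    case False
    then show ?thesis by (simp add: circ_def P0 del: map_append)
  qed
qed

lemma leib_bracket_homogeneous:
  assumes s: "vector_space s" and P: "P \<in> cochains s s p" and Q: "Q \<in> cochains s s q"
  shows "leib_bracket s P Q Xs x =
    (if length Xs = p + q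
     then circ s p q P Q Xs x - s ((-1) ^ (p * q)) (circ s q p Q P Xs x) else 0)"
proof -
  interpret vector_space s by (rule s)
  have fin: "finite {(a, b). a + b = length Xs}"
    by (rule finite_subset[of _ "{..length Xs} \<times> {..length Xs}"]) auto
  have z: "circ s a b P Q Xs x - s ((-1) ^ (a * b)) (circ s b a Q P Xs x) = 0"
    if "a + b = length Xs" "(a, b) \<noteq> (p, q)" for a b
    using that circ_eq_0[OF s P Q, of a b Xs x] circ_eq_0[OF s Q P, of b a Xs x] by auto
  have "leib_bracket s P Q Xs x =
    (\<Sum>ab \<in> {(a, b). a + b = length Xs}. if ab = (p, q)
       then circ s p q P Q Xs x - s ((-1) ^ (p * q)) (circ s q p Q P Xs x) else 0)"
    unfolding leib_bracket_def by (rule sum.cong) (auto split: if_splits dest: z)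
  then show ?thesis using fin by (auto simp: sum.delta)
qed


section \<open>The V-data of a representation\<close>

definition boxplus ::
  "('g::ab_group_add \<Rightarrow> 'g \<Rightarrow> 'g \<Rightarrow> 'g) \<Rightarrow> ('g \<Rightarrow> 'g \<Rightarrow> 'v::ab_group_add \<Rightarrow> 'v) \<Rightarrow>
   ('g \<times> 'v, 'g \<times> 'v) cochain" where
  "boxplus \<mu> \<rho> Xs c =
     (case Xs of
        [(a, b)] \<Rightarrow> (\<mu> (fst a) (fst b) (fst c), \<rho> (fst a) (fst b) (snd c))
      | _ \<Rightarrow> 0)"

text \<open>The embedding of \<open>C\<^sup>n(V, \<gg>)\<close> into \<open>C\<^sup>n(\<gg> \<oplus> V, \<gg> \<oplus> V)\<close>.\<close>

definition extend_cochain ::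
  "('v, 'g) cochain \<Rightarrow> ('g::ab_group_add \<times> 'v::ab_group_add, 'g \<times> 'v) cochain" where
  "extend_cochain f Xs c = (f (map (map_prod snd snd) Xs) (snd c), 0)"

definition restrict_cochain ::
  "('g::ab_group_add \<times> 'v::ab_group_add, 'g \<times> 'v) cochain \<Rightarrow> ('v, 'g) cochain" where
  "restrict_cochain f Xs v = fst (f (map (map_prod (Pair 0) (Pair 0)) Xs) (0, v))"

definition projP ::
  "('g::ab_group_add \<times> 'v::ab_group_add, 'g \<times> 'v) cochain \<Rightarrow> ('g \<times> 'v, 'g \<times> 'v) cochain" where
  "projP f = extend_cochain (restrict_cochain f)"

end

theory Submission
  imports Defs
begin

text \<open>
  The proof has three parts.

  \<^bold>\<open>The graded Lie algebra.\<close> The composition of cochains is a graded right pre-Lie product, and the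
  commutator of such a product satisfies the graded Jacobi identity (\<open>leib_bracket_Jacobi\<close>). The pre-Lie
  identity becomes accessible when the sum over shuffles is replaced by a recursion on the first pair
  \<open>X\<close> of arguments of \<open>P \<circ> Q\<close>: either \<open>X\<close> is an argument of \<open>P\<close>, with the sign \<open>(-1)\<^sup>q\<close> for passing \<open>Q\<close>, or
  it is an argument of \<open>Q\<close>, or, for \<open>q = 0\<close>, it is the pair on which \<open>Q\<close> acts. So fixing the first pair
  behaves like a derivation, and the identity follows by induction on the number of pairs
  (\<open>insertion_pre_Lie\<close>). That the recursion computes the sum over shuffle permutations is
  \<open>circ_eq_insertion\<close>.

  \<^bold>\<open>The V-data.\<close> A map in \<open>C\<^sup>*(V, \<gg>)\<close> takes values in \<open>\<gg>\<close> and vanishes as soon as one argument is in \<open>\<gg>\<close>, so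
  inserting one such map into another gives \<open>0\<close>. The kernel of the projection consists of the maps that
  send arguments from \<open>V\<close> into \<open>V\<close>, and insertion preserves this property. Finally \<open>[\<Delta>, \<Delta>] = 2 \<Delta> \<circ> \<Delta>\<close>, and
  \<open>\<Delta> \<circ> \<Delta> = 0\<close> is the fundamental identity for the bracket \<open>\<Delta>\<close> on \<open>\<gg> \<oplus> V\<close>, whose components are those for
  \<open>\<gg>\<close> and for its action on \<open>V\<close>.

  \<^bold>\<open>The Lie 3-algebra.\<close> Symmetry and the generalized Jacobi identity hold for every derived bracket
  \<open>[[[\<Delta>, x], y], z]\<close> on an abelian part that is closed under it (\<open>derived_Lie_3_algebra\<close>): right
  multiplication with an element is a graded derivation of the bracket, and expanding
  \<open>0 = [\<dots>[[\<Delta>, \<Delta>], x\<^sub>1], \<dots>, x\<^sub>5]\<close> leaves only terms where one factor \<open>\<Delta>\<close> takes three of the \<open>x\<^sub>i\<close> and the other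
  one two, since four of them kill \<open>\<Delta>\<close>. That \<open>C\<^sup>*(V, \<gg>)\<close> is closed under the bracket, with no projection
  applied, is a matter of weights (\<open>triple_bracket_F\<close>): counting arguments in \<open>\<gg>\<close> minus values in \<open>\<gg>\<close>, the
  map \<open>\<Delta>\<close> has weight \<open>2\<close> and \<open>C\<^sup>*(V, \<gg>)\<close> is exactly the part of weight \<open>-1\<close>. Weights are detected by
  rescaling \<open>\<gg>\<close> by the factor \<open>2\<close>.
\<close>


section \<open>Multilinear cochains\<close>

lemma linear_iff_add_scale:
  assumes "vector_space s1" "vector_space s2"
  shows "Vector_Spaces.linear s1 s2 f \<longleftrightarrow>
    (\<forall>x y. f (x + y) = f x + f y) \<and> (\<forall>c x. f (s1 c x) = s2 c (f x))"
  using assms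
  by (auto simp: Vector_Spaces.linear_def module_hom_def module_hom_axioms_def
      module_iff_vector_space)

definition multilinear ::
  "('k::field \<Rightarrow> 'a::ab_group_add \<Rightarrow> 'a) \<Rightarrow> ('k \<Rightarrow> 'b::ab_group_add \<Rightarrow> 'b) \<Rightarrow> ('a, 'b) cochain \<Rightarrow> bool"
  where
  "multilinear sA sB f \<longleftrightarrow>
     (\<forall>Xs. Vector_Spaces.linear sA sB (f Xs)) \<and>
     (\<forall>As Bs y x. Vector_Spaces.linear sA sB (\<lambda>a. f (As @ (a, y) # Bs) x) \<and>
        Vector_Spaces.linear sA sB (\<lambda>b. f (As @ (y, b) # Bs) x))"

lemma linearD:
  assumes "Vector_Spaces.linear s1 s2 f"
  shows "f (x + y) = f x + f y" "f (s1 c x) = s2 c (f x)"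
  using assms by (auto simp: Vector_Spaces.linear_def dest: module_hom.add module_hom.scale)

lemma linear_0: "Vector_Spaces.linear s1 s2 f \<Longrightarrow> f 0 = 0"
  by (auto simp: Vector_Spaces.linear_def dest: module_hom.zero)

text \<open>
  On lists of the wrong length a cochain is zero, hence trivially linear in each slot. So multilinearity
  can be required on lists of all lengths, which makes it stable under fixing the first pair.
\<close>

lemma mem_cochains_iff:
  assumes A: "vector_space sA" and B: "vector_space sB"
  shows "f \<in> cochains sA sB n \<longleftrightarrow>
    multilinear sA sB f \<and> (\<forall>Xs x. length Xs \<noteq> n \<longrightarrow> f Xs x = 0)" (is "?l \<longleftrightarrow> ?r")
proof -
  interpret B: vector_space sB by (rule B)
  have zero: "Vector_Spaces.linear sA sB (\<lambda>x. 0)"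
    by (simp add: linear_iff_add_scale[OF A B])
  show ?thesis
  proof
    assume f: ?l
    then have 0: "f Xs x = 0" if "length Xs \<noteq> n" for Xs x
      using that by (simp add: cochains_def)
    have 1: "Vector_Spaces.linear sA sB (f Xs)" for Xs
    proof (cases "length Xs = n")
      case True
      then show ?thesis using f by (simp add: cochains_def)
    next
      case False
      then have "f Xs = (\<lambda>x. 0)" using 0 by blast
      then show ?thesis using zero by simp
    qed
    have 2: "Vector_Spaces.linear sA sB (\<lambda>a. f (As @ (a, y) # Bs) x) \<and>
        Vector_Spaces.linear sA sB (\<lambda>b. f (As @ (y, b) # Bs) x)" for As Bs y x
    proof (cases "length (As @ (y, y) # Bs) = n")
      case True
      then have "length As < n" by auto
      with True f have "Vector_Spaces.linear sA sB
            (\<lambda>a. f ((As @ (y, y) # Bs)[length As := (a, y)]) x) \<and>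
          Vector_Spaces.linear sA sB (\<lambda>b. f ((As @ (y, y) # Bs)[length As := (y, b)]) x)"
        unfolding cochains_def by blast
      then show ?thesis by simp
    qed (use zero 0 in simp)
    show ?r using 0 1 2 by (simp add: multilinear_def)
  next
    assume f: ?r
    then have 1: "Vector_Spaces.linear sA sB (\<lambda>a. f (As @ (a, y) # Bs) x) \<and>
        Vector_Spaces.linear sA sB (\<lambda>b. f (As @ (y, b) # Bs) x)" for As Bs y x
      by (simp add: multilinear_def)
    have "Vector_Spaces.linear sA sB (\<lambda>a. f (Xs[i := (a, y)]) x) \<and>
        Vector_Spaces.linear sA sB (\<lambda>b. f (Xs[i := (y, b)]) x)"
      if "length Xs = n \<and> i < n" for Xs i y x
      using that 1[of "take i Xs" y "drop (Suc i) Xs" x] by (simp add: upd_conv_take_nth_drop)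
    then show ?l using f by (auto simp: cochains_def multilinear_def)
  qed
qed

text \<open>The signs below only depend on parities, so multiplication with \<open>(-1)\<^sup>n\<close> needs no scalars.\<close>

definition signed :: "'n::semiring_parity \<Rightarrow> 'a::ab_group_add \<Rightarrow> 'a" where
  "signed n x = (if even n then x else - x)"

lemma signed_parity [simp]: "even n \<Longrightarrow> signed n x = x" "odd n \<Longrightarrow> signed n x = - x"
  by (simp_all add: signed_def)

lemma signed_0_right [simp]: "signed n 0 = 0"
  by (simp add: signed_def)

lemma signed_add: "signed n (x + y) = signed n x + signed n y"
  by (simp add: signed_def)

lemma signed_uminus: "signed n (- x) = - signed n x"
  by (simp add: signed_def)

lemma signed_diff: "signed n (x - y) = signed n x - signed n y"
  by (simp add: signed_def)

lemma signed_signed: "signed m (signed n x) = signed (m + n) x"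
  by (simp add: signed_def)

context vector_space
begin

lemma scale_minus_one_power: "scale ((-1) ^ n) x = signed n x"
  by (simp add: signed_def)

lemma scale_signed: "scale c (signed n x) = signed n (scale c x)"
  by (simp add: signed_def)

end

text \<open>
  Fixing the first pair of arguments lowers the degree by one. The facts on insertions below are proved
  by moving this operation across them.
\<close>

abbreviation prepend :: "'a \<times> 'a \<Rightarrow> ('a, 'b) cochain \<Rightarrow> ('a, 'b) cochain" where
  "prepend X P \<equiv> (\<lambda>Xs. P (X # Xs))"

text \<open>
  Only maps with equal source and target can be inserted into each other. The facts collected here
  move sums and scalars through an insertion.
\<close>

locale multilinear_cochain = vector_space s
  for s :: "'k::field \<Rightarrow> 'w::ab_group_add \<Rightarrow> 'w" +
  fixes P :: "('w, 'w) cochain"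
  assumes multilinear: "multilinear s s P"
begin

lemma add_last: "P Xs (x + y) = P Xs x + P Xs y"
  and scale_last: "P Xs (s c x) = s c (P Xs x)"
  using multilinear linear_iff_add_scale[OF vector_space_axioms vector_space_axioms]
  by (auto simp: multilinear_def)

lemma add_slot:
  "P (As @ (a + a', b) # Bs) x = P (As @ (a, b) # Bs) x + P (As @ (a', b) # Bs) x"
  "P (As @ (a, b + b') # Bs) x = P (As @ (a, b) # Bs) x + P (As @ (a, b') # Bs) x"
  and scale_slot:
  "P (As @ (s c a, b) # Bs) x = s c (P (As @ (a, b) # Bs) x)"
  "P (As @ (a, s c b) # Bs) x = s c (P (As @ (a, b) # Bs) x)"
  using multilinear linear_iff_add_scale[OF vector_space_axioms vector_space_axioms]
  by (auto simp: multilinear_def)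

lemma zero_last: "P Xs 0 = 0"
  using add_last[of Xs 0 0] by simp

lemma zero_slot: "P (As @ (0, b) # Bs) x = 0" "P (As @ (a, 0) # Bs) x = 0"
  using add_slot(1)[of As 0 0 b Bs x] add_slot(2)[of As a 0 0 Bs x] by simp_all

lemmas add_hd = add_slot[of "[]", simplified]
lemmas scale_hd = scale_slot[of "[]", simplified]
lemmas zero_hd = zero_slot[of "[]", simplified]

lemma prepend: "multilinear_cochain s (prepend X P)"
proof
  have "Vector_Spaces.linear s s (\<lambda>a. P ((X # As) @ (a, y) # Bs) x) \<and>
     Vector_Spaces.linear s s (\<lambda>b. P ((X # As) @ (y, b) # Bs) x)" for As Bs y x
    using multilinear unfolding multilinear_def by blast
  then show "multilinear s s (prepend X P)"
    using multilinear by (simp add: multilinear_def)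
qed

end

lemma multilinear_cochainI:
  assumes "vector_space s"
    and "\<And>Xs x y. P Xs (x + y) = P Xs x + P Xs y"
    and "\<And>Xs c x. P Xs (s c x) = s c (P Xs x)"
    and "\<And>As Bs a a' b x. P (As @ (a + a', b) # Bs) x = P (As @ (a, b) # Bs) x + P (As @ (a', b) # Bs) x"
    and "\<And>As Bs a b b' x. P (As @ (a, b + b') # Bs) x = P (As @ (a, b) # Bs) x + P (As @ (a, b') # Bs) x"
    and "\<And>As Bs a b c x. P (As @ (s c a, b) # Bs) x = s c (P (As @ (a, b) # Bs) x)"
    and "\<And>As Bs a b c x. P (As @ (a, s c b) # Bs) x = s c (P (As @ (a, b) # Bs) x)"
  shows "multilinear_cochain s P"
  using assms(2-)
  by (auto simp: multilinear_cochain_def multilinear_cochain_axioms_def assms(1) multilinear_def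
      linear_iff_add_scale[OF assms(1) assms(1)])


section \<open>Insertion of one cochain into another\<close>

text \<open>
  The composition \<open>P \<circ> Q\<close>, by recursion on the arguments: the first pair becomes an argument of \<open>P\<close>, an
  argument of \<open>Q\<close>, or the pair on which \<open>Q\<close> acts. The last alternative contributes only if \<open>Q []\<close> is
  nonzero, that is, in degree \<open>0\<close>. The number \<open>q\<close> stands for the degree of \<open>Q\<close> and enters through its
  parity alone, so that it may grow by one when an argument of \<open>Q\<close> is fixed.
\<close>

fun insertion :: "nat \<Rightarrow> ('w, 'w) cochain \<Rightarrow> ('w, 'w) cochain \<Rightarrow> ('w::ab_group_add, 'w) cochain" where
  "insertion q P Q [] x = P [] (Q [] x)"
| "insertion q P Q (X # Xs) x =
     signed q (insertion q (prepend X P) Q Xs x) + insertion (Suc q) P (prepend X Q) Xs x +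
     (P ((Q [] (fst X), snd X) # Xs) x + P ((fst X, Q [] (snd X)) # Xs) x)"

lemma insertion_parity: "even q = even q' \<Longrightarrow> insertion q P Q Xs x = insertion q' P Q Xs x"
proof (induction Xs arbitrary: q q' P Q)
  case (Cons X Xs)
  have "even (Suc q) = even (Suc q')" using Cons.prems by simp
  note * = Cons.IH[OF this] Cons.IH[OF Cons.prems]
  have "signed q = (signed q' :: 'a \<Rightarrow> 'a)" using Cons.prems by (auto simp: signed_def)
  then show ?case using * by simp
qed simp

lemma insertion_Suc_Suc [simp]: "insertion (Suc (Suc q)) = insertion q"
  by (intro ext insertion_parity) simp

lemma insertion_add_left:
  "insertion q (\<lambda>Xs x. P Xs x + P' Xs x) Q Xs x = insertion q P Q Xs x + insertion q P' Q Xs x"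
  by (induction Xs arbitrary: q P P' Q) (simp_all add: signed_add algebra_simps)

lemma insertion_0_left: "insertion q (\<lambda>Xs x. 0) Q Xs x = 0"
  by (induction Xs arbitrary: q Q) simp_all

lemma insertion_minus_left: "insertion q (\<lambda>Xs x. - P Xs x) Q Xs x = - insertion q P Q Xs x"
  by (induction Xs arbitrary: q P Q) (simp_all add: signed_uminus)

lemma insertion_signed_left:
  "insertion q (\<lambda>Xs x. signed n (P Xs x)) Q Xs x = signed n (insertion q P Q Xs x)"
  by (cases "even n") (simp_all add: insertion_minus_left)

lemma (in vector_space) insertion_scale_left:
  "insertion q (\<lambda>Xs x. scale c (P Xs x)) Q Xs x = scale c (insertion q P Q Xs x)"
  by (induction Xs arbitrary: q P Q) (simp_all add: scale_signed scale_right_distrib)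


context multilinear_cochain
begin

lemma prepend_add:
  "prepend (a + a', b) P = (\<lambda>Xs x. prepend (a, b) P Xs x + prepend (a', b) P Xs x)"
  "prepend (a, b + b') P = (\<lambda>Xs x. prepend (a, b) P Xs x + prepend (a, b') P Xs x)"
  and prepend_scale:
  "prepend (s c a, b) P = (\<lambda>Xs x. s c (prepend (a, b) P Xs x))"
  "prepend (a, s c b) P = (\<lambda>Xs x. s c (prepend (a, b) P Xs x))"
  by (simp_all add: add_hd scale_hd fun_eq_iff)

lemma prepend_0: "prepend (0, b) P = (\<lambda>Xs x. 0)" "prepend (a, 0) P = (\<lambda>Xs x. 0)"
  by (simp_all add: zero_hd fun_eq_iff)

lemma insertion_add_right:
  "insertion q P (\<lambda>Xs x. Q Xs x + Q' Xs x) Xs x = insertion q P Q Xs x + insertion q P Q' Xs x"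
  using multilinear_cochain_axioms
proof (induction Xs arbitrary: q P Q Q')
  case Nil
  then interpret multilinear_cochain s P .
  show ?case by (simp add: add_last)
next
  case (Cons X Xs)
  interpret multilinear_cochain s P by (rule Cons.prems)
  show ?case
    by (simp add: Cons.IH Cons.prems prepend add_hd signed_add ac_simps)
qed

lemma insertion_scale_right:
  "insertion q P (\<lambda>Xs x. s c (Q Xs x)) Xs x = s c (insertion q P Q Xs x)"
  using multilinear_cochain_axioms
proof (induction Xs arbitrary: q P Q)
  case Nil
  then interpret multilinear_cochain s P .
  show ?case by (simp add: scale_last)
next
  case (Cons X Xs)
  interpret multilinear_cochain s P by (rule Cons.prems)
  show ?case
    by (simp add: Cons.IH Cons.prems prepend scale_hd scale_signed scale_right_distrib)
qed

lemma insertion_0_right: "insertion q P (\<lambda>Xs x. 0) Xs x = 0"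
  using insertion_add_right[of q "\<lambda>Xs x. 0" "\<lambda>Xs x. 0" Xs x] by simp

lemma insertion_minus_right:
  "insertion q P (\<lambda>Xs x. - Q Xs x) Xs x = - insertion q P Q Xs x"
  using insertion_scale_right[of q "-1" Q Xs x] by simp

lemma insertion_diff_right:
  "insertion q P (\<lambda>Xs x. Q Xs x - Q' Xs x) Xs x = insertion q P Q Xs x - insertion q P Q' Xs x"
  using insertion_add_right[of q Q "\<lambda>Xs x. - Q' Xs x" Xs x] by (simp add: insertion_minus_right)

lemma insertion_signed_right:
  "insertion q P (\<lambda>Xs x. signed n (Q Xs x)) Xs x = signed n (insertion q P Q Xs x)"
  by (cases "even n") (simp_all add: insertion_minus_right)

end

lemma multilinear_insertion:
  assumes "multilinear_cochain s P" "multilinear_cochain s Q"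
  shows "multilinear_cochain s (insertion q P Q)"
proof -
  interpret vector_space s using assms(1) by (simp add: multilinear_cochain_def)
  have last: "insertion q P Q Xs (x + y) = insertion q P Q Xs x + insertion q P Q Xs y \<and>
      insertion q P Q Xs (s c x) = s c (insertion q P Q Xs x)"
    if "multilinear_cochain s P" "multilinear_cochain s Q" for q P Q Xs c x y
    using that
  proof (induction Xs arbitrary: q P Q)
    case (Nil q P Q)
    interpret P: multilinear_cochain s P by (rule Nil.prems)
    interpret Q: multilinear_cochain s Q by (rule Nil.prems)
    show ?case by (simp add: P.add_last Q.add_last P.scale_last Q.scale_last)
  next
    case (Cons X Xs q P Q)
    interpret P: multilinear_cochain s P by (rule Cons.prems)
    interpret Q: multilinear_cochain s Q by (rule Cons.prems)
    show ?case
      by (simp add: P.add_last P.scale_last Cons.IH P.prepend Q.prepend Cons.prems signed_add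
          scale_signed scale_right_distrib)
  qed
  have slot:
    "insertion q P Q (As @ (a + a', b) # Bs) x =
       insertion q P Q (As @ (a, b) # Bs) x + insertion q P Q (As @ (a', b) # Bs) x \<and>
    insertion q P Q (As @ (a, b + b') # Bs) x =
       insertion q P Q (As @ (a, b) # Bs) x + insertion q P Q (As @ (a, b') # Bs) x \<and>
    insertion q P Q (As @ (s c a, b) # Bs) x = s c (insertion q P Q (As @ (a, b) # Bs) x) \<and>
    insertion q P Q (As @ (a, s c b) # Bs) x = s c (insertion q P Q (As @ (a, b) # Bs) x)"
    if "multilinear_cochain s P" "multilinear_cochain s Q" for q P Q As Bs a b c a' b' x
    using that
  proof (induction As arbitrary: q P Q)
    case (Nil q P Q)
    interpret P: multilinear_cochain s P by (rule Nil.prems)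
    interpret Q: multilinear_cochain s Q by (rule Nil.prems)
    show ?case
      by (simp add: P.add_hd P.scale_hd P.prepend_add P.prepend_scale Q.prepend_add Q.prepend_scale Q.add_last Q.scale_last
          insertion_add_left P.insertion_add_right insertion_scale_left P.insertion_scale_right
          signed_add scale_signed scale_right_distrib ac_simps)
  next
    case (Cons X As q P Q)
    interpret P: multilinear_cochain s P by (rule Cons.prems)
    interpret Q: multilinear_cochain s Q by (rule Cons.prems)
    show ?case
      by (simp add: P.add_slot[of "_ # _", simplified] P.scale_slot[of "_ # _", simplified]
          Cons.IH P.prepend Q.prepend Cons.prems signed_add scale_signed scale_right_distrib)
  qed
  show ?thesis
    using assms by (intro multilinear_cochainI vector_space_axioms) (simp_all add: last slot)
qed

text \<open>
  Parities in place of degrees: fixing an argument of a map of degree \<open>0\<close> would lead to degree \<open>-1\<close>,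
  while parities need no separate treatment of this case.
\<close>

definition parity_homogeneous :: "nat \<Rightarrow> ('w, 'b::zero) cochain \<Rightarrow> bool" where
  "parity_homogeneous q Q \<longleftrightarrow> (\<forall>Xs x. odd (length Xs + q) \<longrightarrow> Q Xs x = 0)"

lemma parity_homogeneous_prepend:
  "parity_homogeneous q Q \<Longrightarrow> parity_homogeneous (Suc q) (prepend X Q)"
  by (auto simp: parity_homogeneous_def)

lemma insertion_diff_left:
  "insertion q (\<lambda>Xs x. P Xs x - P' Xs x) Q Xs x = insertion q P Q Xs x - insertion q P' Q Xs x"
  using insertion_add_left[of q P "\<lambda>Xs x. - P' Xs x" Q Xs x] by (simp add: insertion_minus_left)

lemma prepend_insertion:
  "prepend X (insertion q P Q) = (\<lambda>Xs x.
     signed q (insertion q (prepend X P) Q Xs x) + insertion (Suc q) P (prepend X Q) Xs x +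
     (prepend (Q [] (fst X), snd X) P Xs x + prepend (fst X, Q [] (snd X)) P Xs x))"
  by (intro ext) simp

text \<open>
  The associator of the insertion is graded symmetric in its last two arguments. When the first pair
  \<open>X\<close> is fixed, the associators of \<open>P, Q, R\<close> turn into those where \<open>X\<close> was given to \<open>P\<close>, \<open>Q\<close> or \<open>R\<close>, which are
  covered by the induction hypothesis, and into terms where \<open>Q\<close> or \<open>R\<close> acts on \<open>X\<close>. Among the latter,
  the terms with a single action cancel between the two sides, the nested actions on one entry of \<open>X\<close>
  cancel within each associator, and the simultaneous actions on both entries are visibly symmetric;
  a map of odd parity does not act at all.
\<close>

theorem insertion_pre_Lie:
  assumes "multilinear_cochain s P" "multilinear_cochain s Q" "multilinear_cochain s R"
    and "parity_homogeneous q Q" "parity_homogeneous r R"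
  shows "insertion r (insertion q P Q) R Xs x - insertion (q + r) P (insertion r Q R) Xs x =
    signed (q * r) (insertion q (insertion r P R) Q Xs x - insertion (q + r) P (insertion q R Q) Xs x)"
  using assms
proof (induction Xs arbitrary: P Q R q r)
  case Nil
  then interpret multilinear_cochain s P by simp
  show ?case by simp
next
  case (Cons X Xs)
  interpret multilinear_cochain s P by fact
  interpret Q: multilinear_cochain s Q by fact
  interpret R: multilinear_cochain s R by fact
  have Q0: "Q [] y = 0" if "odd q" for y
    using Cons.prems(4) that by (simp add: parity_homogeneous_def)
  have R0: "R [] y = 0" if "odd r" for y
    using Cons.prems(5) that by (simp add: parity_homogeneous_def)
  note Q' = parity_homogeneous_prepend[OF Cons.prems(4), of X]
  note R' = parity_homogeneous_prepend[OF Cons.prems(5), of X]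
  note IH = Cons.IH[OF prepend[of X] Cons.prems(2-5)]
    Cons.IH[OF Cons.prems(1) Q.prepend Cons.prems(3) Q' Cons.prems(5)]
    Cons.IH[OF Cons.prems(1,2) R.prepend Cons.prems(4) R']
  note IH = IH[THEN diff_eq_eq[THEN iffD1]]
  note expand = prepend_insertion insertion_add_left insertion_signed_left insertion_minus_left
    insertion_0_left insertion_add_right insertion_signed_right insertion_minus_right
    insertion_0_right insertion_diff_left insertion_diff_right prepend_0 Q.prepend_0 R.prepend_0 zero_hd
  show ?case
  proof (cases "even q")
    case True
    then have parity: "insertion (Suc (q + r)) = (insertion (Suc r) :: ('b, 'b) cochain \<Rightarrow> _)"
      and parity': "even r \<Longrightarrow> insertion (Suc q) = (insertion (Suc r) :: ('b, 'b) cochain \<Rightarrow> _)"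
      by (auto intro!: ext insertion_parity)
    show ?thesis
      using True Q0 R0
      by (cases "even r"; simp add: expand IH algebra_simps; simp add: parity parity')
  next
    case False
    then have parity: "even r \<Longrightarrow> insertion (Suc (q + r)) = (insertion (Suc q) :: ('b, 'b) cochain \<Rightarrow> _)"
      by (auto intro!: ext insertion_parity)
    show ?thesis
      using False Q0 R0
      by (cases "even r"; simp add: expand IH algebra_simps; simp add: parity)
  qed
qed


section \<open>Shuffle sums\<close>

text \<open>
  The sum over all ways to split a list into a first block of length \<open>i\<close> and a second block, keeping the
  order within the blocks. An entry of the second block passes those entries of the first block that
  follow it in the list, which gives the sign of the shuffle.
\<close>

fun shuffle_sum :: "nat \<Rightarrow> ('x list \<Rightarrow> 'x list \<Rightarrow> 'b::ab_group_add) \<Rightarrow> 'x list \<Rightarrow> 'b" where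
  "shuffle_sum i \<Phi> [] = (if i = 0 then \<Phi> [] [] else 0)"
| "shuffle_sum i \<Phi> (X # Xs) =
     (if i = 0 then 0 else shuffle_sum (i - 1) (\<lambda>A. \<Phi> (X # A)) Xs) +
     signed i (shuffle_sum i (\<lambda>A B. \<Phi> A (X # B)) Xs)"

lemma shuffle_sum_eq_0: "length Xs < i \<Longrightarrow> shuffle_sum i \<Phi> Xs = 0"
  by (induction Xs arbitrary: i \<Phi>) auto

lemma shuffle_sum_add:
  "shuffle_sum i (\<lambda>A B. \<Phi> A B + \<Psi> A B) Xs = shuffle_sum i \<Phi> Xs + shuffle_sum i \<Psi> Xs"
  by (induction Xs arbitrary: i \<Phi> \<Psi>) (simp_all add: signed_add)

text \<open>
  The same recursion from the other end of the list. This is the form that fits shuffle permutations: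
  taking away the largest value leaves a permutation of \<open>{1..n - 1}\<close>, without renumbering.
\<close>

lemma shuffle_sum_snoc:
  fixes \<Phi> :: "'x list \<Rightarrow> 'x list \<Rightarrow> 'b::ab_group_add"
  shows "shuffle_sum i \<Phi> (Xs @ [X]) = shuffle_sum i (\<lambda>A B. \<Phi> A (B @ [X])) Xs +
     (if i = 0 then 0
      else signed (Suc (length Xs) - i) (shuffle_sum (i - 1) (\<lambda>A. \<Phi> (A @ [X])) Xs))"
proof (induction Xs arbitrary: i \<Phi>)
  case Nil
  show ?case by (cases i) auto
next
  case (Cons Y Xs)
  show ?case
  proof (cases i)
    case 0
    then show ?thesis by (simp add: Cons.IH)
  next
    case (Suc m)
    show ?thesis
    proof (cases "m \<le> length Xs")
      case True
      then have "odd (Suc m + (length Xs - m)) = even (length Xs)" by simp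
      with True Suc show ?thesis
        by (cases m) (auto simp: Cons.IH signed_add signed_signed signed_def Suc_diff_le)
    next
      case False
      then have "shuffle_sum m \<Psi> Xs = 0" for \<Psi> :: "'x list \<Rightarrow> 'x list \<Rightarrow> 'b"
        by (simp add: shuffle_sum_eq_0)
      moreover have "shuffle_sum (Suc m) \<Psi> Xs = 0" for \<Psi> :: "'x list \<Rightarrow> 'x list \<Rightarrow> 'b"
        using False by (simp add: shuffle_sum_eq_0)
      ultimately show ?thesis
        using Suc by (cases m) (auto simp: Cons.IH)
    qed
  qed
qed

text \<open>
  The cyclic permutation that carries position \<open>i\<close> to the end \<open>n\<close>, preserving the order of the others.
\<close>

definition move_to_end :: "nat \<Rightarrow> nat \<Rightarrow> nat \<Rightarrow> nat" where
  "move_to_end i n m = (if m = i then n else if i < m \<and> m \<le> n then m - 1 else m)"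

lemma move_to_end_Suc: "i \<le> n \<Longrightarrow> move_to_end i (Suc n) = transpose n (Suc n) \<circ> move_to_end i n"
  by (auto simp: move_to_end_def transpose_def fun_eq_iff)

lemma move_to_end_permutes:
  assumes "i \<le> n"
  shows "move_to_end i n permutes {i..n}" and "sign (move_to_end i n) = (-1) ^ (n - i)"
proof -
  have "move_to_end i n permutes {i..n} \<and> sign (move_to_end i n) = (-1) ^ (n - i)"
    using assms
  proof (induction n rule: dec_induct)
    case base
    have "move_to_end i i = id" by (auto simp: move_to_end_def)
    then show ?case by (simp add: permutes_id del: id_apply flip: id_def)
  next
    case (step n)
    have t: "transpose n (Suc n) permutes {i..Suc n}"
      using step.hyps by (intro permutes_swap_id) auto
    have m: "move_to_end i n permutes {i..Suc n}"
      using step.IH by (auto intro: permutes_subset)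
    have "sign (move_to_end i (Suc n)) = - sign (move_to_end i n)"
      unfolding move_to_end_Suc[OF step.hyps(1)]
      using permutation_permutes t m by (subst sign_compose) (auto simp: sign_swap_id)
    then have "sign (move_to_end i (Suc n)) = (-1) ^ (Suc n - i)"
      using step.IH step.hyps by (simp add: Suc_diff_le)
    moreover have "move_to_end i (Suc n) permutes {i..Suc n}"
      unfolding move_to_end_Suc[OF step.hyps(1)] by (rule permutes_compose[OF m t])
    ultimately show ?case by blast
  qed
  then show "move_to_end i n permutes {i..n}" "sign (move_to_end i n) = (-1) ^ (n - i)"
    by blast+
qed

lemma finite_shuffle_perms: "finite (shuffle_perms i j)"
  by (rule finite_subset[OF _ finite_permutations[of "{1..i + j}"]]) (auto simp: shuffle_perms_def)

lemma strict_mono_on_le_bound: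
  fixes f :: "nat \<Rightarrow> nat"
  assumes "strict_mono_on A f" "m \<in> A" "m' \<in> A" "\<And>k. k \<in> A \<Longrightarrow> f k \<le> f m" "m \<le> m'"
  shows "m = m'"
  using assms by (metis leD le_neq_implies_less strict_mono_onD)

lemma shuffle_perms_last_block:
  "{\<sigma> \<in> shuffle_perms i (Suc j). \<sigma> (Suc (i + j)) = Suc (i + j)} = shuffle_perms i j" (is "?l = ?r")
proof (intro set_eqI iffI)
  fix \<sigma> assume "\<sigma> \<in> ?l"
  then have p: "\<sigma> permutes {1..Suc (i + j)}" and fixed: "\<sigma> (Suc (i + j)) = Suc (i + j)"
    and m: "strict_mono_on {1..i} \<sigma>" "strict_mono_on {i + 1..Suc (i + j)} \<sigma>"
    by (auto simp: shuffle_perms_def)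
  have "\<sigma> permutes {1..i + j}"
    by (rule permutes_superset[OF p]) (use fixed in \<open>auto simp: le_Suc_eq\<close>)
  then show "\<sigma> \<in> ?r" using m by (auto simp: shuffle_perms_def strict_mono_on_def)
next
  fix \<sigma> assume \<sigma>: "\<sigma> \<in> ?r"
  then have p: "\<sigma> permutes {1..i + j}"
    and m: "strict_mono_on {1..i} \<sigma>" "strict_mono_on {i + 1..i + j} \<sigma>"
    by (auto simp: shuffle_perms_def)
  have fixed: "\<sigma> (Suc (i + j)) = Suc (i + j)" using permutes_not_in[OF p] by simp
  have le: "\<sigma> k \<le> i + j" if "k \<in> {i + 1..i + j}" for k
    using permutes_in_image[OF p, of k] that by auto
  have "strict_mono_on {i + 1..i + Suc j} \<sigma>"
  proof (rule strict_mono_onI)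
    fix r k assume *: "r \<in> {i + 1..i + Suc j}" "k \<in> {i + 1..i + Suc j}" "r < k"
    show "\<sigma> r < \<sigma> k"
    proof (cases "k = Suc (i + j)")
      case True
      then show ?thesis using le[of r] * fixed by simp
    next
      case False
      then show ?thesis using strict_mono_onD[OF m(2)] * by auto
    qed
  qed
  moreover have "\<sigma> permutes {1..i + Suc j}"
    using p by (rule permutes_subset) auto
  ultimately show "\<sigma> \<in> ?l" using m fixed by (simp add: shuffle_perms_def)
qed

text \<open>
  A shuffle whose first block ends with the largest value arises from a shuffle of the remaining values:
  the position of the largest value has to be moved over the second block.
\<close>

lemma shuffle_perms_first_block:
  "{\<sigma> \<in> shuffle_perms (Suc i) j. \<sigma> (Suc i) = Suc (i + j)} =
     (\<lambda>\<sigma>. \<sigma> \<circ> move_to_end (Suc i) (Suc (i + j))) ` shuffle_perms i j" (is "?l = ?f ` ?r")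
proof (intro set_eqI iffI)
  let ?c = "move_to_end (Suc i) (Suc (i + j))"
  have c: "?c permutes {1..Suc (i + j)}"
    using move_to_end_permutes(1)[of "Suc i" "Suc (i + j)"] by (rule permutes_subset) auto
  have c_lt: "?c k = k" if "k < Suc i" for k using that by (simp add: move_to_end_def)
  have c_Suc: "?c (Suc k) = k" if "i < k" "k \<le> i + j" for k
    using that by (simp add: move_to_end_def)
  have c_i: "?c (Suc i) = Suc (i + j)" by (simp add: move_to_end_def)
  {
    fix \<sigma> assume "\<sigma> \<in> ?l"
    then have p: "\<sigma> permutes {1..Suc (i + j)}" and fixed: "\<sigma> (Suc i) = Suc (i + j)"
      and m: "strict_mono_on {1..Suc i} \<sigma>" "strict_mono_on {i + 2..Suc (i + j)} \<sigma>"
      by (auto simp: shuffle_perms_def)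
    define \<tau> where "\<tau> = \<sigma> \<circ> inv ?c"
    have \<tau>c: "\<tau> (?c k) = \<sigma> k" for k
      unfolding \<tau>_def using permutes_inverses(2)[OF c] by simp
    have \<sigma>: "\<sigma> = \<tau> \<circ> ?c" using \<tau>c by (simp add: fun_eq_iff)
    have "\<tau> permutes {1..Suc (i + j)}"
      unfolding \<tau>_def by (rule permutes_compose[OF permutes_inv[OF c] p])
    moreover have "\<tau> (Suc (i + j)) = Suc (i + j)" using \<tau>c[of "Suc i"] c_i fixed by simp
    ultimately have "\<tau> permutes {1..i + j}"
      by (rule_tac permutes_superset) (auto simp: le_Suc_eq)
    moreover have "strict_mono_on {1..i} \<tau>"
    proof (rule strict_mono_onI)
      fix r k assume *: "r \<in> {1..i}" "k \<in> {1..i}" "r < k"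
      then have "\<tau> r = \<sigma> r" "\<tau> k = \<sigma> k" using \<tau>c[of r] \<tau>c[of k] c_lt by auto
      then show "\<tau> r < \<tau> k" using strict_mono_onD[OF m(1), of r k] * by auto
    qed
    moreover have "strict_mono_on {i + 1..i + j} \<tau>"
    proof (rule strict_mono_onI)
      fix r k assume *: "r \<in> {i + 1..i + j}" "k \<in> {i + 1..i + j}" "r < k"
      then have "\<tau> r = \<sigma> (Suc r)" "\<tau> k = \<sigma> (Suc k)"
        using \<tau>c[of "Suc r"] \<tau>c[of "Suc k"] c_Suc by auto
      then show "\<tau> r < \<tau> k" using strict_mono_onD[OF m(2), of "Suc r" "Suc k"] * by auto
    qed
    ultimately have "\<tau> \<in> ?r" by (simp add: shuffle_perms_def)
    then show "\<sigma> \<in> ?f ` ?r" using \<sigma> by blast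
  }
  {
    fix \<sigma> assume "\<sigma> \<in> ?f ` ?r"
    then obtain \<tau> where \<sigma>: "\<sigma> = \<tau> \<circ> ?c" and p: "\<tau> permutes {1..i + j}"
      and m: "strict_mono_on {1..i} \<tau>" "strict_mono_on {i + 1..i + j} \<tau>"
      by (auto simp: shuffle_perms_def)
    have fixed: "\<tau> (Suc (i + j)) = Suc (i + j)" using permutes_not_in[OF p] by simp
    have \<sigma>i: "\<sigma> (Suc i) = Suc (i + j)" by (simp add: \<sigma> c_i fixed)
    have le: "\<tau> k \<le> i + j" if "k \<in> {1..i + j}" for k
      using permutes_in_image[OF p, of k] that by auto
    have "strict_mono_on {1..Suc i} \<sigma>"
    proof (rule strict_mono_onI)
      fix r k assume *: "r \<in> {1..Suc i}" "k \<in> {1..Suc i}" "r < k"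
      then have r: "\<sigma> r = \<tau> r" by (simp add: \<sigma> c_lt)
      show "\<sigma> r < \<sigma> k"
      proof (cases "k = Suc i")
        case True
        then show ?thesis using le[of r] * r \<sigma>i by simp
      next
        case False
        then have "\<sigma> k = \<tau> k" using * by (simp add: \<sigma> c_lt)
        then show ?thesis using strict_mono_onD[OF m(1), of r k] * False r by simp
      qed
    qed
    moreover have "strict_mono_on {i + 2..Suc (i + j)} \<sigma>"
    proof (rule strict_mono_onI)
      fix r k assume *: "r \<in> {i + 2..Suc (i + j)}" "k \<in> {i + 2..Suc (i + j)}" "r < k"
      then have "\<sigma> r = \<tau> (r - 1)" "\<sigma> k = \<tau> (k - 1)"
        using c_Suc[of "r - 1"] c_Suc[of "k - 1"] by (auto simp: \<sigma>)
      then show "\<sigma> r < \<sigma> k" using strict_mono_onD[OF m(2), of "r - 1" "k - 1"] * by auto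
    qed
    moreover have "\<tau> permutes {1..Suc (i + j)}"
      using p by (rule permutes_subset) auto
    then have "\<sigma> permutes {1..Suc (i + j)}" unfolding \<sigma> by (rule permutes_compose[OF c])
    ultimately show "\<sigma> \<in> ?l" using \<sigma>i by (simp add: shuffle_perms_def)
  }
qed

text \<open>
  A shuffle is increasing on both blocks, so its largest value stands at the end of one of them.
\<close>

lemma shuffle_perms_position_of_max:
  assumes \<sigma>: "\<sigma> \<in> shuffle_perms i j" and n: "0 < i + j"
  shows "(0 < i \<and> \<sigma> i = i + j) \<or> (0 < j \<and> \<sigma> (i + j) = i + j)"
proof -
  have p: "\<sigma> permutes {1..i + j}"
    and m: "strict_mono_on {1..i} \<sigma>" "strict_mono_on {i + 1..i + j} \<sigma>"
    using \<sigma> by (auto simp: shuffle_perms_def)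
  obtain k where k: "k \<in> {1..i + j}" "\<sigma> k = i + j"
    using permutes_image[OF p] n by (metis atLeastAtMost_iff imageE le_refl less_eq_Suc_le One_nat_def)
  have le: "\<sigma> k' \<le> \<sigma> k" if "k' \<in> {1..i + j}" for k'
    using permutes_in_image[OF p, of k'] that k by auto
  show ?thesis
  proof (cases "k \<le> i")
    case True
    then have "k = i"
      using k le by (intro strict_mono_on_le_bound[OF m(1)]) auto
    then show ?thesis using k by auto
  next
    case False
    then have "k = i + j"
      using k le by (intro strict_mono_on_le_bound[OF m(2)]) auto
    then show ?thesis using k False by auto
  qed
qed

definition perm_shuffle_sum ::
  "('k::field \<Rightarrow> 'b \<Rightarrow> 'b::ab_group_add) \<Rightarrow> nat \<Rightarrow> nat \<Rightarrow> ('x list \<Rightarrow> 'x list \<Rightarrow> 'b) \<Rightarrow> 'x list \<Rightarrow> 'b" where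
  "perm_shuffle_sum s i j \<Phi> Xs = (\<Sum>\<sigma>\<in>shuffle_perms i j. s (of_int (sign \<sigma>))
     (\<Phi> (map (\<lambda>m. Xs ! (\<sigma> m - 1)) [1..<i + 1]) (map (\<lambda>m. Xs ! (\<sigma> m - 1)) [i + 1..<i + j + 1])))"

text \<open>
  Induction on the last entry of the list, which is the one that the largest value of a shuffle refers
  to. The shuffles split according to the block that contains this value.
\<close>

lemma (in vector_space) perm_shuffle_sum_eq:
  "length Xs = i + j \<Longrightarrow> perm_shuffle_sum scale i j \<Phi> Xs = shuffle_sum i \<Phi> Xs"
proof (induction Xs arbitrary: i j \<Phi> rule: rev_induct)
  case Nil
  then have "shuffle_perms i j = {id}" by (auto simp: shuffle_perms_def strict_mono_on_def)
  then show ?case using Nil by (simp add: perm_shuffle_sum_def)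
next
  case (snoc X Xs)
  define n where "n = i + j"
  have n: "length Xs = n - 1" "0 < n" using snoc.prems by (auto simp: n_def)
  define g where "g \<sigma> = scale (of_int (sign \<sigma>)) (\<Phi> (map (\<lambda>m. (Xs @ [X]) ! (\<sigma> m - 1)) [1..<i + 1])
    (map (\<lambda>m. (Xs @ [X]) ! (\<sigma> m - 1)) [i + 1..<i + j + 1]))" for \<sigma>
  define S1 where "S1 = {\<sigma> \<in> shuffle_perms i j. 0 < j \<and> \<sigma> n = n}"
  define S2 where "S2 = {\<sigma> \<in> shuffle_perms i j. 0 < i \<and> \<sigma> i = n}"
  have "shuffle_perms i j = S1 \<union> S2"
    using shuffle_perms_position_of_max[of _ i j] n by (auto simp: S1_def S2_def n_def)
  moreover have "S1 \<inter> S2 = {}"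
  proof -
    have "i = n" if "\<sigma> permutes {1..n}" "\<sigma> i = n" "\<sigma> n = n" for \<sigma>
      using permutes_inj[OF that(1)] that(2,3) by (metis injD)
    then show ?thesis by (auto simp: S1_def S2_def shuffle_perms_def n_def)
  qed
  moreover have "finite S1" "finite S2" using finite_shuffle_perms by (auto simp: S1_def S2_def)
  ultimately have split: "perm_shuffle_sum scale i j \<Phi> (Xs @ [X]) = sum g S1 + sum g S2"
    by (simp add: perm_shuffle_sum_def g_def sum.union_disjoint)
  have nth: "(Xs @ [X]) ! (\<sigma> m - 1) = Xs ! (\<sigma> m - 1)"
    if "\<sigma> permutes {1..n - 1}" "m \<in> {1..n - 1}" for \<sigma> m
    using permutes_in_image[OF that(1), of m] that(2) n by (auto simp: nth_append)
  have 1: "sum g S1 = shuffle_sum i (\<lambda>A B. \<Phi> A (B @ [X])) Xs"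
  proof (cases j)
    case 0
    then show ?thesis using snoc.prems by (simp add: S1_def shuffle_sum_eq_0)
  next
    case (Suc j')
    have S1: "S1 = shuffle_perms i j'"
      using shuffle_perms_last_block[of i j'] by (simp add: S1_def Suc n_def)
    have "g \<sigma> = scale (of_int (sign \<sigma>)) (\<Phi> (map (\<lambda>m. Xs ! (\<sigma> m - 1)) [1..<i + 1])
        (map (\<lambda>m. Xs ! (\<sigma> m - 1)) [i + 1..<i + j' + 1] @ [X]))" if "\<sigma> \<in> shuffle_perms i j'" for \<sigma>
    proof -
      have p: "\<sigma> permutes {1..n - 1}" using that by (simp add: shuffle_perms_def n_def Suc)
      have "\<sigma> (Suc (i + j')) = Suc (i + j')"
        using permutes_not_in[OF p] by (simp add: n_def Suc)
      moreover have "(Xs @ [X]) ! (i + j') = X"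
        using n by (simp add: nth_append n_def Suc)
      ultimately show ?thesis
        using n nth[OF p] by (auto simp: g_def Suc n_def intro!: arg_cong[of _ _ "scale _"] arg_cong2[of _ _ _ _ \<Phi>])
    qed
    then have "sum g S1 = perm_shuffle_sum scale i j' (\<lambda>A B. \<Phi> A (B @ [X])) Xs"
      by (simp add: S1 perm_shuffle_sum_def)
    also have "\<dots> = shuffle_sum i (\<lambda>A B. \<Phi> A (B @ [X])) Xs"
      by (rule snoc.IH) (use snoc.prems Suc in simp)
    finally show ?thesis .
  qed
  have 2: "sum g S2 = (if i = 0 then 0
      else signed (Suc (length Xs) - i) (shuffle_sum (i - 1) (\<lambda>A. \<Phi> (A @ [X])) Xs))"
  proof (cases i)
    case 0
    then show ?thesis by (simp add: S2_def)
  next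
    case (Suc i')
    let ?c = "move_to_end i n"
    have S2: "S2 = (\<lambda>\<sigma>. \<sigma> \<circ> ?c) ` shuffle_perms i' j"
      using shuffle_perms_first_block[of i' j] by (simp add: S2_def Suc n_def)
    have c: "?c permutes {i..n}" "sign ?c = (-1) ^ j"
      using move_to_end_permutes[of i n] by (simp_all add: n_def)
    have inj: "inj_on (\<lambda>\<sigma>. \<sigma> \<circ> ?c) (shuffle_perms i' j)"
      using permutes_surj[OF c(1)] by (auto simp: inj_on_def fun_eq_iff) (metis surjD)
    have "g (\<sigma> \<circ> ?c) = signed j (scale (of_int (sign \<sigma>)) (\<Phi> (map (\<lambda>m. Xs ! (\<sigma> m - 1)) [1..<i' + 1] @ [X])
        (map (\<lambda>m. Xs ! (\<sigma> m - 1)) [i' + 1..<i' + j + 1])))" if "\<sigma> \<in> shuffle_perms i' j" for \<sigma>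
    proof -
      have p: "\<sigma> permutes {1..n - 1}" using that by (simp add: shuffle_perms_def n_def Suc)
      have "permutation \<sigma>" "permutation ?c" using p c permutation_permutes by blast+
      then have "sign (\<sigma> \<circ> ?c) = sign \<sigma> * (-1) ^ j" by (simp add: sign_compose c(2))
      then have sgn: "scale (of_int (sign (\<sigma> \<circ> ?c))) y = signed j (scale (of_int (sign \<sigma>)) y)" for y
        by (simp add: signed_def)
      have fixed: "\<sigma> n = n" using permutes_not_in[OF p] n by simp
      have A: "map (\<lambda>m. (Xs @ [X]) ! ((\<sigma> \<circ> ?c) m - 1)) [1..<i + 1] =
          map (\<lambda>m. Xs ! (\<sigma> m - 1)) [1..<i' + 1] @ [X]"
      proof -
        have "map (\<lambda>m. (Xs @ [X]) ! ((\<sigma> \<circ> ?c) m - 1)) [1..<i' + 1] =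
            map (\<lambda>m. Xs ! (\<sigma> m - 1)) [1..<i' + 1]"
        proof (rule map_cong[OF refl])
          fix m assume m: "m \<in> set [1..<i' + 1]"
          then have "?c m = m" by (auto simp: move_to_end_def Suc)
          then show "(Xs @ [X]) ! ((\<sigma> \<circ> ?c) m - 1) = Xs ! (\<sigma> m - 1)"
            using nth[OF p, of m] m by (auto simp: Suc n_def)
        qed
        moreover have "(Xs @ [X]) ! ((\<sigma> \<circ> ?c) i - 1) = X"
          using n fixed by (simp add: move_to_end_def nth_append)
        ultimately show ?thesis by (simp add: Suc)
      qed
      have B: "map (\<lambda>m. (Xs @ [X]) ! ((\<sigma> \<circ> ?c) m - 1)) [i + 1..<i + j + 1] =
          map (\<lambda>m. Xs ! (\<sigma> m - 1)) [i' + 1..<i' + j + 1]"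
      proof -
        have "[i + 1..<i + j + 1] = map Suc [i' + 1..<i' + j + 1]"
          by (simp add: Suc map_Suc_upt)
        then have "map (\<lambda>m. (Xs @ [X]) ! ((\<sigma> \<circ> ?c) m - 1)) [i + 1..<i + j + 1] =
            map (\<lambda>m. (Xs @ [X]) ! (\<sigma> (?c (Suc m)) - 1)) [i' + 1..<i' + j + 1]" by simp
        also have "\<dots> = map (\<lambda>m. Xs ! (\<sigma> m - 1)) [i' + 1..<i' + j + 1]"
        proof (rule map_cong[OF refl])
          fix m assume m: "m \<in> set [i' + 1..<i' + j + 1]"
          then have "?c (Suc m) = m" by (auto simp: move_to_end_def Suc n_def)
          then show "(Xs @ [X]) ! (\<sigma> (?c (Suc m)) - 1) = Xs ! (\<sigma> m - 1)"
            using nth[OF p, of m] m by (auto simp: Suc n_def)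
        qed
        finally show ?thesis .
      qed
      show ?thesis unfolding g_def sgn A B ..
    qed
    then have "sum g S2 = signed j (perm_shuffle_sum scale i' j (\<lambda>A. \<Phi> (A @ [X])) Xs)"
      unfolding S2 sum.reindex[OF inj] by (simp add: perm_shuffle_sum_def signed_def sum_negf)
    also have "perm_shuffle_sum scale i' j (\<lambda>A. \<Phi> (A @ [X])) Xs = shuffle_sum i' (\<lambda>A. \<Phi> (A @ [X])) Xs"
      by (rule snoc.IH) (use snoc.prems Suc in simp)
    finally show ?thesis using snoc.prems by (simp add: Suc)
  qed
  show ?case unfolding split 1 2 by (simp add: shuffle_sum_snoc)
qed


section \<open>The composition of cochains is an insertion\<close>

text \<open>
  The defining formula of \<open>circ\<close>, with the permutations absorbed into shuffle sums. The pair on which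
  \<open>Q\<close> acts has list index \<open>k + q\<close>, where \<open>k\<close> now starts at \<open>0\<close>.
\<close>

definition shuffle_circ :: "nat \<Rightarrow> nat \<Rightarrow> ('w::ab_group_add, 'w) cochain \<Rightarrow> ('w, 'w) cochain \<Rightarrow> ('w, 'w) cochain" where
  "shuffle_circ p q P Q Xs x =
     (\<Sum>k<p. signed (k * q) (shuffle_sum k
        (\<lambda>A B. P (A @ (Q B (fst (Xs ! (k + q))), snd (Xs ! (k + q))) # drop (Suc (k + q)) Xs) x +
               P (A @ (fst (Xs ! (k + q)), Q B (snd (Xs ! (k + q)))) # drop (Suc (k + q)) Xs) x)
        (take (k + q) Xs))) +
     signed (p * q) (shuffle_sum p (\<lambda>A B. P A (Q B x)) Xs)"

lemma (in vector_space) circ_eq_shuffle_circ: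
  assumes len: "length Xs = p + q"
  shows "circ scale p q P Q Xs x = shuffle_circ p q P Q Xs x"
proof -
  have slot: "(\<Sum>\<sigma>\<in>shuffle_perms k q. scale (of_int (sign \<sigma>))
      (P (map (\<lambda>i. Xs ! (\<sigma> i - 1)) [1..<Suc k] @
         [f (map (\<lambda>i. Xs ! (\<sigma> i - 1)) [Suc k..<Suc k + q])] @
         map (\<lambda>i. Xs ! (i - 1)) [Suc k + q + 1..<p + q + 1]) x)) =
    shuffle_sum k (\<lambda>A B. P (A @ f B # drop (Suc (k + q)) Xs) x) (take (k + q) Xs)"
    (is "?l = _") if k: "k < p" for k and f :: "('b \<times> 'b) list \<Rightarrow> 'b \<times> 'b"
  proof -
    have drop: "map (\<lambda>i. Xs ! (i - 1)) [Suc k + q + 1..<p + q + 1] = drop (Suc (k + q)) Xs"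
      by (rule nth_equalityI) (use len k in \<open>auto simp del: upt_Suc\<close>)
    have map: "map (\<lambda>i. Xs ! (\<sigma> i - 1)) L = map (\<lambda>i. take (k + q) Xs ! (\<sigma> i - 1)) L"
      if "\<sigma> \<in> shuffle_perms k q" "set L \<subseteq> {1..k + q}" for \<sigma> L
    proof (rule map_cong[OF refl])
      fix i assume "i \<in> set L"
      then have "\<sigma> i \<in> {1..k + q}"
        using that permutes_in_image[of \<sigma> "{1..k + q}" i] by (auto simp: shuffle_perms_def)
      then have "\<sigma> i - 1 < k + q" by auto
      then show "Xs ! (\<sigma> i - 1) = take (k + q) Xs ! (\<sigma> i - 1)" by simp
    qed
    have "?l = perm_shuffle_sum scale k q (\<lambda>A B. P (A @ f B # drop (Suc (k + q)) Xs) x) (take (k + q) Xs)"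
      unfolding perm_shuffle_sum_def drop
    proof (rule sum.cong[OF refl])
      fix \<sigma> assume \<sigma>: "\<sigma> \<in> shuffle_perms k q"
      have "map (\<lambda>i. Xs ! (\<sigma> i - 1)) [1..<k + 1] = map (\<lambda>i. take (k + q) Xs ! (\<sigma> i - 1)) [1..<k + 1]"
        "map (\<lambda>i. Xs ! (\<sigma> i - 1)) [k + 1..<k + q + 1] =
          map (\<lambda>i. take (k + q) Xs ! (\<sigma> i - 1)) [k + 1..<k + q + 1]"
        by (intro map[OF \<sigma>]; auto)+
      then show "scale (of_int (sign \<sigma>)) (P (map (\<lambda>i. Xs ! (\<sigma> i - 1)) [1..<Suc k] @
         [f (map (\<lambda>i. Xs ! (\<sigma> i - 1)) [Suc k..<Suc k + q])] @ drop (Suc (k + q)) Xs) x) =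
        scale (of_int (sign \<sigma>)) (P (map (\<lambda>m. take (k + q) Xs ! (\<sigma> m - 1)) [1..<k + 1] @
         f (map (\<lambda>m. take (k + q) Xs ! (\<sigma> m - 1)) [k + 1..<k + q + 1]) # drop (Suc (k + q)) Xs) x)"
        by (simp del: upt_Suc map_eq_conv)
    qed
    also have "\<dots> = shuffle_sum k (\<lambda>A B. P (A @ f B # drop (Suc (k + q)) Xs) x) (take (k + q) Xs)"
      using k len by (intro perm_shuffle_sum_eq) simp
    finally show ?thesis .
  qed
  have slots: "(\<Sum>k = 1..p. scale ((-1) ^ ((k - 1) * q)) (\<Sum>\<sigma>\<in>shuffle_perms (k - 1) q. scale (of_int (sign \<sigma>))
      (P (map (\<lambda>i. Xs ! (\<sigma> i - 1)) [1..<k] @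
         [f (Xs ! (k + q - 1)) (map (\<lambda>i. Xs ! (\<sigma> i - 1)) [k..<k + q])] @
         map (\<lambda>i. Xs ! (i - 1)) [k + q + 1..<p + q + 1]) x))) =
    (\<Sum>k<p. signed (k * q)
       (shuffle_sum k (\<lambda>A B. P (A @ f (Xs ! (k + q)) B # drop (Suc (k + q)) Xs) x) (take (k + q) Xs)))"
    for f :: "('b \<times> 'b) \<Rightarrow> ('b \<times> 'b) list \<Rightarrow> 'b \<times> 'b"
    unfolding One_nat_def sum.atLeast1_atMost_eq
    by (rule sum.cong[OF refl], subst slot[symmetric])
      (simp_all add: scale_minus_one_power del: upt_Suc)
  have last: "(\<Sum>\<sigma>\<in>shuffle_perms p q. scale ((-1) ^ (p * q) * of_int (sign \<sigma>))
         (P (map (\<lambda>i. Xs ! (\<sigma> i - 1)) [1..<p + 1])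
            (Q (map (\<lambda>i. Xs ! (\<sigma> i - 1)) [p + 1..<p + q + 1]) x))) =
      signed (p * q) (shuffle_sum p (\<lambda>A B. P A (Q B x)) Xs)"
    unfolding perm_shuffle_sum_eq[OF len, symmetric] perm_shuffle_sum_def
    by (simp only: scale_minus_one_power[symmetric] scale_sum_right scale_scale)
  show ?thesis
    unfolding circ_def Let_def last slots[of "\<lambda>Y B. (Q B (fst Y), snd Y)"]
      slots[of "\<lambda>Y B. (fst Y, Q B (snd Y))"]
    by (simp add: shuffle_circ_def shuffle_sum_add signed_add sum.distrib)
qed

text \<open>
  The recursion of \<open>insertion\<close>: in every shuffle sum, the first entry of the list goes to the first
  block, hence to \<open>P\<close>, or to the second block, hence to \<open>Q\<close>. Only the summand \<open>k = 0\<close> for \<open>q = 0\<close> has no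
  list to be split; there the first pair is the one on which \<open>Q\<close> acts.
\<close>

lemma shuffle_circ_Cons:
  "shuffle_circ p q P Q (X # Xs) x =
     (if p = 0 then 0 else signed q (shuffle_circ (p - 1) q (prepend X P) Q Xs x)) +
     (if q = 0 then 0 else shuffle_circ p (q - 1) P (prepend X Q) Xs x) +
     (if p = 0 \<or> q \<noteq> 0 then 0
      else P ((Q [] (fst X), snd X) # Xs) x + P ((fst X, Q [] (snd X)) # Xs) x)"
  if len: "Suc (length Xs) = p + q"
proof -
  define T where "T P Q k q Xs = shuffle_sum k
      (\<lambda>A B. P (A @ (Q B (fst (Xs ! (k + q))), snd (Xs ! (k + q))) # drop (Suc (k + q)) Xs) x +
             P (A @ (fst (Xs ! (k + q)), Q B (snd (Xs ! (k + q)))) # drop (Suc (k + q)) Xs) x)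
      (take (k + q) Xs)" for P Q :: "('a, 'a) cochain" and k q Xs
  have circ: "shuffle_circ p q P Q Xs x = (\<Sum>k<p. signed (k * q) (T P Q k q Xs)) +
     signed (p * q) (shuffle_sum p (\<lambda>A B. P A (Q B x)) Xs)" for p q P Q Xs
    by (simp add: shuffle_circ_def T_def)
  let ?A = "P ((Q [] (fst X), snd X) # Xs) x + P ((fst X, Q [] (snd X)) # Xs) x"
  have T: "T P Q k q (X # Xs) =
      (if k = 0 then 0 else T (prepend X P) Q (k - 1) q Xs) +
      (if q = 0 then 0 else signed k (T P (prepend X Q) k (q - 1) Xs)) +
      (if k = 0 \<and> q = 0 then ?A else 0)" for k
  proof (cases "k + q")
    case 0
    then show ?thesis by (simp add: T_def)
  next
    case (Suc m)
    show ?thesis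
    proof (cases "q = 0")
      case True
      then show ?thesis using Suc by (simp add: T_def shuffle_sum_eq_0)
    next
      case False
      have "k - 1 + q = m" if "k \<noteq> 0" using Suc that by simp
      moreover have "k + (q - 1) = m" using Suc False by simp
      ultimately show ?thesis using Suc False by (cases k) (simp_all add: T_def)
    qed
  qed
  have sign: "signed (k * q) (signed k y) = signed (k * (q - 1)) y" if "q \<noteq> 0" for k and y :: 'a
    using that by (cases q) (auto simp: signed_def)
  have "(\<Sum>k<p. signed (k * q) (T P Q k q (X # Xs))) =
      (\<Sum>k<p. if k = 0 then 0 else signed (k * q) (T (prepend X P) Q (k - 1) q Xs)) +
      (if q = 0 then 0 else \<Sum>k<p. signed (k * (q - 1)) (T P (prepend X Q) k (q - 1) Xs)) +
      (\<Sum>k<p. if k = 0 \<and> q = 0 then ?A else 0)"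
  proof -
    have "signed (k * q) (T P Q k q (X # Xs)) =
        (if k = 0 then 0 else signed (k * q) (T (prepend X P) Q (k - 1) q Xs)) +
        (if q = 0 then 0 else signed (k * (q - 1)) (T P (prepend X Q) k (q - 1) Xs)) +
        (if k = 0 \<and> q = 0 then ?A else 0)" for k
      unfolding T by (simp add: signed_add sign)
    then show ?thesis by (simp only: sum.distrib) simp
  qed
  also have "(\<Sum>k<p. if k = 0 then 0 else signed (k * q) (T (prepend X P) Q (k - 1) q Xs)) =
      (if p = 0 then 0 else signed q (\<Sum>k<p - 1. signed (k * q) (T (prepend X P) Q k q Xs)))"
  proof (cases p)
    case (Suc p')
    have "signed ((Suc k) * q) y = signed q (signed (k * q) y)" for k and y :: 'a
      by (auto simp: signed_def)
    moreover have "signed q (sum f S) = (\<Sum>k\<in>S. signed q (f k))" for f :: "nat \<Rightarrow> 'a" and S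
      by (simp add: signed_def sum_negf)
    ultimately show ?thesis unfolding Suc sum.lessThan_Suc_shift by simp
  qed simp
  also have "(\<Sum>k<p. if k = 0 \<and> q = 0 then ?A else 0) = (if p = 0 \<or> q \<noteq> 0 then 0 else ?A)"
    by (cases p) (simp_all add: sum.lessThan_Suc_shift)
  moreover have "signed (p * q) (shuffle_sum p (\<lambda>A B. P A (Q B x)) (X # Xs)) =
     (if p = 0 then 0 else signed q (signed ((p - 1) * q) (shuffle_sum (p - 1) (\<lambda>A B. P (X # A) (Q B x)) Xs))) +
     (if q = 0 then 0 else signed (p * (q - 1)) (shuffle_sum p (\<lambda>A B. P A (Q (X # B) x)) Xs))"
  proof (cases "q = 0")
    case True
    then show ?thesis using len by (simp add: shuffle_sum_eq_0)
  next
    case False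
    then show ?thesis
      by (cases p; cases q) (auto simp: signed_def)
  qed
  ultimately show ?thesis
    unfolding circ by (simp add: signed_add algebra_simps)
qed

definition homogeneous :: "nat \<Rightarrow> ('w, 'b::zero) cochain \<Rightarrow> bool" where
  "homogeneous n P \<longleftrightarrow> (\<forall>Xs x. length Xs \<noteq> n \<longrightarrow> P Xs x = 0)"

lemma homogeneous_prepend: "homogeneous (Suc n) P \<Longrightarrow> homogeneous n (prepend X P)"
  by (simp add: homogeneous_def)

lemma homogeneous_0_prepend: "homogeneous 0 P \<Longrightarrow> prepend X P = (\<lambda>Xs x. 0)"
  by (simp add: homogeneous_def fun_eq_iff)

lemma homogeneous_parity: "homogeneous n P \<Longrightarrow> parity_homogeneous n P"
  by (auto simp: homogeneous_def parity_homogeneous_def)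

lemma homogeneous_insertion:
  assumes "multilinear_cochain s P" "homogeneous p P" "homogeneous q Q"
  shows "homogeneous (p + q) (insertion q' P Q)"
proof -
  have "insertion q' P Q Xs x = 0" if "length Xs \<noteq> p + q" for Xs x
    using assms that
  proof (induction Xs arbitrary: p q q' P Q)
    case (Nil p q q' P Q)
    interpret multilinear_cochain s P by (rule Nil.prems)
    show ?case using Nil.prems by (auto simp: homogeneous_def zero_last)
  next
    case (Cons X Xs p q q' P Q)
    interpret multilinear_cochain s P by (rule Cons.prems)
    have "insertion q' (prepend X P) Q Xs x = 0" for q'
    proof (cases p)
      case 0
      then show ?thesis using Cons.prems by (simp add: homogeneous_0_prepend insertion_0_left)
    next
      case (Suc m)
      then show ?thesis
        using Cons.IH[OF prepend homogeneous_prepend] Cons.prems by simp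
    qed
    moreover have "insertion q' P (prepend X Q) Xs x = 0" for q'
    proof (cases q)
      case 0
      then show ?thesis using Cons.prems by (simp add: homogeneous_0_prepend insertion_0_right)
    next
      case (Suc m)
      then show ?thesis
        using Cons.IH[OF Cons.prems(1,2) homogeneous_prepend] Cons.prems by simp
    qed
    moreover have "P ((Q [] (fst X), snd X) # Xs) x + P ((fst X, Q [] (snd X)) # Xs) x = 0"
      using Cons.prems by (cases "q = 0") (auto simp: homogeneous_def zero_hd)
    ultimately show ?case by simp
  qed
  then show ?thesis by (simp add: homogeneous_def)
qed

lemma shuffle_circ_eq_insertion:
  assumes "multilinear_cochain s P" "homogeneous p P" "homogeneous q Q" "length Xs = p + q"
  shows "shuffle_circ p q P Q Xs x = insertion q P Q Xs x"
  using assms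
proof (induction Xs arbitrary: p q P Q)
  case Nil
  then show ?case by (simp add: shuffle_circ_def)
next
  case (Cons X Xs p q P Q)
  interpret multilinear_cochain s P by (rule Cons.prems)
  have "(if p = 0 then 0 else signed q (shuffle_circ (p - 1) q (prepend X P) Q Xs x)) =
      signed q (insertion q (prepend X P) Q Xs x)"
  proof (cases p)
    case 0
    then show ?thesis using Cons.prems by (simp add: homogeneous_0_prepend insertion_0_left)
  next
    case (Suc m)
    then show ?thesis
      using Cons.IH[OF prepend homogeneous_prepend] Cons.prems by simp
  qed
  moreover have "(if q = 0 then 0 else shuffle_circ p (q - 1) P (prepend X Q) Xs x) =
      insertion (Suc q) P (prepend X Q) Xs x"
  proof (cases q)
    case 0
    then show ?thesis using Cons.prems by (simp add: homogeneous_0_prepend insertion_0_right)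
  next
    case (Suc m)
    then show ?thesis
      using Cons.IH[OF Cons.prems(1,2) homogeneous_prepend] Cons.prems by simp
  qed
  moreover have "(if p = 0 \<or> q \<noteq> 0 then 0
      else P ((Q [] (fst X), snd X) # Xs) x + P ((fst X, Q [] (snd X)) # Xs) x) =
      P ((Q [] (fst X), snd X) # Xs) x + P ((fst X, Q [] (snd X)) # Xs) x"
    using Cons.prems by (auto simp: homogeneous_def zero_hd)
  ultimately show ?case
    using shuffle_circ_Cons[of Xs p q P Q X x] Cons.prems by simp
qed


section \<open>Derived brackets\<close>

lemma power_int_minus_one: "(-1 :: 'k::field) powi n = (if even n then 1 else -1)"
  by (cases n rule: int_cases2) (auto simp: power_int_minus)

lemma (in vector_space) scale_minus_one_power_int: "scale ((-1) powi n) x = signed n x"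
  by (simp add: power_int_minus_one)

locale graded_Lie =
  fixes s :: "'k::field \<Rightarrow> 'a::ab_group_add \<Rightarrow> 'a" and G :: "int \<Rightarrow> 'a set" and br :: "'a \<Rightarrow> 'a \<Rightarrow> 'a"
  assumes graded_Lie_algebra: "graded_Lie_algebra s G br"
begin

sublocale vector_space s
  using graded_Lie_algebra by (simp add: graded_Lie_algebra_def graded_vector_space_def)

lemma subspace_degree: "subspace (G i)"
  using graded_Lie_algebra by (simp add: graded_Lie_algebra_def graded_vector_space_def)

lemma degree_imp_total: "x \<in> G i \<Longrightarrow> x \<in> total s G"
  unfolding total_def by (auto intro: span_base)

lemma subspace_total: "subspace (total s G)"
  by (simp add: total_def)

lemma br_add_left: "x \<in> total s G \<Longrightarrow> y \<in> total s G \<Longrightarrow> z \<in> total s G \<Longrightarrow> br (x + y) z = br x z + br y z"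
  and br_add_right: "x \<in> total s G \<Longrightarrow> y \<in> total s G \<Longrightarrow> z \<in> total s G \<Longrightarrow> br z (x + y) = br z x + br z y"
  using graded_Lie_algebra unfolding graded_Lie_algebra_def by blast+

lemma br_scale_left: "x \<in> total s G \<Longrightarrow> z \<in> total s G \<Longrightarrow> br (s c x) z = s c (br x z)"
  and br_scale_right: "x \<in> total s G \<Longrightarrow> z \<in> total s G \<Longrightarrow> br z (s c x) = s c (br z x)"
  using graded_Lie_algebra unfolding graded_Lie_algebra_def by blast+

lemma br_0_left: "z \<in> total s G \<Longrightarrow> br 0 z = 0"
  and br_0_right: "z \<in> total s G \<Longrightarrow> br z 0 = 0"
  using br_scale_left[of 0 z 0] br_scale_right[of 0 z 0] subspace_0[OF subspace_total] by simp_all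

lemma br_signed_left:
  "x \<in> total s G \<Longrightarrow> z \<in> total s G \<Longrightarrow> br (signed (n :: int) x) z = signed n (br x z)"
  by (simp flip: scale_minus_one_power_int add: br_scale_left)

lemma signed_total: "x \<in> total s G \<Longrightarrow> signed (n :: int) x \<in> total s G"
  using subspace_neg[OF subspace_total] by (simp add: signed_def)

lemma br_degree: "x \<in> G i \<Longrightarrow> y \<in> G j \<Longrightarrow> br x y \<in> G (i + j)"
  using graded_Lie_algebra unfolding graded_Lie_algebra_def by blast

lemma br_antisym: "x \<in> G i \<Longrightarrow> y \<in> G j \<Longrightarrow> br x y = - signed (i * j) (br y x)"
  using graded_Lie_algebra unfolding graded_Lie_algebra_def
  by (metis scale_minus_one_power_int)

lemma br_Jacobi: "x \<in> G i \<Longrightarrow> y \<in> G j \<Longrightarrow> z \<in> G k \<Longrightarrow>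
    br x (br y z) = br (br x y) z + signed (i * j) (br y (br x z))"
  using graded_Lie_algebra unfolding graded_Lie_algebra_def
  by (metis scale_minus_one_power_int)

text \<open>
  For each argument fixed, the condition on the other one defines a subspace, so that it passes from
  homogeneous elements to their span.
\<close>

lemma bilinear_membership:
  assumes H: "\<And>i. H i \<subseteq> G i" "\<And>i. H' i \<subseteq> G i" and S: "subspace S"
    and hom: "\<And>i j x y. x \<in> H i \<Longrightarrow> y \<in> H' j \<Longrightarrow> br x y \<in> S"
    and x: "x \<in> total s H" and y: "y \<in> total s H'"
  shows "br x y \<in> S"
proof -
  have tot: "total s H \<subseteq> total s G" "total s H' \<subseteq> total s G"
    unfolding total_def using H by (intro span_mono; blast)+
  have "br x y \<in> S" if y: "y \<in> H' j" for y j
  proof -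
    have yG: "y \<in> total s G" using y H degree_imp_total by blast
    let ?T = "{x \<in> total s G. br x y \<in> S}"
    have "subspace ?T"
      using subspace_total S yG
      by (auto simp: subspace_def br_add_left br_scale_left br_0_left)
    moreover have "(\<Union>i. H i) \<subseteq> ?T" using hom y H degree_imp_total by blast
    ultimately have "total s H \<subseteq> ?T" unfolding total_def by (rule span_minimal[rotated])
    then show ?thesis using x by blast
  qed
  moreover have xG: "x \<in> total s G" using x tot by blast
  let ?T = "{y \<in> total s G. br x y \<in> S}"
  have "subspace ?T"
    using subspace_total S xG
    by (auto simp: subspace_def br_add_right br_scale_right br_0_right)
  moreover have "(\<Union>i. H' i) \<subseteq> ?T" using calculation(1) H degree_imp_total by blast
  ultimately have "total s H' \<subseteq> ?T"
    using span_minimal[of "\<Union>i. H' i" ?T] by (simp add: total_def)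
  then show ?thesis using y by blast
qed

lemma br_total: "x \<in> total s G \<Longrightarrow> y \<in> total s G \<Longrightarrow> br x y \<in> total s G"
  by (rule bilinear_membership[of G G]) (auto intro: subspace_total br_degree degree_imp_total)

text \<open>
  The Jacobi identity, read as a statement on the right multiplication with \<open>y\<close>: it is a graded
  derivation.
\<close>

lemma br_derivation:
  assumes "A \<in> G a" "B \<in> G b" "y \<in> G j"
  shows "br (br A B) y = br A (br B y) + signed (b * j) (br (br A y) B)"
proof -
  have "br B (br A y) = - signed (b * (a + j)) (br (br A y) B)"
    by (rule br_antisym[OF assms(2) br_degree[OF assms(1,3)]])
  with br_Jacobi[OF assms] show ?thesis
    by (auto simp: signed_def)
qed

text \<open>
  This is the derivation rule for \<open>br (br A x) y\<close>, whose first term contains \<open>br x y\<close>.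
\<close>

lemma br_swap:
  assumes "A \<in> G a" "x \<in> G i" "y \<in> G j" "br x y = 0"
  shows "br (br A x) y = signed (i * j) (br (br A y) x)"
  using br_derivation[OF assms(1-3)] assms(4) br_0_right[OF degree_imp_total[OF assms(1)]] by simp

end

text \<open>
  The summand is a function of the list of permuted indices, not of the permutation, since the proofs
  move entries of this list over blocks of other entries.
\<close>

definition symmetrize ::
  "('k::field \<Rightarrow> 'a::ab_group_add \<Rightarrow> 'a) \<Rightarrow> (nat \<Rightarrow> int) \<Rightarrow> nat \<Rightarrow> (nat list \<Rightarrow> 'a) \<Rightarrow> 'a" where
  "symmetrize s d n F =
     (\<Sum>\<sigma> | \<sigma> permutes {1..n}. s (koszul_sign n d \<sigma>) (F (map \<sigma> [1..<Suc n])))"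

text \<open>
  An adjacent transposition permutes the pairs of positions \<open>i < j\<close>, apart from the pair that it swaps;
  that pair changes from an inversion to a non-inversion or conversely.
\<close>

lemma koszul_sign_adjacent:
  assumes \<sigma>: "\<sigma> permutes {1..n}" and k: "1 \<le> k" "k < n"
  shows "koszul_sign n d (\<sigma> \<circ> transpose k (Suc k)) =
    (-1) powi (d (\<sigma> k) * d (\<sigma> (Suc k))) * (koszul_sign n d \<sigma> :: 'k::field)"
proof -
  let ?\<tau> = "transpose k (Suc k)"
  define w :: "nat \<Rightarrow> nat \<Rightarrow> 'k" where "w a b = (if b < a then (-1) powi (d a * d b) else 1)" for a b
  define S where "S = {(i, j). 1 \<le> i \<and> i < j \<and> j \<le> n}"
  have fin: "finite S"
    by (rule finite_subset[of _ "{1..n} \<times> {1..n}"]) (auto simp: S_def)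
  have sign: "koszul_sign n d \<pi> = (\<Prod>(i, j)\<in>S. w (\<pi> i) (\<pi> j))" for \<pi>
  proof -
    have "(\<Prod>(i, j)\<in>S. w (\<pi> i) (\<pi> j)) =
        (\<Prod>(i, j)\<in>{(i, j). 1 \<le> i \<and> i < j \<and> j \<le> n \<and> \<pi> j < \<pi> i}. w (\<pi> i) (\<pi> j))"
      by (rule prod.mono_neutral_right[OF fin]) (auto simp: S_def w_def split: if_splits)
    then show ?thesis
      unfolding koszul_sign_def by (simp add: w_def cong: prod.cong_simp) (rule prod.cong; auto)
  qed
  have kS: "(k, Suc k) \<in> S" using k by (simp add: S_def)
  have rest: "(\<Prod>(i, j)\<in>S - {(k, Suc k)}. w (\<sigma> (?\<tau> i)) (\<sigma> (?\<tau> j))) =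
      (\<Prod>(i, j)\<in>S - {(k, Suc k)}. w (\<sigma> i) (\<sigma> j))"
    by (rule prod.reindex_bij_witness[of _ "\<lambda>(i, j). (?\<tau> i, ?\<tau> j)" "\<lambda>(i, j). (?\<tau> i, ?\<tau> j)"])
      (use k in \<open>auto simp: S_def transpose_def split: if_splits\<close>)
  have ne: "\<sigma> k \<noteq> \<sigma> (Suc k)" using permutes_inj[OF \<sigma>] by (metis injD n_not_Suc_n)
  have sq: "w (\<sigma> (Suc k)) (\<sigma> k) = (-1) powi (d (\<sigma> k) * d (\<sigma> (Suc k))) * w (\<sigma> k) (\<sigma> (Suc k))"
    using ne by (auto simp: w_def power_int_minus_one mult.commute)
  show ?thesis
    unfolding sign prod.remove[OF fin kS] o_def rest by (simp add: sq mult.assoc)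
qed

lemma (in vector_space) symmetrize_adjacent:
  assumes k: "Suc (i + j + 1) = n"
    and F: "\<And>u a b v. length u = i \<Longrightarrow> length v = j \<Longrightarrow> set (u @ a # b # v) \<subseteq> {1..n} \<Longrightarrow>
      F' (u @ a # b # v) = signed (d a * d b) (F (u @ b # a # v))"
  shows "symmetrize scale d n F' = symmetrize scale d n F"
proof -
  let ?\<tau> = "transpose (Suc i) (Suc (Suc i))"
  have \<tau>: "?\<tau> permutes {1..n}" using k by (intro permutes_swap_id) auto
  have "scale (koszul_sign n d \<sigma>) (F' (map \<sigma> [1..<Suc n])) =
      scale (koszul_sign n d (\<sigma> \<circ> ?\<tau>)) (F (map (\<sigma> \<circ> ?\<tau>) [1..<Suc n]))"
    if \<sigma>: "\<sigma> permutes {1..n}" for \<sigma>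
  proof -
    let ?u = "map \<sigma> [1..<Suc i]" and ?v = "map \<sigma> [i + 3..<Suc n]"
    have l: "[1..<Suc n] = [1..<Suc i] @ Suc i # Suc (Suc i) # [i + 3..<Suc n]"
    proof -
      have "[1..<Suc n] = [1..<Suc i] @ [Suc i..<Suc n]"
        using k upt_add_eq_append[of 1 "Suc i" "n - i"] by simp
      also have "[Suc i..<Suc n] = Suc i # Suc (Suc i) # [i + 3..<Suc n]"
        using k by (simp add: upt_conv_Cons eval_nat_numeral del: upt_Suc)
      finally show ?thesis .
    qed
    have l1: "map \<sigma> [1..<Suc n] = ?u @ \<sigma> (Suc i) # \<sigma> (Suc (Suc i)) # ?v"
      unfolding l by simp
    have l2: "map (\<sigma> \<circ> ?\<tau>) [1..<Suc n] = ?u @ \<sigma> (Suc (Suc i)) # \<sigma> (Suc i) # ?v"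
      unfolding l by (auto simp: transpose_def simp del: upt_Suc)
    have "set (map \<sigma> [1..<Suc n]) \<subseteq> {1..n}" using permutes_image[OF \<sigma>] by auto
    then have "F' (map \<sigma> [1..<Suc n]) =
        signed (d (\<sigma> (Suc i)) * d (\<sigma> (Suc (Suc i)))) (F (map (\<sigma> \<circ> ?\<tau>) [1..<Suc n]))"
      unfolding l1 l2 using k by (intro F) auto
    moreover have "1 \<le> Suc i" "Suc i < n" using k by auto
    ultimately show ?thesis
      unfolding koszul_sign_adjacent[OF \<sigma> \<open>1 \<le> Suc i\<close> \<open>Suc i < n\<close>]
      by (simp add: power_int_minus_one)
  qed
  then have "symmetrize scale d n F' =
      (\<Sum>\<sigma> | \<sigma> permutes {1..n}. scale (koszul_sign n d (\<sigma> \<circ> ?\<tau>)) (F (map (\<sigma> \<circ> ?\<tau>) [1..<Suc n])))"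
    unfolding symmetrize_def by (intro sum.cong) auto
  also have "\<dots> = symmetrize scale d n F"
    unfolding symmetrize_def by (rule sum_permutations_compose_right[OF \<tau>, symmetric])
  finally show ?thesis .
qed

lemma symmetrize_cong:
  assumes "\<And>l. length l = n \<Longrightarrow> set l \<subseteq> {1..n} \<Longrightarrow> F l = F' l"
  shows "symmetrize s d n F = symmetrize s d n F'"
proof -
  have "F (map \<sigma> [1..<Suc n]) = F' (map \<sigma> [1..<Suc n])" if "\<sigma> permutes {1..n}" for \<sigma>
    using permutes_image[OF that] by (intro assms) auto
  then show ?thesis unfolding symmetrize_def by (intro sum.cong) auto
qed

lemma (in vector_space) symmetrize_add:
  "symmetrize scale d n (\<lambda>l. F l + F' l) = symmetrize scale d n F + symmetrize scale d n F'"
  by (simp add: symmetrize_def scale_right_distrib sum.distrib)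

text \<open>
  Moving an entry to the left over a block of entries, by one adjacent transposition for each of them.
\<close>

lemma (in vector_space) symmetrize_move:
  assumes "Suc (i + j + k) = n"
    and F: "\<And>u v y w. length u = i \<Longrightarrow> length v = j \<Longrightarrow> length w = k \<Longrightarrow>
      set (u @ v @ y # w) \<subseteq> {1..n} \<Longrightarrow>
      F' (u @ v @ y # w) = signed (d y * sum_list (map d v)) (F (u @ y # v @ w))"
  shows "symmetrize scale d n F' = symmetrize scale d n F"
  using assms
proof (induction j arbitrary: F' k)
  case 0
  have "F' l = F l" if "length l = n" "set l \<subseteq> {1..n}" for l
  proof -
    have "l = take i l @ l ! i # drop (Suc i) l" using that 0 by (simp add: Cons_nth_drop_Suc)
    then show ?thesis using 0(2)[of "take i l" "[]" "drop (Suc i) l" "l ! i"] that 0(1) by simp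
  qed
  then show ?case by (rule symmetrize_cong)
next
  case (Suc j)
  define p where "p = i + j"
  \<comment> \<open>\<open>H\<close> differs from \<open>F'\<close> by the first of these transpositions, so \<open>y\<close> has one entry less to pass.\<close>
  define H where "H l = signed (d (l ! p) * d (l ! Suc p)) (F' (l[p := l ! Suc p, Suc p := l ! p]))" for l
  have H: "H (u @ a # b # v) = signed (d a * d b) (F' (u @ b # a # v))" if "length u = p" for u v a b
    using that by (simp add: H_def nth_append list_update_append)
  have "symmetrize scale d n F' = symmetrize scale d n H"
    by (rule symmetrize_adjacent[of p k]) (use Suc.prems in \<open>auto simp: H signed_signed p_def\<close>)
  also have "\<dots> = symmetrize scale d n F"
  proof (rule Suc.IH)
    fix u v y w
    assume l: "length u = i" "length v = j" "length w = Suc k" and set: "set (u @ v @ y # w) \<subseteq> {1..n}"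
    then obtain a w' where w: "w = a # w'" by (cases w) auto
    have "H (u @ v @ y # w) = signed (d y * d a) (F' (u @ (v @ [a]) @ y # w'))"
      using H[of "u @ v" y a w'] l by (simp add: w p_def)
    also have "F' (u @ (v @ [a]) @ y # w') =
        signed (d y * sum_list (map d (v @ [a]))) (F (u @ y # (v @ [a]) @ w'))"
      using l set by (intro Suc.prems) (auto simp: w)
    finally show "H (u @ v @ y # w) = signed (d y * sum_list (map d v)) (F (u @ y # v @ w))"
      by (simp add: w signed_signed) (auto simp: signed_def)
  qed (use Suc.prems in simp)
  finally show ?case .
qed

text \<open>
  Closure of \<open>H\<close> under the triple bracket is what allows the derived bracket to be iterated without
  projecting back to \<open>H\<close>.
\<close>

locale derived_bracket = graded_Lie s G br
  for s :: "'k::field_char_0 \<Rightarrow> 'a::ab_group_add \<Rightarrow> 'a" and G br +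
  fixes \<Delta> :: 'a and H :: "int \<Rightarrow> 'a set"
  assumes \<Delta>: "\<Delta> \<in> G 1" "br \<Delta> \<Delta> = 0"
    and subspace_H: "\<And>i. subspace (H i)"
    and H_G: "\<And>i. H i \<subseteq> G i"
    and abelian: "\<And>i j x y. x \<in> H i \<Longrightarrow> y \<in> H j \<Longrightarrow> br x y = 0"
    and closed: "\<And>i j k x y z. x \<in> H i \<Longrightarrow> y \<in> H j \<Longrightarrow> z \<in> H k \<Longrightarrow>
      br (br (br \<Delta> x) y) z \<in> H (i + j + k + 1)"
begin

abbreviation t :: "'a \<Rightarrow> 'a \<Rightarrow> 'a \<Rightarrow> 'a" where
  "t x y z \<equiv> br (br (br \<Delta> x) y) z"

lemma H_total: "total s H \<subseteq> total s G"
  unfolding total_def using H_G by (intro span_mono) blast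

lemma t_sym_12:
  assumes "x \<in> H i" "y \<in> H j" "z \<in> total s G"
  shows "t x y z = signed (i * j) (t y x z)"
proof -
  have "x \<in> G i" "y \<in> G j" using assms H_G by auto
  then have "br (br \<Delta> x) y = signed (i * j) (br (br \<Delta> y) x)"
    using br_swap[OF \<Delta>(1)] abelian assms by blast
  moreover have "br (br \<Delta> y) x \<in> total s G"
    using br_degree \<Delta>(1) \<open>x \<in> G i\<close> \<open>y \<in> G j\<close> degree_imp_total by blast
  ultimately show ?thesis using assms(3) by (simp add: br_signed_left)
qed

lemma t_sym_23:
  assumes "x \<in> G i" "y \<in> H j" "z \<in> H k"
  shows "t x y z = signed (j * k) (t x z y)"
  using br_swap[OF br_degree[OF \<Delta>(1) assms(1)]] abelian assms H_G by blast

text \<open>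
  The index set \<open>J\<close> is kept abstract, as it matters only for the symmetrization that it is \<open>{1..5}\<close>.
\<close>

context
  fixes d :: "nat \<Rightarrow> int" and x :: "nat \<Rightarrow> 'a" and J :: "nat set"
  assumes x: "\<And>i. i \<in> J \<Longrightarrow> x i \<in> H (d i)" and J: "J = {1..5}"
begin

definition iter_br :: "'a \<Rightarrow> nat list \<Rightarrow> 'a" where
  "iter_br A l = foldl (\<lambda>A i. br A (x i)) A l"

definition deg :: "nat list \<Rightarrow> int" where
  "deg l = sum_list (map d l)"

text \<open>
  The bracket of two iterated brackets. The degree of \<open>iter_br \<Delta> l\<close> is \<open>1 + deg l\<close>; the sign removes the
  contribution of the \<open>1\<close>, so that \<open>star\<close> is graded symmetric and right multiplications are derivations
  for the Koszul signs of the elements \<open>x i\<close> alone.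
\<close>

definition star :: "nat list \<Rightarrow> nat list \<Rightarrow> 'a" where
  "star l m = signed (deg l) (br (iter_br \<Delta> l) (iter_br \<Delta> m))"

lemma xG: "i \<in> J \<Longrightarrow> x i \<in> G (d i)"
  using x H_G by blast

lemma iter_br_simps [simp]: "iter_br A [] = A" "iter_br A (i # l) = iter_br (br A (x i)) l"
  "iter_br A (l @ [i]) = br (iter_br A l) (x i)"
  by (simp_all add: iter_br_def)

lemma deg_simps [simp]: "deg [] = 0" "deg (i # l) = d i + deg l" "deg (l @ m) = deg l + deg m"
  by (simp_all add: deg_def)

lemma iter_br_degree: "set l \<subseteq> J \<Longrightarrow> A \<in> G a \<Longrightarrow> iter_br A l \<in> G (a + deg l)"
proof (induction l arbitrary: A a)
  case (Cons i l)
  then have "iter_br (br A (x i)) l \<in> G (a + d i + deg l)"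
    by (intro Cons.IH br_degree xG) auto
  then show ?case by (simp add: algebra_simps)
qed simp

lemma iter_br_0: "set l \<subseteq> J \<Longrightarrow> iter_br 0 l = 0"
  by (induction l) (auto simp: br_0_left degree_imp_total[OF xG])

lemma iter_br_add:
  "set l \<subseteq> J \<Longrightarrow> A \<in> total s G \<Longrightarrow> B \<in> total s G \<Longrightarrow> iter_br (A + B) l = iter_br A l + iter_br B l"
  by (induction l arbitrary: A B) (auto simp: br_add_left degree_imp_total[OF xG] br_total)

lemma iter_br_signed:
  "set l \<subseteq> J \<Longrightarrow> A \<in> total s G \<Longrightarrow> iter_br (signed (n :: int) A) l = signed n (iter_br A l)"
  by (induction l arbitrary: A) (auto simp: br_signed_left degree_imp_total[OF xG] br_total)

text \<open>
  Three factors lead into the abelian part \<open>H\<close>, so a fourth one gives zero.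
\<close>

lemma iter_br_long:
  assumes "set l \<subseteq> J" "4 \<le> length l"
  shows "iter_br \<Delta> l = 0"
proof -
  obtain a b c e r where l: "l = a # b # c # e # r"
    using assms(2) by (auto simp: Suc_le_length_iff numeral_eq_Suc)
  have "t (x a) (x b) (x c) \<in> H (d a + d b + d c + 1)" using assms(1) by (intro closed x) (auto simp: l)
  then have "br (t (x a) (x b) (x c)) (x e) = 0"
    using assms(1) x[of e] abelian by (auto simp: l)
  then show ?thesis using assms(1) by (simp add: l iter_br_0)
qed

lemma iter_br_\<Delta>_degree: "set l \<subseteq> J \<Longrightarrow> iter_br \<Delta> l \<in> G (1 + deg l)"
  by (rule iter_br_degree[OF _ \<Delta>(1)])

lemma star_total: "set l \<subseteq> J \<Longrightarrow> set m \<subseteq> J \<Longrightarrow> star l m \<in> total s G"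
  using br_total[OF degree_imp_total degree_imp_total, OF iter_br_\<Delta>_degree iter_br_\<Delta>_degree, of l m]
    subspace_neg[OF subspace_total]
  by (auto simp: star_def signed_def)

lemma star_sym:
  assumes "set l \<subseteq> J" "set m \<subseteq> J"
  shows "star l m = signed (deg l * deg m) (star m l)"
  using br_antisym[OF iter_br_\<Delta>_degree iter_br_\<Delta>_degree, OF assms]
  by (auto simp: star_def signed_def)

lemma star_derivation:
  assumes "set l \<subseteq> J" "set m \<subseteq> J" "i \<in> J"
  shows "br (star l m) (x i) = star l (m @ [i]) + signed (d i * deg m) (star (l @ [i]) m)"
proof -
  note G = iter_br_\<Delta>_degree[OF assms(1)] iter_br_\<Delta>_degree[OF assms(2)] xG[OF assms(3)]
  have "br (star l m) (x i) = signed (deg l) (br (br (iter_br \<Delta> l) (iter_br \<Delta> m)) (x i))"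
    unfolding star_def using G by (intro br_signed_left br_total degree_imp_total)
  then show ?thesis
    unfolding br_derivation[OF G] by (auto simp: star_def signed_def)
qed

text \<open>
  \<open>[\<dots>[[\<Delta>, \<Delta>], x\<^sub>1], \<dots>, x\<^sub>5]\<close> is expanded one factor at a time. After symmetrization a term only depends
  on how many of the first \<open>m\<close> factors went to the left \<open>\<Delta>\<close> (the number \<open>i\<close>), so the expansion is
  governed by Pascal's triangle.
\<close>

definition expansion :: "nat \<Rightarrow> nat \<Rightarrow> 'a" where
  "expansion i m = symmetrize s d 5 (\<lambda>l. iter_br (star (take i l) (drop i (take m l))) (drop m l))"

lemma expansion_step:
  assumes "i \<le> m" "m < 5"
  shows "expansion i m = expansion i (Suc m) + expansion (Suc i) (Suc m)"
proof -
  let ?F = "\<lambda>l. signed (d (l ! m) * deg (drop i (take m l)))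
    (iter_br (star (take i l @ [l ! m]) (drop i (take m l))) (drop (Suc m) l))"
  have "expansion i m = symmetrize s d 5 (\<lambda>l.
      iter_br (star (take i l) (drop i (take (Suc m) l))) (drop (Suc m) l) + ?F l)"
    unfolding expansion_def
  proof (rule symmetrize_cong)
    fix l :: "nat list" assume "length l = 5" "set l \<subseteq> {1..5}"
    then have l: "length l = 5" "set l \<subseteq> J" by (simp_all add: J)
    then have lm: "l ! m \<in> J" using assms nth_mem[of m l] by auto
    have sets: "set (take i l) \<subseteq> J" "set (drop i (take m l)) \<subseteq> J"
      "set (drop (Suc m) l) \<subseteq> J"
      using l set_take_subset set_drop_subset by (metis subset_trans)+
    have "iter_br (star (take i l) (drop i (take m l))) (drop m l) =
        iter_br (br (star (take i l) (drop i (take m l))) (x (l ! m))) (drop (Suc m) l)"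
      using l assms by (simp flip: Cons_nth_drop_Suc)
    also have "\<dots> = iter_br (star (take i l) (drop i (take m l) @ [l ! m])) (drop (Suc m) l) + ?F l"
      unfolding star_derivation[OF sets(1,2) lm] using sets lm
      by (subst iter_br_add) (auto simp: star_total iter_br_signed signed_total)
    also have "drop i (take m l) @ [l ! m] = drop i (take (Suc m) l)"
      using l assms by (simp add: take_Suc_conv_app_nth)
    finally show "iter_br (star (take i l) (drop i (take m l))) (drop m l) =
        iter_br (star (take i l) (drop i (take (Suc m) l))) (drop (Suc m) l) + ?F l" .
  qed
  also have "\<dots> = expansion i (Suc m) + symmetrize s d 5 ?F"
    by (simp add: symmetrize_add expansion_def)
  also have "symmetrize s d 5 ?F = expansion (Suc i) (Suc m)"
    unfolding expansion_def
  proof (rule symmetrize_move[of i "m - i" "4 - m"])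
    fix u v w :: "nat list" and y
    assume "length u = i" "length v = m - i" "length w = 4 - m"
    then show "?F (u @ v @ y # w) = signed (d y * sum_list (map d v))
        (iter_br (star (take (Suc i) (u @ y # v @ w)) (drop (Suc i) (take (Suc m) (u @ y # v @ w))))
          (drop (Suc m) (u @ y # v @ w)))"
      using assms by (simp add: nth_append deg_def Suc_diff_le)
  qed (use assms in auto)
  finally show ?thesis .
qed

text \<open>
  The terms that survive in the expansion are those of the generalized Jacobi identity, without a
  sign: graded antisymmetry of the bracket and graded symmetry of the triple bracket, used to bring
  the inner bracket to the front, contribute the same sign as the definition of \<open>star\<close>.
\<close>

lemma star_3_2:
  assumes "set [a, b, c, e, f] \<subseteq> J"
  shows "star [a, b, c] [e, f] = t (t (x a) (x b) (x c)) (x e) (x f)"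
proof -
  let ?T = "t (x a) (x b) (x c)"
  have T: "?T \<in> H (d a + d b + d c + 1)" using assms by (intro closed x) auto
  have TG: "?T \<in> G (1 + deg [a, b, c])" using iter_br_\<Delta>_degree[of "[a, b, c]"] assms by simp
  have e: "x e \<in> H (d e)" "x f \<in> H (d f)" using x assms by auto
  have "br ?T (br (br \<Delta> (x e)) (x f)) = - signed ((1 + deg [a, b, c]) * (1 + deg [e, f])) (t (x e) (x f) ?T)"
    using br_antisym[OF TG iter_br_\<Delta>_degree[of "[e, f]"]] assms by simp
  also have "t (x e) (x f) ?T = signed (d f * (d a + d b + d c + 1)) (t (x e) ?T (x f))"
    using e H_G T by (intro t_sym_23) auto
  also have "t (x e) ?T (x f) = signed (d e * (d a + d b + d c + 1)) (t ?T (x e) (x f))"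
    using e H_G T degree_imp_total by (intro t_sym_12) blast+
  finally show ?thesis
    by (simp add: star_def) (auto simp: signed_def)
qed

text \<open>
  In the expansion of \<open>0\<close>, three or two of the five factors go to the left; in both cases there are \<open>10\<close>
  choices, and all \<open>20\<close> terms have the same symmetrization.
\<close>

lemma derived_Jacobi:
  "symmetrize s d 5 (\<lambda>l. t (t (x (l ! 0)) (x (l ! 1)) (x (l ! 2))) (x (l ! 3)) (x (l ! 4))) = 0"
proof -
  let ?T = "\<lambda>l. t (t (x (l ! 0)) (x (l ! 1)) (x (l ! 2))) (x (l ! 3)) (x (l ! 4))"
  have list5: "\<exists>a b c e f. l = [a, b, c, e, f]" if "length l = 5" for l :: "nat list"
    using that by (auto simp: length_Suc_conv numeral_eq_Suc)
  have e0: "expansion i 5 = 0" if "i \<in> {0, 1, 4, 5}" for i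
  proof -
    have "expansion i 5 = symmetrize s d 5 (\<lambda>l. 0)"
      unfolding expansion_def
    proof (rule symmetrize_cong)
      fix l :: "nat list" assume "length l = 5" "set l \<subseteq> {1..5}"
      then have l: "length l = 5" "set l \<subseteq> J" by (simp_all add: J)
      have sets: "set (take i l) \<subseteq> J" "set (drop i l) \<subseteq> J"
        using l set_take_subset set_drop_subset by (metis subset_trans)+
      have "iter_br \<Delta> (take i l) = 0 \<or> iter_br \<Delta> (drop i l) = 0"
        using that l iter_br_long[OF sets(1)] iter_br_long[OF sets(2)] by auto
      then have "star (take i l) (drop i l) = 0"
        using br_0_left br_0_right degree_imp_total[OF iter_br_\<Delta>_degree] sets
        by (auto simp: star_def)
      then show "iter_br (star (take i l) (drop i (take 5 l))) (drop 5 l) = 0"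
        using l by simp
    qed
    then show ?thesis by (simp add: symmetrize_def)
  qed
  have e3: "expansion 3 5 = symmetrize s d 5 ?T"
    unfolding expansion_def
  proof (rule symmetrize_cong)
    fix l :: "nat list" assume "length l = 5" "set l \<subseteq> {1..5}"
    then have l: "length l = 5" "set l \<subseteq> J" by (simp_all add: J)
    then obtain a b c e f where "l = [a, b, c, e, f]" using list5 by blast
    with l show "iter_br (star (take 3 l) (drop 3 (take 5 l))) (drop 5 l) = ?T l"
      using star_3_2[of a b c e f] by (simp add: numeral_eq_Suc)
  qed
  have e2: "expansion 2 5 = expansion 3 5"
  proof -
    \<comment> \<open>By symmetry of \<open>star\<close> the last three entries have to be moved in front of the first two. This is
      done one entry at a time; \<open>?F k\<close> is the stage after \<open>k\<close> moves.\<close>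
    let ?S = "\<lambda>l. star (take 3 l) (drop 3 l)"
    let ?F = "\<lambda>k l. signed (deg (drop (Suc (Suc k)) l) * deg (take 2 (drop k l)))
      (?S (take k l @ drop (Suc (Suc k)) l @ take 2 (drop k l)))"
    have "expansion 2 5 = symmetrize s d 5 (?F 0)"
      unfolding expansion_def
    proof (rule symmetrize_cong)
      fix l :: "nat list" assume "length l = 5" "set l \<subseteq> {1..5}"
      then have l: "length l = 5" "set l \<subseteq> J" by (simp_all add: J)
      then obtain a b c e f where "l = [a, b, c, e, f]" using list5 by blast
      with l show "iter_br (star (take 2 l) (drop 2 (take 5 l))) (drop 5 l) = ?F 0 l"
        using star_sym[of "[a, b]" "[c, e, f]"] by (simp add: numeral_eq_Suc mult.commute)
    qed
    also have move: "symmetrize s d 5 (?F k) = symmetrize s d 5 (?F (Suc k))" if "k < 3" for k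
    proof (rule symmetrize_move[of k 2 "2 - k"])
      fix u v w :: "nat list" and y
      assume "length u = k" "length v = 2" "length w = 2 - k"
      then show "?F k (u @ v @ y # w) = signed (d y * sum_list (map d v)) (?F (Suc k) (u @ y # v @ w))"
        by (auto simp: signed_signed deg_def[of v, symmetric] signed_def algebra_simps)
    qed (use that in auto)
    have "symmetrize s d 5 (?F 0) = symmetrize s d 5 (?F 3)"
      using move[of 0] move[of 1] move[of 2] by (simp add: numeral_eq_Suc)
    also have "\<dots> = expansion 3 5"
      unfolding expansion_def
    proof (rule symmetrize_cong)
      fix l :: "nat list" assume "length l = 5" "set l \<subseteq> {1..5}"
      then have l: "length l = 5" "set l \<subseteq> J" by (simp_all add: J)
      then show "?F 3 l = iter_br (star (take 3 l) (drop 3 (take 5 l))) (drop 5 l)"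
        by simp
    qed
    finally show ?thesis .
  qed
  have "expansion 0 0 = 0"
    unfolding expansion_def
  proof -
    have "iter_br (star [] []) l = 0" if "set l \<subseteq> {1..5}" for l
      using that by (simp add: star_def \<Delta> iter_br_0 J)
    then have "symmetrize s d 5 (\<lambda>l. iter_br (star [] []) l) = symmetrize s d 5 (\<lambda>l. 0)"
      by (intro symmetrize_cong) auto
    then show "symmetrize s d 5 (\<lambda>l. iter_br (star (take 0 l) (drop 0 (take 0 l))) (drop 0 l)) = 0"
      by (simp add: symmetrize_def)
  qed
  moreover have "expansion 0 0 = s 20 (symmetrize s d 5 ?T)"
  proof -
    define E where "E = symmetrize s d 5 ?T"
    have add: "s a E + s b E = s (a + b) E" for a b by (simp add: scale_left_distrib)
    \<comment> \<open>From the bottom row \<open>m = 5\<close> up to the top of the triangle.\<close>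
    have 5: "expansion 0 5 = s 0 E" "expansion 1 5 = s 0 E" "expansion 2 5 = s 1 E"
      "expansion 3 5 = s 1 E" "expansion 4 5 = s 0 E" "expansion 5 5 = s 0 E"
      using e0 e2 e3 by (simp_all add: E_def)
    have 4: "expansion 0 4 = s 0 E" "expansion 1 4 = s 1 E" "expansion 2 4 = s 2 E"
      "expansion 3 4 = s 1 E" "expansion 4 4 = s 0 E"
      using expansion_step[of 0 4] expansion_step[of 1 4] expansion_step[of 2 4]
        expansion_step[of 3 4] expansion_step[of 4 4] 5 add[of 0 1] add[of 1 1] add[of 1 0]
      by (simp_all add: numeral_eq_Suc)
    have 3: "expansion 0 3 = s 1 E" "expansion 1 3 = s 3 E" "expansion 2 3 = s 3 E"
      "expansion 3 3 = s 1 E"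
      using expansion_step[of 0 3] expansion_step[of 1 3] expansion_step[of 2 3] expansion_step[of 3 3]
        4 add[of 0 1] add[of 1 2] add[of 2 1] add[of 1 0]
      by (simp_all add: numeral_eq_Suc)
    have 2: "expansion 0 2 = s 4 E" "expansion 1 2 = s 6 E" "expansion 2 2 = s 4 E"
      using expansion_step[of 0 2] expansion_step[of 1 2] expansion_step[of 2 2]
        3 add[of 1 3] add[of 3 3] add[of 3 1]
      by (simp_all add: numeral_eq_Suc)
    have 1: "expansion 0 1 = s 10 E" "expansion 1 1 = s 10 E"
      using expansion_step[of 0 1] expansion_step[of 1 1] 2 add[of 4 6] add[of 6 4]
      by (simp_all add: numeral_eq_Suc)
    show ?thesis
      using expansion_step[of 0 0] 1 add[of 10 10] by (simp add: E_def)
  qed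
  ultimately have "s 20 (symmetrize s d 5 ?T) = 0" by simp
  then show ?thesis by simp
qed

end

theorem derived_Lie_3_algebra: "Lie_3_algebra s H t"
proof -
  have graded: "graded_vector_space s H"
  proof -
    have "\<forall>i\<in>I. x i = 0" if "finite I" "\<forall>i\<in>I. x i \<in> H i" "sum x I = 0" for I x
    proof -
      have "\<forall>i\<in>I. x i \<in> G i" using that(2) H_G by blast
      then show ?thesis
        using graded_Lie_algebra that(1,3)
        unfolding graded_Lie_algebra_def graded_vector_space_def by meson
    qed
    then show ?thesis
      unfolding graded_vector_space_def using vector_space_axioms subspace_H by meson
  qed
  have trilinear: "t (x + y) u v = t x u v + t y u v" "t (s c x) u v = s c (t x u v)"
    "t u (x + y) v = t u x v + t u y v" "t u (s c x) v = s c (t u x v)"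
    "t u v (x + y) = t u v x + t u v y" "t u v (s c x) = s c (t u v x)"
    if H: "x \<in> total s H" "y \<in> total s H" "u \<in> total s H" "v \<in> total s H" for x y u v c
  proof -
    note G = H[THEN subsetD[OF H_total]]
    note \<Delta>G = degree_imp_total[OF \<Delta>(1)]
    show "t (x + y) u v = t x u v + t y u v" "t (s c x) u v = s c (t x u v)"
      "t u (x + y) v = t u x v + t u y v" "t u (s c x) v = s c (t u x v)"
      "t u v (x + y) = t u v x + t u v y" "t u v (s c x) = s c (t u v x)"
      using G \<Delta>G
      by (simp_all add: br_add_left br_add_right br_scale_left br_scale_right br_total)
  qed
  have sym: "t x y z = s ((-1) powi (i * j)) (t y x z)"
    "t x y z = s ((-1) powi (j * k)) (t x z y)"
    if "x \<in> H i" "y \<in> H j" "z \<in> H k" for x y z i j k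
  proof -
    have "x \<in> G i" "z \<in> total s G" using that H_G degree_imp_total by blast+
    from t_sym_12[OF that(1,2) this(2)] t_sym_23[OF this(1) that(2,3)]
    show "t x y z = s ((-1) powi (i * j)) (t y x z)" "t x y z = s ((-1) powi (j * k)) (t x z y)"
      unfolding scale_minus_one_power_int .
  qed
  have Jacobi: "(\<Sum>\<sigma> | \<sigma> permutes {1..5::nat}.
      s (koszul_sign 5 d \<sigma>) (t (t (x (\<sigma> 1)) (x (\<sigma> 2)) (x (\<sigma> 3))) (x (\<sigma> 4)) (x (\<sigma> 5)))) = 0"
    if "\<forall>i\<in>{1..5}. x i \<in> H (d i)" for d x
  proof -
    have "[1..<Suc 5] = [1, 2, 3, 4, 5]" by (simp add: upt_rec numeral_eq_Suc)
    then show ?thesis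
      using derived_Jacobi[of "{1..5}" x d] that by (simp add: symmetrize_def del: upt_Suc)
  qed
  show ?thesis
    unfolding Lie_3_algebra_def
    by (intro conjI allI ballI impI; (rule graded trilinear closed sym Jacobi; assumption)?)
qed

end


section \<open>The graded Lie algebra of cochains\<close>

lemma vector_space_cochain_scale: "vector_space s \<Longrightarrow> vector_space (cochain_scale s)"
  by (auto simp: vector_space_def cochain_scale_def fun_eq_iff)

lemma cochain_sum_apply: "(\<Sum>i\<in>I. f i) Xs x = (\<Sum>i\<in>I. (f i :: ('a, 'b::ab_group_add) cochain) Xs x)"
  by (induction I rule: infinite_finite_induct) simp_all

definition component :: "nat \<Rightarrow> ('a, 'b::zero) cochain \<Rightarrow> ('a, 'b) cochain" where
  "component n f Xs x = (if length Xs = n then f Xs x else 0)"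

lemma homogeneous_component: "homogeneous n (component n f)"
  by (simp add: homogeneous_def component_def)

lemma component_homogeneous: "homogeneous n f \<Longrightarrow> component n f = f"
  by (auto simp: homogeneous_def component_def fun_eq_iff)

lemma sum_components:
  fixes f :: "('a, 'b::ab_group_add) cochain"
  shows "(\<And>Xs x. N < length Xs \<Longrightarrow> f Xs x = 0) \<Longrightarrow> f = (\<Sum>n\<le>N. component n f)"
  by (auto simp: fun_eq_iff cochain_sum_apply component_def leI)

locale cochain_spaces = A: vector_space sA + B: vector_space sB
  for sA :: "'k::field \<Rightarrow> 'a::ab_group_add \<Rightarrow> 'a" and sB :: "'k \<Rightarrow> 'b::ab_group_add \<Rightarrow> 'b"
begin

sublocale C: vector_space "cochain_scale sB :: 'k \<Rightarrow> ('a, 'b) cochain \<Rightarrow> ('a, 'b) cochain"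
  by (rule vector_space_cochain_scale) (rule B.vector_space_axioms)

lemma linear_iff:
  "Vector_Spaces.linear sA sB f \<longleftrightarrow>
    (\<forall>x y. f (x + y) = f x + f y) \<and> (\<forall>c x. f (sA c x) = sB c (f x))"
  by (rule linear_iff_add_scale) (rule A.vector_space_axioms B.vector_space_axioms)+

lemma mem_cochains: "f \<in> cochains sA sB n \<longleftrightarrow> multilinear sA sB f \<and> homogeneous n f"
  unfolding homogeneous_def
  by (rule mem_cochains_iff) (rule A.vector_space_axioms B.vector_space_axioms)+

lemma subspace_multilinear: "C.subspace {f. multilinear sA sB f}"
proof -
  have "multilinear sA sB 0" by (simp add: multilinear_def linear_iff)
  moreover have "multilinear sA sB (f + g)" if "multilinear sA sB f" "multilinear sA sB g" for f g
    using that by (simp add: multilinear_def linear_iff B.scale_right_distrib ac_simps)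
  moreover have "multilinear sA sB (cochain_scale sB c f)" if "multilinear sA sB f" for f c
    using that
    by (simp add: multilinear_def linear_iff cochain_scale_def B.scale_right_distrib mult.commute)
  ultimately show ?thesis by (simp add: C.subspace_def)
qed

lemma subspace_cochains: "C.subspace (cochains sA sB n)"
proof -
  have "cochains sA sB n = {f. multilinear sA sB f} \<inter> {f. homogeneous n f}"
    by (auto simp: mem_cochains)
  moreover have "C.subspace {f :: ('a, 'b) cochain. homogeneous n f}"
    by (simp add: C.subspace_def homogeneous_def cochain_scale_def)
  ultimately show ?thesis using subspace_multilinear C.subspace_inter by simp
qed

lemma component_cochains: "multilinear sA sB f \<Longrightarrow> component n f \<in> cochains sA sB n"
  by (simp add: mem_cochains homogeneous_component multilinear_def linear_iff component_def)

lemma graded_vector_space_cochains: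
  "graded_vector_space (cochain_scale sB) (nonneg_grading (cochains sA sB))"
  unfolding graded_vector_space_def
proof (intro conjI allI impI)
  show "C.subspace (nonneg_grading (cochains sA sB) i)" for i
    by (simp add: nonneg_grading_def subspace_cochains)
next
  fix I and f :: "int \<Rightarrow> ('a, 'b) cochain"
  assume *: "finite I \<and> (\<forall>i\<in>I. f i \<in> nonneg_grading (cochains sA sB) i) \<and> sum f I = 0"
  show "\<forall>i\<in>I. f i = 0"
  proof (rule ballI, intro ext)
    fix i Xs x assume i: "i \<in> I"
    have f: "f j Xs x = 0" if "j \<in> I" "j \<noteq> int (length Xs)" for j
    proof (cases "j < 0")
      case True
      then show ?thesis using * that by (auto simp: nonneg_grading_def)
    next
      case False
      then have "homogeneous (nat j) (f j)"
        using * that by (auto simp: nonneg_grading_def mem_cochains)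
      moreover have "length Xs \<noteq> nat j" using that False by auto
      ultimately show ?thesis by (simp add: homogeneous_def)
    qed
    have "0 = (\<Sum>j\<in>I. f j Xs x)" using * by (simp flip: cochain_sum_apply)
    also have "\<dots> = (\<Sum>j\<in>I. if j = int (length Xs) then f j Xs x else 0)"
      by (rule sum.cong) (auto simp: f)
    also have "\<dots> = (if int (length Xs) \<in> I then f (int (length Xs)) Xs x else 0)"
      using * by (simp add: sum.delta)
    finally show "f i Xs x = 0 Xs x" using f[OF i] i by (cases "i = int (length Xs)") auto
  qed
qed (rule C.vector_space_axioms)

text \<open>
  A map that vanishes on long lists is the finite sum of its restrictions to the lists of fixed length.
\<close>

lemma total_cochains:
  "total (cochain_scale sB) (nonneg_grading (cochains sA sB)) =
    {f. multilinear sA sB f \<and> (\<exists>N. \<forall>Xs x. N < length Xs \<longrightarrow> f Xs x = 0)}" (is "_ = ?S")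
proof (rule set_eqI, rule iffI)
  fix f
  have "C.subspace ?S"
    unfolding C.subspace_def
  proof (intro conjI ballI allI)
    show "0 \<in> ?S" using subspace_multilinear by (simp add: C.subspace_def)
    show "f + g \<in> ?S" if fg: "f \<in> ?S" "g \<in> ?S" for f g
    proof -
      obtain N M where "\<forall>Xs x. N < length Xs \<longrightarrow> f Xs x = 0" "\<forall>Xs x. M < length Xs \<longrightarrow> g Xs x = 0"
        using fg by blast
      then have "\<forall>Xs x. max N M < length Xs \<longrightarrow> (f + g) Xs x = 0" by simp
      then show ?thesis using fg subspace_multilinear unfolding C.subspace_def by blast
    qed
    show "cochain_scale sB c f \<in> ?S" if "f \<in> ?S" for f c
      using that subspace_multilinear by (auto simp: C.subspace_def cochain_scale_def)
  qed
  moreover have "f \<in> ?S" if f: "f \<in> nonneg_grading (cochains sA sB) i" for f i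
  proof (cases "i < 0")
    case True
    then show ?thesis using f C.subspace_0[OF subspace_multilinear] by (simp add: nonneg_grading_def)
  next
    case False
    then have "multilinear sA sB f" "homogeneous (nat i) f"
      using f by (simp_all add: nonneg_grading_def mem_cochains)
    then show ?thesis by (auto simp: homogeneous_def intro!: exI[of _ "nat i"])
  qed
  then have "(\<Union>i. nonneg_grading (cochains sA sB) i) \<subseteq> ?S" by blast
  ultimately show "f \<in> total (cochain_scale sB) (nonneg_grading (cochains sA sB)) \<Longrightarrow> f \<in> ?S"
    unfolding total_def using C.span_minimal by blast
next
  fix f assume f: "f \<in> ?S"
  then obtain N where N: "\<forall>Xs x. N < length Xs \<longrightarrow> f Xs x = 0" by blast
  have "component n f \<in> (\<Union>i. nonneg_grading (cochains sA sB) i)" for n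
  proof -
    have "component n f \<in> nonneg_grading (cochains sA sB) (int n)"
      using f component_cochains[of f n] by (simp add: nonneg_grading_def)
    then show ?thesis by blast
  qed
  then have span: "(\<Sum>n\<le>N. component n f) \<in> C.span (\<Union>i. nonneg_grading (cochains sA sB) i)"
    by (intro C.span_sum C.span_base)
  have "(\<Sum>n\<le>N. component n f) = f"
    by (rule sum_components[symmetric]) (use N in blast)
  from span[unfolded this] show "f \<in> total (cochain_scale sB) (nonneg_grading (cochains sA sB))"
    unfolding total_def .
qed

end

locale cochain_algebra = vector_space s for s :: "'k::field \<Rightarrow> 'w::ab_group_add \<Rightarrow> 'w"
begin

sublocale cochain_spaces s s
  by (intro cochain_spaces.intro vector_space_axioms)

abbreviation "L \<equiv> nonneg_grading (cochains s s)"
abbreviation "sL \<equiv> cochain_scale s :: 'k \<Rightarrow> ('w, 'w) cochain \<Rightarrow> ('w, 'w) cochain"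

lemma multilinear_cochain_iff: "multilinear_cochain s P \<longleftrightarrow> multilinear s s P"
  by (simp add: multilinear_cochain_def multilinear_cochain_axioms_def vector_space_axioms)

lemma cochainsD:
  assumes "P \<in> cochains s s n"
  shows "multilinear_cochain s P" "homogeneous n P"
  using assms by (simp_all add: mem_cochains multilinear_cochain_iff)

lemma circ_component:
  "circ s p q P Q Xs x = circ s p q (component p P) (component q Q) Xs x"
proof -
  have P: "component p P l y = P l y" if "length l = p" for l y
    using that by (simp add: component_def)
  have Q: "component q Q l y = Q l y" if "length l = q" for l y
    using that by (simp add: component_def)
  have len: "length (map f [1..<k] @ [y] @ map g [k + q + 1..<p + q + 1]) = p"
    if "k \<in> {1..p}" for f g :: "nat \<Rightarrow> 'w \<times> 'w" and y k
    using that by auto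
  have slot: "P (map f [1..<k] @ [y] @ map g [k + q + 1..<p + q + 1]) x =
      component p P (map f [1..<k] @ [y] @ map g [k + q + 1..<p + q + 1]) x"
    if "k \<in> {1..p}" for f g :: "nat \<Rightarrow> 'w \<times> 'w" and y k
    by (rule P[OF len[OF that], symmetric])
  have inner: "Q (map f [k..<k + q]) y = component q Q (map f [k..<k + q]) y" for f k y
    by (rule Q[symmetric]) simp
  have last: "P (map f [1..<p + 1]) (Q (map f [p + 1..<p + q + 1]) x) =
      component p P (map f [1..<p + 1]) (component q Q (map f [p + 1..<p + q + 1]) x)" for f
    by (simp add: P Q del: upt_Suc)
  show ?thesis
    unfolding circ_def Let_def
  proof (intro arg_cong2[of _ _ _ _ "(+)"])
    show "(\<Sum>\<sigma>\<in>shuffle_perms p q. s ((-1) ^ (p * q) * of_int (sign \<sigma>))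
         (P (map (\<lambda>i. Xs ! (\<sigma> i - 1)) [1..<p + 1]) (Q (map (\<lambda>i. Xs ! (\<sigma> i - 1)) [p + 1..<p + q + 1]) x))) =
      (\<Sum>\<sigma>\<in>shuffle_perms p q. s ((-1) ^ (p * q) * of_int (sign \<sigma>))
         (component p P (map (\<lambda>i. Xs ! (\<sigma> i - 1)) [1..<p + 1])
           (component q Q (map (\<lambda>i. Xs ! (\<sigma> i - 1)) [p + 1..<p + q + 1]) x)))"
      unfolding last ..
  qed (rule sum.cong[OF refl], unfold slot inner, rule refl)+
qed

lemma circ_eq_insertion:
  assumes "multilinear s s P" "length Xs = p + q"
  shows "circ s p q P Q Xs x = insertion q (component p P) (component q Q) Xs x"
proof -
  have "circ s p q P Q Xs x = shuffle_circ p q (component p P) (component q Q) Xs x"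
    by (subst circ_component) (rule circ_eq_shuffle_circ[OF assms(2)])
  then show ?thesis
    using shuffle_circ_eq_insertion[OF cochainsD(1)[OF component_cochains[OF assms(1)]]
        homogeneous_component homogeneous_component assms(2)] by simp
qed

text \<open>
  For elements of the direct sum the bracket splits into the brackets of components; the bilinearity of
  insertions carries over in this form.
\<close>

lemma leib_bracket_eq_insertions:
  assumes "multilinear s s P" "multilinear s s Q"
  shows "leib_bracket s P Q Xs x = (\<Sum>(p, q) \<in> {(p, q). p + q = length Xs}.
     insertion q (component p P) (component q Q) Xs x -
     signed (p * q) (insertion p (component q Q) (component p P) Xs x))"
  unfolding leib_bracket_def
proof (intro sum.cong[OF refl], clarify)
  fix p q assume len: "p + q = length Xs"
  then have "length Xs = p + q" "length Xs = q + p" by simp_all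
  then show "circ s p q P Q Xs x - s ((-1) ^ (p * q)) (circ s q p Q P Xs x) =
      insertion q (component p P) (component q Q) Xs x -
      signed (p * q) (insertion p (component q Q) (component p P) Xs x)"
    by (simp only: circ_eq_insertion[OF assms(1)] circ_eq_insertion[OF assms(2)] scale_minus_one_power)
qed

lemma leib_bracket_cochains:
  assumes P: "P \<in> cochains s s p" and Q: "Q \<in> cochains s s q"
  shows "leib_bracket s P Q =
    (\<lambda>Xs x. insertion q P Q Xs x - signed (p * q) (insertion p Q P Xs x))"
proof (intro ext)
  fix Xs x
  note P' = cochainsD[OF P] and Q' = cochainsD[OF Q]
  show "leib_bracket s P Q Xs x = insertion q P Q Xs x - signed (p * q) (insertion p Q P Xs x)"
  proof (cases "length Xs = p + q")
    case True
    have "circ s p q P Q Xs x = insertion q P Q Xs x"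
      using circ_eq_insertion[of P Xs p q Q x] True P' Q'
      by (simp add: component_homogeneous multilinear_cochain_iff)
    moreover have "circ s q p Q P Xs x = insertion p Q P Xs x"
      using circ_eq_insertion[of Q Xs q p P x] True P' Q'
      by (simp add: component_homogeneous multilinear_cochain_iff)
    ultimately show ?thesis
      unfolding leib_bracket_homogeneous[OF vector_space_axioms P Q]
      using True by (simp add: scale_minus_one_power)
  next
    case False
    then have "insertion q P Q Xs x = 0" "insertion p Q P Xs x = 0"
      using homogeneous_insertion[OF P' Q'(2), of q] homogeneous_insertion[OF Q' P'(2), of p]
      by (simp_all add: homogeneous_def add.commute)
    then show ?thesis
      unfolding leib_bracket_homogeneous[OF vector_space_axioms P Q]
      using False by (simp only: if_False signed_0_right diff_zero)
  qed
qed

lemma leib_bracket_in_cochains: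
  assumes P: "P \<in> cochains s s p" and Q: "Q \<in> cochains s s q"
  shows "leib_bracket s P Q \<in> cochains s s (p + q)"
proof -
  note P' = cochainsD[OF P] and Q' = cochainsD[OF Q]
  have "insertion q P Q \<in> cochains s s (p + q)" "insertion p Q P \<in> cochains s s (p + q)"
    using homogeneous_insertion[OF P' Q'(2), of q] homogeneous_insertion[OF Q' P'(2), of p]
      multilinear_insertion[OF P'(1) Q'(1), of q] multilinear_insertion[OF Q'(1) P'(1), of p]
    by (simp_all add: mem_cochains multilinear_cochain_iff add.commute)
  then have "insertion q P Q - sL ((-1) ^ (p * q)) (insertion p Q P) \<in> cochains s s (p + q)"
    by (intro C.subspace_diff C.subspace_scale subspace_cochains)
  moreover have "insertion q P Q - sL ((-1) ^ (p * q)) (insertion p Q P) = leib_bracket s P Q"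
    unfolding leib_bracket_cochains[OF P Q]
    by (simp add: fun_eq_iff cochain_scale_def scale_minus_one_power)
  ultimately show ?thesis by simp
qed

lemma leib_bracket_antisym:
  assumes "P \<in> cochains s s p" "Q \<in> cochains s s q"
  shows "leib_bracket s P Q Xs x = - signed (p * q) (leib_bracket s Q P Xs x)"
  unfolding leib_bracket_cochains[OF assms] leib_bracket_cochains[OF assms(2,1)]
  by (simp add: signed_diff signed_signed mult.commute[of q p])

text \<open>The commutator of a graded pre-Lie product satisfies the graded Jacobi identity.\<close>

lemma leib_bracket_Jacobi:
  assumes P: "P \<in> cochains s s p" and Q: "Q \<in> cochains s s q" and R: "R \<in> cochains s s r"
  shows "leib_bracket s P (leib_bracket s Q R) Xs x =
    leib_bracket s (leib_bracket s P Q) R Xs x +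
    signed (p * q) (leib_bracket s Q (leib_bracket s P R) Xs x)"
proof -
  note P' = cochainsD[OF P] and Q' = cochainsD[OF Q] and R' = cochainsD[OF R]
  interpret P: multilinear_cochain s P by (rule P')
  interpret Q: multilinear_cochain s Q by (rule Q')
  interpret R: multilinear_cochain s R by (rule R')
  note parity = P'(2)[THEN homogeneous_parity] Q'(2)[THEN homogeneous_parity]
    R'(2)[THEN homogeneous_parity]
  note pre_Lie = insertion_pre_Lie[OF P'(1) Q'(1) R'(1) parity(2,3), THEN diff_eq_eq[THEN iffD1]]
    insertion_pre_Lie[OF Q'(1) P'(1) R'(1) parity(1,3), THEN diff_eq_eq[THEN iffD1]]
    insertion_pre_Lie[OF R'(1) P'(1) Q'(1) parity(1,2), THEN diff_eq_eq[THEN iffD1]]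
  note expand = insertion_diff_left insertion_signed_left insertion_minus_left insertion_add_left
    P.insertion_diff_right P.insertion_signed_right P.insertion_minus_right P.insertion_add_right
    Q.insertion_diff_right Q.insertion_signed_right Q.insertion_minus_right Q.insertion_add_right
    R.insertion_diff_right R.insertion_signed_right R.insertion_minus_right R.insertion_add_right
  note inner = leib_bracket_cochains[OF P Q] leib_bracket_cochains[OF P R] leib_bracket_cochains[OF Q R]
  note outer = leib_bracket_cochains[OF P leib_bracket_in_cochains[OF Q R], unfolded inner]
    leib_bracket_cochains[OF leib_bracket_in_cochains[OF P Q] R, unfolded inner]
    leib_bracket_cochains[OF Q leib_bracket_in_cochains[OF P R], unfolded inner]
  show ?thesis
    unfolding inner outer
    by (cases "even p"; cases "even q"; cases "even r")
      (simp_all add: expand pre_Lie algebra_simps)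
qed


lemma component_add:
  "component n (\<lambda>Xs x. P Xs x + P' Xs x) = (\<lambda>Xs x. component n P Xs x + component n P' Xs x)"
  for P P' :: "('w, 'w) cochain"
  by (simp add: fun_eq_iff component_def)

lemma component_scale: "component n (sL c P) = (\<lambda>Xs x. s c (component n P Xs x))"
  by (simp add: fun_eq_iff component_def cochain_scale_def)

lemma multilinear_component:
  assumes "multilinear s s P"
  shows "multilinear_cochain s (component n P)"
  using component_cochains[OF assms] cochainsD by blast

lemma leib_bracket_add:
  assumes "multilinear s s P" "multilinear s s P'" "multilinear s s Q"
  shows "leib_bracket s (P + P') Q = leib_bracket s P Q + leib_bracket s P' Q"
    and "leib_bracket s Q (P + P') = leib_bracket s Q P + leib_bracket s Q P'"
proof -
  have "multilinear s s (P + P')"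
    using subspace_multilinear assms(1,2) by (simp add: C.subspace_def)
  note * = leib_bracket_eq_insertions[OF this assms(3)] leib_bracket_eq_insertions[OF assms(1,3)]
    leib_bracket_eq_insertions[OF assms(2,3)] leib_bracket_eq_insertions[OF assms(3) this]
    leib_bracket_eq_insertions[OF assms(3,1)] leib_bracket_eq_insertions[OF assms(3,2)]
  note add = component_add insertion_add_left
    multilinear_cochain.insertion_add_right[OF multilinear_component[OF assms(3)]]
  show "leib_bracket s (P + P') Q = leib_bracket s P Q + leib_bracket s P' Q"
    "leib_bracket s Q (P + P') = leib_bracket s Q P + leib_bracket s Q P'"
    unfolding fun_eq_iff plus_fun_apply *
    by (simp_all only: flip: sum.distrib) (auto intro!: sum.cong simp: add signed_add)
qed

lemma leib_bracket_scale:
  assumes "multilinear s s P" "multilinear s s Q"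
  shows "leib_bracket s (sL c P) Q = sL c (leib_bracket s P Q)"
    and "leib_bracket s Q (sL c P) = sL c (leib_bracket s Q P)"
proof -
  have "multilinear s s (sL c P)"
    using subspace_multilinear assms(1) by (simp add: C.subspace_def)
  note * = leib_bracket_eq_insertions[OF this assms(2)] leib_bracket_eq_insertions[OF assms]
    leib_bracket_eq_insertions[OF assms(2) this] leib_bracket_eq_insertions[OF assms(2,1)]
  note scale = component_scale insertion_scale_left
    multilinear_cochain.insertion_scale_right[OF multilinear_component[OF assms(2)]]
  show "leib_bracket s (sL c P) Q = sL c (leib_bracket s P Q)"
    "leib_bracket s Q (sL c P) = sL c (leib_bracket s Q P)"
    unfolding fun_eq_iff cochain_scale_def[of s c "leib_bracket s _ _"] * scale_sum_right
    by (auto intro!: sum.cong simp: scale scale_signed scale_right_diff_distrib)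
qed

lemma leib_bracket_0:
  assumes "multilinear s s P"
  shows "leib_bracket s 0 P = 0" "leib_bracket s P 0 = 0"
  using leib_bracket_scale[OF assms assms, of 0] by simp_all

lemma L_cases:
  assumes "P \<in> L i"
  obtains (zero) "P = 0" | (nat) p where "i = int p" "P \<in> cochains s s p"
  using assms nat[of "nat i"] by (cases "i < 0") (auto simp: nonneg_grading_def)

lemma L_int: "L (int p) = cochains s s p"
  by (simp add: nonneg_grading_def)

lemma zero_mem_L: "0 \<in> L i"
  using C.subspace_0[OF subspace_cochains] by (simp add: nonneg_grading_def)

lemma multilinear_L: "P \<in> L i \<Longrightarrow> multilinear s s P"
  by (erule L_cases) (use C.subspace_0[OF subspace_multilinear] in \<open>auto simp: mem_cochains\<close>)

lemma leib_bracket_L: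
  assumes "P \<in> L i" "Q \<in> L j"
  shows "leib_bracket s P Q \<in> L (i + j)"
  using assms(1)
proof (cases rule: L_cases)
  case zero
  then show ?thesis using leib_bracket_0 multilinear_L assms(2) zero_mem_L by simp
next
  case P: (nat p)
  show ?thesis
    using assms(2)
  proof (cases rule: L_cases)
    case zero
    then show ?thesis using leib_bracket_0 multilinear_L assms(1) zero_mem_L by simp
  next
    case Q: (nat q)
    show ?thesis
      using leib_bracket_in_cochains[OF P(2) Q(2)] L_int[of "p + q"] by (simp add: P(1) Q(1))
  qed
qed

sublocale graded_Lie sL L "leib_bracket s"
proof
  have total: "multilinear s s P" if "P \<in> total sL L" for P
    using that by (simp add: total_cochains)
  have antisym: "leib_bracket s P Q = - sL ((-1) powi (i * j)) (leib_bracket s Q P)"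
    if PQ: "P \<in> L i" "Q \<in> L j" for P Q i j
    using PQ(1)
  proof (cases rule: L_cases)
    case zero
    then show ?thesis using leib_bracket_0 multilinear_L PQ(2) by simp
  next
    case P: (nat p)
    show ?thesis
      using PQ(2)
    proof (cases rule: L_cases)
      case zero
      then show ?thesis using leib_bracket_0 multilinear_L PQ(1) by simp
    next
      case Q: (nat q)
      show ?thesis
        using leib_bracket_antisym[OF P(2) Q(2)]
        by (simp add: P(1) Q(1) fun_eq_iff cochain_scale_def scale_minus_one_power_int signed_def)
    qed
  qed
  have Jacobi: "leib_bracket s P (leib_bracket s Q R) = leib_bracket s (leib_bracket s P Q) R +
      sL ((-1) powi (i * j)) (leib_bracket s Q (leib_bracket s P R))"
    if PQR: "P \<in> L i" "Q \<in> L j" "R \<in> L k" for P Q R i j k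
  proof -
    note br_0 = PQR[THEN multilinear_L, THEN leib_bracket_0(1)]
      PQR[THEN multilinear_L, THEN leib_bracket_0(2)]
      leib_bracket_L[OF PQR(1,2), THEN multilinear_L, THEN leib_bracket_0(2)]
      leib_bracket_L[OF PQR(1,3), THEN multilinear_L, THEN leib_bracket_0(1)]
      leib_bracket_L[OF PQR(1,3), THEN multilinear_L, THEN leib_bracket_0(2)]
      leib_bracket_L[OF PQR(2,3), THEN multilinear_L, THEN leib_bracket_0(1)]
    show ?thesis
      using PQR(1)
    proof (cases rule: L_cases)
      case zero
      then show ?thesis using br_0 by simp
    next
      case P: (nat p)
      show ?thesis
        using PQR(2)
      proof (cases rule: L_cases)
        case zero
        then show ?thesis using br_0 by simp
      next
        case Q: (nat q)
        show ?thesis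
          using PQR(3)
        proof (cases rule: L_cases)
          case zero
          then show ?thesis using br_0 by simp
        next
          case R: (nat r)
          show ?thesis
            using leib_bracket_Jacobi[OF P(2) Q(2) R(2)]
            by (simp add: P(1) Q(1) fun_eq_iff cochain_scale_def scale_minus_one_power_int signed_def)
        qed
      qed
    qed
  qed
  show "graded_Lie_algebra sL L (leib_bracket s)"
    unfolding graded_Lie_algebra_def
    by (intro conjI allI ballI;
      rule graded_vector_space_cochains leib_bracket_L antisym Jacobi leib_bracket_add
        leib_bracket_scale; (assumption | (rule total, assumption))+)
qed

end


section \<open>Cochains on a direct sum\<close>

text \<open>
  Two multilinear maps agree if they agree on arguments from a generating set: expand one argument after
  the other.
\<close>

lemma multilinear_cochain_eqI:
  assumes "multilinear_cochain s P" "multilinear_cochain s P'"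
    and S: "\<And>w. \<exists>a\<in>S. \<exists>b\<in>S. w = a + b"
    and eq: "\<And>Xs x. set Xs \<subseteq> S \<times> S \<Longrightarrow> x \<in> S \<Longrightarrow> P Xs x = P' Xs x"
  shows "P Xs x = P' Xs x"
  using assms(1,2) eq
proof (induction Xs arbitrary: P P')
  case (Nil P P')
  interpret P: multilinear_cochain s P by (rule Nil.prems)
  interpret P': multilinear_cochain s P' by (rule Nil.prems)
  obtain a b where "a \<in> S" "b \<in> S" "x = a + b" using S by blast
  then show ?case using Nil.prems(3)[of "[]"] by (simp add: P.add_last P'.add_last)
next
  case (Cons X Xs P P')
  interpret P: multilinear_cochain s P by (rule Cons.prems)
  interpret P': multilinear_cochain s P' by (rule Cons.prems)
  have IH: "P ((c, e) # Xs) x = P' ((c, e) # Xs) x" if "c \<in> S" "e \<in> S" for c e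
    by (rule Cons.IH[OF P.prepend P'.prepend], rule Cons.prems(3)) (use that in auto)
  obtain a b where ab: "a \<in> S" "b \<in> S" "fst X = a + b" using S by blast
  obtain c e where ce: "c \<in> S" "e \<in> S" "snd X = c + e" using S by blast
  have X: "X = (a + b, c + e)" using ab ce by (simp add: prod_eq_iff)
  show ?case unfolding X by (simp add: P.add_hd P'.add_hd IH ab ce)
qed

locale direct_sum = G: vector_space sG + V: vector_space sV
  for sG :: "'k::field_char_0 \<Rightarrow> 'g::ab_group_add \<Rightarrow> 'g" and sV :: "'k \<Rightarrow> 'v::ab_group_add \<Rightarrow> 'v"
begin

definition sW :: "'k \<Rightarrow> 'g \<times> 'v \<Rightarrow> 'g \<times> 'v" where
  "sW c w = (sG c (fst w), sV c (snd w))"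

lemma scale_eq_sW: "module_prod.scale sG sV = sW"
proof -
  have "module_prod sG sV"
    unfolding module_prod_def module_pair_def using G.module_axioms V.module_axioms by blast
  then show ?thesis by (simp add: module_prod.scale_def sW_def fun_eq_iff split_beta)
qed

lemma sW_simps [simp]: "fst (sW c w) = sG c (fst w)" "snd (sW c w) = sV c (snd w)"
  by (simp_all add: sW_def)

sublocale W: vector_space sW
  by standard (simp_all add: prod_eq_iff G.scale_left_distrib G.scale_right_distrib
      V.scale_left_distrib V.scale_right_distrib)

sublocale cochain_algebra sW ..

sublocale VG: cochain_spaces sV sG ..

abbreviation "F \<equiv> nonneg_grading (\<lambda>n. extend_cochain ` cochains sV sG n)"


lemma extend_cochains:
  assumes "f \<in> cochains sV sG n"
  shows "extend_cochain f \<in> cochains sW sW n"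
proof -
  have f: "multilinear sV sG f" "homogeneous n f" using assms by (simp_all add: VG.mem_cochains)
  have "multilinear sW sW (extend_cochain f)"
    using f(1) by (simp add: multilinear_def VG.linear_iff linear_iff extend_cochain_def prod_eq_iff)
  then show ?thesis
    using f(2) by (simp add: mem_cochains homogeneous_def extend_cochain_def zero_prod_def)
qed

lemma multilinear_restrict:
  assumes "multilinear sW sW f"
  shows "multilinear sV sG (restrict_cochain f)"
proof -
  interpret multilinear_cochain sW f using assms by (simp add: multilinear_cochain_iff)
  have add: "(0, u + v) = (0 :: 'g, u) + (0, v)" for u v :: 'v by simp
  have scale: "(0, sV c u) = sW c (0, u)" for c u by (simp add: prod_eq_iff)
  show ?thesis
    unfolding multilinear_def VG.linear_iff restrict_cochain_def map_append list.map map_prod_simp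
      add scale add_last scale_last add_slot scale_slot
    by simp
qed

lemma restrict_extend [simp]: "restrict_cochain (extend_cochain f) = f" for f :: "('v, 'g) cochain"
proof -
  have map: "map (map_prod snd snd) (map (map_prod (Pair 0) (Pair 0)) Xs) = Xs" for Xs :: "('v \<times> 'v) list"
    by (induction Xs) auto
  show ?thesis
    by (intro ext) (simp only: restrict_cochain_def extend_cochain_def fst_conv snd_conv map)
qed

lemma projP_extend: "projP (extend_cochain f) = extend_cochain f" for f :: "('v, 'g) cochain"
  by (simp add: projP_def)

lemma projP_add: "projP (f + g) = projP f + projP (g :: ('g \<times> 'v, 'g \<times> 'v) cochain)"
  by (simp add: fun_eq_iff projP_def extend_cochain_def restrict_cochain_def)

lemma projP_scale: "projP (sL c f) = sL c (projP f)"
  by (simp add: fun_eq_iff projP_def extend_cochain_def restrict_cochain_def cochain_scale_def prod_eq_iff)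

lemma projP_0: "projP (0 :: ('g \<times> 'v, 'g \<times> 'v) cochain) = 0"
  by (simp add: fun_eq_iff projP_def extend_cochain_def restrict_cochain_def zero_prod_def)

lemma projP_cochains:
  assumes "f \<in> cochains sW sW n"
  shows "projP f \<in> extend_cochain ` cochains sV sG n"
proof -
  have "homogeneous n (restrict_cochain f)"
    using assms by (simp add: mem_cochains homogeneous_def restrict_cochain_def)
  then have "restrict_cochain f \<in> cochains sV sG n"
    using assms multilinear_restrict by (simp add: mem_cochains VG.mem_cochains)
  then show ?thesis unfolding projP_def by (rule imageI)
qed

lemma F_subset_L: "F i \<subseteq> L i"
  using extend_cochains by (auto simp: nonneg_grading_def)

lemma projP_F: "f \<in> F i \<Longrightarrow> projP f = f"
  by (auto simp: nonneg_grading_def projP_extend projP_0 split: if_splits)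

lemma projP_L: "f \<in> L i \<Longrightarrow> projP f \<in> F i"
  using projP_cochains by (auto simp: nonneg_grading_def projP_0)

lemma F_eq: "F i = {f \<in> L i. projP f = f}"
proof (intro set_eqI iffI)
  show "f \<in> {f \<in> L i. projP f = f}" if "f \<in> F i" for f
    using that projP_F F_subset_L by blast
  show "f \<in> F i" if "f \<in> {f \<in> L i. projP f = f}" for f
    using that projP_L[of f i] by simp
qed

lemma subspace_F: "C.subspace (F i)"
  unfolding F_eq using subspace_degree[of i]
  by (auto simp: C.subspace_def projP_0 projP_add projP_scale)

lemma total_F_subset: "total sL F \<subseteq> total sL L"
  unfolding total_def using F_subset_L by (intro C.span_mono) blast

lemma total_F_degree: "F i \<subseteq> total sL F"
  unfolding total_def using C.span_base by blast

lemma projP_total_F: "f \<in> total sL F \<Longrightarrow> projP f = f"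
proof -
  have "C.subspace {f. projP f = f}"
    by (simp add: C.subspace_def projP_0 projP_add projP_scale)
  then have "total sL F \<subseteq> {f. projP f = f}"
    unfolding total_def using projP_F by (intro C.span_minimal) blast+
  then show "f \<in> total sL F \<Longrightarrow> projP f = f" by blast
qed

lemma projP_total_L: "f \<in> total sL L \<Longrightarrow> projP f \<in> total sL F"
proof -
  have "C.subspace (total sL F)" by (simp add: total_def)
  then have "C.subspace {f. projP f \<in> total sL F}"
    by (simp add: C.subspace_def projP_0 projP_add projP_scale)
  then have "total sL L \<subseteq> {f. projP f \<in> total sL F}"
    unfolding total_def[of _ L] using projP_L total_F_degree by (intro C.span_minimal) blast+
  then show "f \<in> total sL L \<Longrightarrow> projP f \<in> total sL F" by blast
qed

lemma projP_image: "projP ` total sL L = total sL F"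
proof
  show "projP ` total sL L \<subseteq> total sL F" using projP_total_L by blast
  show "total sL F \<subseteq> projP ` total sL L"
  proof
    fix f assume "f \<in> total sL F"
    then show "f \<in> projP ` total sL L"
      using projP_total_F[of f] total_F_subset by (intro image_eqI[of _ _ f]) auto
  qed
qed

text \<open>
  The two halves of being in \<open>C\<^sup>*(V, \<gg>)\<close>, namely vanishing on \<open>\<gg>\<close> and taking values in \<open>\<gg>\<close>, play different
  parts when one map is inserted into another: the outer map needs the former, the inner map the
  latter.
\<close>

definition vanishes_on_G :: "('g \<times> 'v, 'g \<times> 'v) cochain \<Rightarrow> bool" where
  "vanishes_on_G P \<longleftrightarrow> (\<forall>Xs g. P Xs (g, 0) = 0) \<and>
     (\<forall>As Bs g y x. P (As @ ((g, 0), y) # Bs) x = 0 \<and> P (As @ (y, (g, 0)) # Bs) x = 0)"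

lemma vanishes_on_G_prepend: "vanishes_on_G P \<Longrightarrow> vanishes_on_G (prepend X P)"
proof -
  assume P: "vanishes_on_G P"
  have "P ((X # As) @ ((g, 0), y) # Bs) x = 0 \<and> P ((X # As) @ (y, (g, 0)) # Bs) x = 0" for As Bs g y x
    using P unfolding vanishes_on_G_def by blast
  then show ?thesis using P by (simp add: vanishes_on_G_def)
qed

lemma insertion_F_eq_0:
  assumes "vanishes_on_G P" "\<And>Xs x. snd (Q Xs x) = 0"
  shows "insertion q P Q Xs x = 0"
  using assms
proof (induction Xs arbitrary: q P Q)
  case (Nil q P Q)
  have "P [] (fst (Q [] x), 0) = 0" using Nil.prems(1) by (simp add: vanishes_on_G_def)
  moreover have "(fst (Q [] x), 0) = Q [] x" using Nil.prems(2) by (simp add: prod_eq_iff)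
  ultimately show ?case by simp
next
  case (Cons X Xs q P Q)
  have Q: "(fst (Q [] y), 0) = Q [] y" for y using Cons.prems(2) by (simp add: prod_eq_iff)
  have "P ([] @ ((g, 0), y) # Xs) x = 0 \<and> P ([] @ (y, (g, 0)) # Xs) x = 0" for g y
    using Cons.prems(1) unfolding vanishes_on_G_def by blast
  from this[of "fst (Q [] _)", unfolded Q]
  have "P ((Q [] y, z) # Xs) x = 0" "P ((z, Q [] y) # Xs) x = 0" for y z by simp_all
  then show ?case
    using Cons.IH[OF vanishes_on_G_prepend[OF Cons.prems(1)] Cons.prems(2)]
      Cons.IH[OF Cons.prems(1), of "prepend X Q"] Cons.prems(2) by simp
qed

lemma vanishes_on_G_extend:
  assumes "f \<in> cochains sV sG n"
  shows "vanishes_on_G (extend_cochain f)"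
proof -
  have f: "multilinear sV sG f" using assms by (simp add: VG.mem_cochains)
  have "f Xs 0 = 0" for Xs using f linear_0 by (auto simp: multilinear_def)
  moreover have "f (As @ (0, b) # Bs) y = 0" "f (As @ (b, 0) # Bs) y = 0" for As Bs b y
    using f linear_0[of sV sG "\<lambda>a. f (As @ (a, b) # Bs) y"]
      linear_0[of sV sG "\<lambda>a. f (As @ (b, a) # Bs) y"]
    by (simp_all add: multilinear_def)
  ultimately show ?thesis
    by (simp add: vanishes_on_G_def extend_cochain_def zero_prod_def)
qed

lemma F_cases:
  assumes "P \<in> F i"
  obtains (zero) "P = 0" | (nat) p f where "i = int p" "P = extend_cochain f" "f \<in> cochains sV sG p"
  using assms nat[of "nat i"] by (cases "i < 0") (auto simp: nonneg_grading_def)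

lemma leib_bracket_F:
  assumes "P \<in> F i" "Q \<in> F j"
  shows "leib_bracket sW P Q = 0"
  using assms(1)
proof (cases rule: F_cases)
  case zero
  have "multilinear sW sW Q" using assms(2) F_subset_L multilinear_L by blast
  then show ?thesis using zero leib_bracket_0 by simp
next
  case P: (nat p f)
  show ?thesis
    using assms(2)
  proof (cases rule: F_cases)
    case zero
    have "multilinear sW sW P" using assms(1) F_subset_L multilinear_L by blast
    then show ?thesis using zero leib_bracket_0 by simp
  next
    case Q: (nat q g)
    have 0: "insertion n (extend_cochain f) (extend_cochain g) Xs x = 0"
      "insertion n (extend_cochain g) (extend_cochain f) Xs x = 0" for n Xs x
      using insertion_F_eq_0[OF vanishes_on_G_extend] P(3) Q(3) by (simp_all add: extend_cochain_def)
    have "leib_bracket sW P Q Xs x = 0" for Xs x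
      by (simp only: P(2) Q(2) 0 signed_0_right diff_self
          leib_bracket_cochains[OF extend_cochains[OF P(3)] extend_cochains[OF Q(3)]])
    then show ?thesis by (intro ext) (simp only: zero_fun_apply)
  qed
qed

lemma leib_bracket_total_F:
  assumes "P \<in> total sL F" "Q \<in> total sL F"
  shows "leib_bracket sW P Q = 0"
proof -
  have "leib_bracket sW P Q \<in> {0}"
    by (rule bilinear_membership[OF F_subset_L F_subset_L _ _ assms]) (simp_all add: leib_bracket_F)
  then show ?thesis by simp
qed

lemma graded_Lie_subalgebra_F: "graded_Lie_subalgebra sL L (leib_bracket sW) (total sL F)"
  unfolding graded_Lie_subalgebra_def
proof (rule conjI)
  have sub: "C.subspace (total sL F)" unfolding total_def by (rule C.subspace_span)
  then have "0 \<in> total sL F" by (rule C.subspace_0)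
  then show "\<forall>x\<in>total sL F. \<forall>y\<in>total sL F. leib_bracket sW x y \<in> total sL F"
    by (simp add: leib_bracket_total_F)
  show "total sL F = C.span (\<Union>i. total sL F \<inter> L i)"
  proof
    show "total sL F \<subseteq> C.span (\<Union>i. total sL F \<inter> L i)"
    proof -
      have "(\<Union>i. F i) \<subseteq> (\<Union>i. total sL F \<inter> L i)" using F_subset_L total_F_degree by blast
      from C.span_mono[OF this] show ?thesis unfolding total_def[of sL F] .
    qed
    show "C.span (\<Union>i. total sL F \<inter> L i) \<subseteq> total sL F"
      using sub by (intro C.span_minimal) auto
  qed
qed

text \<open>
  The kernel of \<open>projP\<close>, in a form that is evidently stable under insertion.
\<close>

definition preserves_V :: "('g \<times> 'v, 'g \<times> 'v) cochain \<Rightarrow> bool" where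
  "preserves_V P \<longleftrightarrow>
     (\<forall>Xs x. set Xs \<subseteq> {w. fst w = 0} \<times> {w. fst w = 0} \<and> fst x = 0 \<longrightarrow> fst (P Xs x) = 0)"

lemma preserves_VD:
  "preserves_V P \<Longrightarrow> set Xs \<subseteq> {w. fst w = 0} \<times> {w. fst w = 0} \<Longrightarrow> fst x = 0 \<Longrightarrow> fst (P Xs x) = 0"
  by (simp only: preserves_V_def)

lemma projP_eq_0_iff: "projP P = 0 \<longleftrightarrow> preserves_V P"
proof
  assume 0: "projP P = 0"
  show "preserves_V P"
    unfolding preserves_V_def
  proof (intro allI impI)
    fix Xs :: "(('g \<times> 'v) \<times> ('g \<times> 'v)) list" and x :: "'g \<times> 'v"
    assume *: "set Xs \<subseteq> {w. fst w = 0} \<times> {w. fst w = 0} \<and> fst x = 0"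
    then have "map (map_prod (Pair 0) (Pair 0)) (map (map_prod snd snd) Xs) = Xs"
      by (induction Xs) (auto simp: prod_eq_iff)
    moreover have "(0, snd x) = x" using * by (simp add: prod_eq_iff)
    ultimately have "fst (projP P Xs x) = fst (P Xs x)"
      unfolding projP_def extend_cochain_def restrict_cochain_def by (simp only: fst_conv)
    then show "fst (P Xs x) = 0" using 0 by simp
  qed
next
  assume "preserves_V P"
  then have "restrict_cochain P Xs v = 0" for Xs v
    unfolding restrict_cochain_def by (rule preserves_VD) auto
  then show "projP P = 0" by (simp add: fun_eq_iff projP_def extend_cochain_def zero_prod_def)
qed

lemma preserves_V_prepend:
  "preserves_V P \<Longrightarrow> fst (fst X) = 0 \<Longrightarrow> fst (snd X) = 0 \<Longrightarrow> preserves_V (prepend X P)"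
  by (cases X) (auto simp: preserves_V_def)

lemma preserves_V_insertion:
  assumes "preserves_V P" "preserves_V Q"
  shows "preserves_V (insertion q P Q)"
proof -
  have "fst (insertion q P Q Xs x) = 0"
    if "set Xs \<subseteq> {w. fst w = 0} \<times> {w. fst w = 0}" "fst x = 0" for Xs x
    using assms that(1)
  proof (induction Xs arbitrary: q P Q)
    case Nil
    have "fst (Q [] x) = 0" using Nil(2) that(2) by (intro preserves_VD[of Q]) auto
    then show ?case using Nil(1) by (simp add: preserves_VD)
  next
    case (Cons X Xs q P Q)
    then have X: "fst (fst X) = 0" "fst (snd X) = 0" by (auto simp: mem_Times_iff)
    have "fst (Q [] (fst X)) = 0" "fst (Q [] (snd X)) = 0"
      using Cons.prems(2) X by (simp_all add: preserves_VD)
    then have "fst (P ((Q [] (fst X), snd X) # Xs) x) = 0" "fst (P ((fst X, Q [] (snd X)) # Xs) x) = 0"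
      using Cons.prems(3) X that(2) by (simp_all add: preserves_VD[OF Cons.prems(1)])
    moreover have "fst (signed n y) = signed n (fst y)" for n :: nat and y :: "'g \<times> 'v"
      by (simp add: signed_def)
    ultimately show ?case
      using Cons.IH[OF preserves_V_prepend[OF Cons.prems(1) X] Cons.prems(2)]
        Cons.IH[OF Cons.prems(1) preserves_V_prepend[OF Cons.prems(2) X]] Cons.prems(3)
      by simp
  qed
  then show ?thesis by (simp add: preserves_V_def)
qed

lemma preserves_V_component: "preserves_V P \<Longrightarrow> preserves_V (component n P)"
  by (simp add: preserves_V_def component_def)

lemma preserves_V_leib_bracket:
  assumes "multilinear sW sW P" "multilinear sW sW Q" "preserves_V P" "preserves_V Q"
  shows "preserves_V (leib_bracket sW P Q)"
proof -
  have "preserves_V (insertion q (component p P) (component q Q))"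
    "preserves_V (insertion p (component q Q) (component p P))" for p q
    using assms by (simp_all add: preserves_V_insertion preserves_V_component)
  then have "fst (insertion q (component p P) (component q Q) Xs x) = 0"
      "fst (insertion p (component q Q) (component p P) Xs x) = 0"
    if "set Xs \<subseteq> {w. fst w = 0} \<times> {w. fst w = 0} \<and> fst x = 0" for p q Xs x
    using that preserves_VD by blast+
  then have "fst (insertion q (component p P) (component q Q) Xs x -
      signed (p * q) (insertion p (component q Q) (component p P) Xs x)) = 0"
    if "set Xs \<subseteq> {w. fst w = 0} \<times> {w. fst w = 0} \<and> fst x = 0" for p q Xs x
    using that by (simp only: fst_diff signed_def) (simp split: if_split)
  then show ?thesis
    unfolding preserves_V_def leib_bracket_eq_insertions[OF assms(1,2)] fst_sum
    by (intro allI impI sum.neutral ballI) (simp only: split_beta)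
qed

lemma graded_Lie_subalgebra_ker_projP:
  "graded_Lie_subalgebra sL L (leib_bracket sW) {x \<in> total sL L. projP x = 0}" (is "graded_Lie_subalgebra _ _ _ ?K")
  unfolding graded_Lie_subalgebra_def
proof
  show "\<forall>x\<in>?K. \<forall>y\<in>?K. leib_bracket sW x y \<in> ?K"
    using br_total preserves_V_leib_bracket by (auto simp: projP_eq_0_iff total_cochains)
  have sub: "C.subspace ?K"
    using subspace_total by (auto simp: C.subspace_def projP_0 projP_add projP_scale)
  show "?K = C.span (\<Union>i. ?K \<inter> L i)"
  proof
    show "C.span (\<Union>i. ?K \<inter> L i) \<subseteq> ?K"
      using sub by (intro C.span_minimal) auto
    show "?K \<subseteq> C.span (\<Union>i. ?K \<inter> L i)"
    proof
      fix f assume f: "f \<in> ?K"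
      then obtain N where N: "\<forall>Xs x. N < length Xs \<longrightarrow> f Xs x = 0" and m: "multilinear sW sW f"
        by (auto simp: total_cochains)
      have "component n f \<in> (\<Union>i. ?K \<inter> L i)" for n
      proof -
        have "component n f \<in> L (int n)" using component_cochains[OF m] by (simp add: L_int)
        moreover have "projP (component n f) = 0"
          using f by (simp add: projP_eq_0_iff preserves_V_component)
        ultimately show ?thesis using degree_imp_total by blast
      qed
      then have span: "(\<Sum>n\<le>N. component n f) \<in> C.span (\<Union>i. ?K \<inter> L i)"
        by (intro C.span_sum C.span_base)
      have "(\<Sum>n\<le>N. component n f) = f"
        by (rule sum_components[symmetric]) (use N in blast)
      then show "f \<in> C.span (\<Union>i. ?K \<inter> L i)" using span by (simp only:)
    qed
  qed
qed


section \<open>Weights\<close>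

text \<open>
  The rescaling of \<open>\<gg>\<close> by \<open>2\<close>. A cochain has weight \<open>w\<close> if it commutes with this automorphism of \<open>\<gg> \<oplus> V\<close> up to
  the factor \<open>2\<^sup>w\<close>, that is, if \<open>rescales (2\<^sup>w) P P\<close> holds. Two different maps are admitted in \<open>rescales\<close>,
  since a fixed argument \<open>X\<close> on one side becomes the rescaled argument on the other side.
\<close>

definition dilate :: "'g \<times> 'v \<Rightarrow> 'g \<times> 'v" where
  "dilate w = (sG 2 (fst w), snd w)"

definition rescales :: "'k \<Rightarrow> ('g \<times> 'v, 'g \<times> 'v) cochain \<Rightarrow> ('g \<times> 'v, 'g \<times> 'v) cochain \<Rightarrow> bool" where
  "rescales c P P' \<longleftrightarrow>
     (\<forall>Xs x. P (map (map_prod dilate dilate) Xs) (dilate x) = sW c (dilate (P' Xs x)))"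

lemma dilate_linear: "dilate (v + w) = dilate v + dilate w" "dilate (sW c w) = sW c (dilate w)"
  "dilate (v - w) = dilate v - dilate w" "dilate (- w) = - dilate w"
  by (simp_all add: dilate_def prod_eq_iff G.scale_right_distrib G.scale_right_diff_distrib mult.commute)

lemma dilate_signed: "dilate (signed (n :: nat) w) = signed n (dilate w)"
  by (simp add: signed_def dilate_linear)

lemma rescalesD: "rescales c P P' \<Longrightarrow>
    P (map (map_prod dilate dilate) Xs) (dilate x) = sW c (dilate (P' Xs x))"
  by (simp only: rescales_def)

lemma rescales_prepend:
  "rescales c P P' \<Longrightarrow> rescales c (prepend (map_prod dilate dilate X) P) (prepend X P')"
proof -
  assume "rescales c P P'"
  from rescalesD[OF this, of "X # _"] show ?thesis by (simp add: rescales_def)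
qed

lemma rescales_insertion:
  assumes "multilinear_cochain sW P" "rescales c P P'" "rescales e Q Q'"
  shows "rescales (c * e) (insertion q P Q) (insertion q P' Q')"
proof -
  have "insertion q P Q (map (map_prod dilate dilate) Xs) (dilate x) =
      sW (c * e) (dilate (insertion q P' Q' Xs x))" for Xs x
    using assms
  proof (induction Xs arbitrary: q P P' Q Q')
    case (Nil q P P' Q Q')
    interpret multilinear_cochain sW P by (rule Nil.prems)
    have "Q [] (dilate x) = sW e (dilate (Q' [] x))" using rescalesD[OF Nil.prems(3), of "[]"] by simp
    moreover have "P [] (dilate (Q' [] x)) = sW c (dilate (P' [] (Q' [] x)))"
      using rescalesD[OF Nil.prems(2), of "[]"] by simp
    ultimately show ?case by (simp add: scale_last mult.commute)
  next
    case (Cons X Xs q P P' Q Q')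
    interpret multilinear_cochain sW P by (rule Cons.prems)
    let ?d = "map_prod dilate dilate"
    have Q: "Q [] (dilate y) = sW e (dilate (Q' [] y))" for y
      using rescalesD[OF Cons.prems(3), of "[]"] by simp
    have P: "P ((dilate y, dilate z) # map ?d Xs) (dilate x) = sW c (dilate (P' ((y, z) # Xs) x))" for y z
      using rescalesD[OF Cons.prems(2), of "(y, z) # Xs"] by simp
    have "P ((Q [] (fst (?d X)), snd (?d X)) # map ?d Xs) (dilate x) =
        sW (c * e) (dilate (P' ((Q' [] (fst X), snd X) # Xs) x))"
      "P ((fst (?d X), Q [] (snd (?d X))) # map ?d Xs) (dilate x) =
        sW (c * e) (dilate (P' ((fst X, Q' [] (snd X)) # Xs) x))"
      by (simp_all add: Q scale_hd P mult.commute)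
    moreover note Cons.IH[OF prepend[of "?d X"] rescales_prepend[OF Cons.prems(2), of X] Cons.prems(3), of q]
      Cons.IH[OF Cons.prems(1,2) rescales_prepend[OF Cons.prems(3), of X], of "Suc q"]
    ultimately show ?case
      by (simp add: dilate_linear dilate_signed W.scale_signed W.scale_right_distrib)
  qed
  then show ?thesis by (simp add: rescales_def)
qed

lemma rescales_leib_bracket:
  assumes P: "P \<in> cochains sW sW p" "rescales c P P" and Q: "Q \<in> cochains sW sW q" "rescales e Q Q"
  shows "rescales (c * e) (leib_bracket sW P Q) (leib_bracket sW P Q)"
  unfolding rescales_def leib_bracket_cochains[OF P(1) Q(1)]
  using rescalesD[OF rescales_insertion[OF cochainsD(1)[OF P(1)] P(2) Q(2), of q]]
    rescalesD[OF rescales_insertion[OF cochainsD(1)[OF Q(1)] Q(2) P(2), of p]]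
  by (simp add: dilate_linear dilate_signed W.scale_signed W.scale_right_diff_distrib mult.commute)

text \<open>
  Weight \<open>-1\<close>: the arguments from \<open>V\<close> are not rescaled, and the value in \<open>\<gg>\<close> is.
\<close>

lemma rescales_extend: "rescales (1 / 2) (extend_cochain f) (extend_cochain f)"
proof -
  have "map (map_prod snd snd) (map (map_prod dilate dilate) Xs) = map (map_prod snd snd) Xs" for Xs
    by (induction Xs) (auto simp: dilate_def)
  then show ?thesis
    unfolding rescales_def extend_cochain_def by (simp add: dilate_def prod_eq_iff del: map_map)
qed

definition summands :: "('g \<times> 'v) set" where
  "summands = {w. fst w = 0 \<or> snd w = 0}"

lemma summands_generate: "\<exists>a\<in>summands. \<exists>b\<in>summands. w = a + b"
  by (rule bexI[of _ "(fst w, 0)"], rule bexI[of _ "(0, snd w)"]) (auto simp: summands_def)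

lemma dilate_summands: "w \<in> summands \<Longrightarrow> dilate w = sW (if fst w = 0 then 1 else 2) w"
  by (auto simp: dilate_def summands_def prod_eq_iff)

lemma dilate_arguments:
  assumes "multilinear_cochain sW P" "set Xs \<subseteq> summands \<times> summands" "x \<in> summands"
  shows "\<exists>j. P (map (map_prod dilate dilate) Xs) (dilate x) = sW (2 ^ j) (P Xs x) \<and>
    (j = 0 \<longrightarrow> set Xs \<subseteq> {w. fst w = 0} \<times> {w. fst w = 0} \<and> fst x = 0)"
  using assms(1,2)
proof (induction Xs arbitrary: P)
  case (Nil P)
  interpret multilinear_cochain sW P by (rule Nil.prems)
  show ?case
    using dilate_summands[OF assms(3)]
    by (intro exI[of _ "if fst x = 0 then 0 else 1"]) (simp add: scale_last)
next
  case (Cons X Xs P)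
  interpret multilinear_cochain sW P by (rule Cons.prems)
  obtain a b where X: "X = (a, b)" by (cases X)
  have ab: "a \<in> summands" "b \<in> summands" using Cons.prems(2) X by auto
  define m where "m w = (if fst w = 0 then 0 else 1 :: nat)" for w :: "'g \<times> 'v"
  have m: "dilate a = sW (2 ^ m a) a" "dilate b = sW (2 ^ m b) b"
    using ab dilate_summands by (simp_all add: m_def)
  obtain j where j: "prepend X P (map (map_prod dilate dilate) Xs) (dilate x) = sW (2 ^ j) (prepend X P Xs x)"
    "j = 0 \<Longrightarrow> set Xs \<subseteq> {w. fst w = 0} \<times> {w. fst w = 0} \<and> fst x = 0"
  proof -
    have "set Xs \<subseteq> summands \<times> summands" using Cons.prems(2) by simp
    from Cons.IH[OF prepend[of X] this] show ?thesis using that by blast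
  qed
  have "P (map (map_prod dilate dilate) (X # Xs)) (dilate x) = sW (2 ^ (m a + m b + j)) (P (X # Xs) x)"
    using j(1) by (simp add: X m scale_hd power_add mult.assoc)
  moreover have "m a + m b + j = 0 \<longrightarrow>
      set (X # Xs) \<subseteq> {w. fst w = 0} \<times> {w. fst w = 0} \<and> fst x = 0"
    using j(2) by (auto simp: X m_def split: if_splits)
  ultimately show ?case by (intro exI[of _ "m a + m b + j"] conjI)
qed

lemma power_two_eq_1_iff: "(2 :: 'k) ^ j = 1 \<longleftrightarrow> j = 0"
proof -
  have "(2 :: 'k) ^ j = of_nat (2 ^ j)" by simp
  then show ?thesis by (metis of_nat_1 of_nat_eq_iff power_0 power_inject_exp one_less_numeral_iff semiring_norm(76))
qed

text \<open>
  If \<open>j\<close> of the arguments are nonzero elements of \<open>\<gg>\<close> and the others lie in \<open>V\<close>, then rescaling them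
  multiplies the value by \<open>2\<^sup>j\<close>. In a map of weight \<open>-1\<close> this factor is \<open>1\<close> on the \<open>\<gg>\<close>-component and
  \<open>1 / 2\<close> on the \<open>V\<close>-component of the value. In characteristic \<open>0\<close> the \<open>V\<close>-component must vanish, and the
  \<open>\<gg>\<close>-component can only survive for \<open>j = 0\<close>.
\<close>

lemma rescales_half:
  assumes "multilinear_cochain sW P" "rescales (1 / 2) P P"
    and "set Xs \<subseteq> summands \<times> summands" "x \<in> summands"
  shows "snd (P Xs x) = 0 \<and>
    (P Xs x = 0 \<or> set Xs \<subseteq> {w. fst w = 0} \<times> {w. fst w = 0} \<and> fst x = 0)"
proof -
  obtain j where j: "P (map (map_prod dilate dilate) Xs) (dilate x) = sW (2 ^ j) (P Xs x)"
    "j = 0 \<Longrightarrow> set Xs \<subseteq> {w. fst w = 0} \<times> {w. fst w = 0} \<and> fst x = 0"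
    using dilate_arguments[OF assms(1,3,4)] by blast
  have eq: "sW (2 ^ j) (P Xs x) = sW (1 / 2) (dilate (P Xs x))"
    using j(1) rescalesD[OF assms(2)] by simp
  have "sG (2 ^ j) (fst (P Xs x)) = sG 1 (fst (P Xs x))"
    using arg_cong[OF eq, of fst] by (simp add: dilate_def)
  then have "fst (P Xs x) = 0 \<or> j = 0"
    using G.scale_right_imp_eq[of "fst (P Xs x)" "2 ^ j" 1] power_two_eq_1_iff by metis
  moreover have "sV (2 ^ j) (snd (P Xs x)) = sV (1 / 2) (snd (P Xs x))"
    using arg_cong[OF eq, of snd] by (simp add: dilate_def)
  then have "snd (P Xs x) = 0"
  proof -
    have "(2 :: 'k) ^ j \<noteq> 1 / 2"
      using power_two_eq_1_iff[of "Suc j"] by (simp add: field_simps)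
    then show ?thesis
      using \<open>sV (2 ^ j) (snd (P Xs x)) = _\<close> V.scale_right_imp_eq by metis
  qed
  moreover have "P Xs x = 0" if "fst (P Xs x) = 0" "snd (P Xs x) = 0"
    using that by (simp add: prod_eq_iff)
  ultimately show ?thesis using j(2) by blast
qed

lemma projP_eq_if_rescales_half:
  assumes P: "P \<in> cochains sW sW n" and r: "rescales (1 / 2) P P"
  shows "projP P = P"
proof -
  have m: "multilinear_cochain sW P" "multilinear_cochain sW (projP P)"
  proof -
    obtain f where f: "projP P = extend_cochain f" "f \<in> cochains sV sG n"
      using projP_cochains[OF P] by (rule imageE)
    show "multilinear_cochain sW (projP P)"
      unfolding f(1) by (rule cochainsD(1)[OF extend_cochains[OF f(2)]])
  qed (rule cochainsD(1)[OF P])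
  have r': "rescales (1 / 2) (projP P) (projP P)" unfolding projP_def by (rule rescales_extend)
  have "projP P Xs x = P Xs x" for Xs x
  proof (rule multilinear_cochain_eqI[OF m(2,1) summands_generate])
    fix Xs x assume S: "set Xs \<subseteq> summands \<times> summands" "x \<in> summands"
    note P = rescales_half[OF m(1) r S] and P' = rescales_half[OF m(2) r' S]
    show "projP P Xs x = P Xs x"
    proof (cases "set Xs \<subseteq> {w. fst w = 0} \<times> {w. fst w = 0} \<and> fst x = 0")
      case True
      then have "map (map_prod (Pair 0) (Pair 0)) (map (map_prod snd snd) Xs) = Xs"
        by (induction Xs) (auto simp: prod_eq_iff)
      moreover have "(0, snd x) = x" using True by (simp add: prod_eq_iff)
      ultimately have "fst (projP P Xs x) = fst (P Xs x)"
        unfolding projP_def extend_cochain_def restrict_cochain_def by (simp only: fst_conv)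
      then show ?thesis using P P' by (simp add: prod_eq_iff)
    next
      case False
      then show ?thesis using P P' by metis
    qed
  qed
  then show ?thesis by (intro ext)
qed

end


section \<open>The bracket of a representation\<close>

locale representation = direct_sum sG sV
  for sG :: "'k::field_char_0 \<Rightarrow> 'g::ab_group_add \<Rightarrow> 'g" and sV :: "'k \<Rightarrow> 'v::ab_group_add \<Rightarrow> 'v" +
  fixes \<mu> :: "'g \<Rightarrow> 'g \<Rightarrow> 'g \<Rightarrow> 'g" and \<rho> :: "'g \<Rightarrow> 'g \<Rightarrow> 'v \<Rightarrow> 'v"
  assumes three_Lie: "three_Lie_algebra sG \<mu>"
    and rep: "three_Lie_representation sG \<mu> sV \<rho>"
begin

abbreviation "\<Delta> \<equiv> boxplus \<mu> \<rho>"

sublocale GG: cochain_spaces sG sG ..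
sublocale GV: cochain_spaces sG sV ..
sublocale VV: cochain_spaces sV sV ..

lemma mu_linear:
  "\<mu> (x + x') y z = \<mu> x y z + \<mu> x' y z" "\<mu> x (y + y') z = \<mu> x y z + \<mu> x y' z"
  "\<mu> x y (z + z') = \<mu> x y z + \<mu> x y z'"
  "\<mu> (sG c x) y z = sG c (\<mu> x y z)" "\<mu> x (sG c y) z = sG c (\<mu> x y z)" "\<mu> x y (sG c z) = sG c (\<mu> x y z)"
proof -
  have "(\<forall>y z. Vector_Spaces.linear sG sG (\<lambda>x. \<mu> x y z)) \<and>
    (\<forall>x z. Vector_Spaces.linear sG sG (\<lambda>y. \<mu> x y z)) \<and>
    (\<forall>x y. Vector_Spaces.linear sG sG (\<lambda>z. \<mu> x y z))"
    using three_Lie unfolding three_Lie_algebra_def by (elim conjE, intro conjI)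
  then have lin: "Vector_Spaces.linear sG sG (\<lambda>x. \<mu> x y z)" "Vector_Spaces.linear sG sG (\<lambda>y. \<mu> x y z)"
    "Vector_Spaces.linear sG sG (\<lambda>z. \<mu> x y z)" for x y z by (simp_all only:)
  show "\<mu> (x + x') y z = \<mu> x y z + \<mu> x' y z" "\<mu> (sG c x) y z = sG c (\<mu> x y z)"
    by (rule linearD[OF lin(1)])+
  show "\<mu> x (y + y') z = \<mu> x y z + \<mu> x y' z" "\<mu> x (sG c y) z = sG c (\<mu> x y z)"
    by (rule linearD[OF lin(2)])+
  show "\<mu> x y (z + z') = \<mu> x y z + \<mu> x y z'" "\<mu> x y (sG c z) = sG c (\<mu> x y z)"
    by (rule linearD[OF lin(3)])+
qed

lemma rho_linear:
  "\<rho> (x + x') y v = \<rho> x y v + \<rho> x' y v" "\<rho> x (y + y') v = \<rho> x y v + \<rho> x y' v"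
  "\<rho> x y (v + v') = \<rho> x y v + \<rho> x y v'"
  "\<rho> (sG c x) y v = sV c (\<rho> x y v)" "\<rho> x (sG c y) v = sV c (\<rho> x y v)" "\<rho> x y (sV c v) = sV c (\<rho> x y v)"
proof -
  have "(\<forall>y v. Vector_Spaces.linear sG sV (\<lambda>x. \<rho> x y v)) \<and>
    (\<forall>x v. Vector_Spaces.linear sG sV (\<lambda>y. \<rho> x y v)) \<and>
    (\<forall>x y. Vector_Spaces.linear sV sV (\<rho> x y))"
    using rep unfolding three_Lie_representation_def by (elim conjE, intro conjI)
  then have lin: "Vector_Spaces.linear sG sV (\<lambda>x. \<rho> x y v)" "Vector_Spaces.linear sG sV (\<lambda>y. \<rho> x y v)"
    "Vector_Spaces.linear sV sV (\<rho> x y)" for x y v by (simp_all only:)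
  show "\<rho> (x + x') y v = \<rho> x y v + \<rho> x' y v" "\<rho> (sG c x) y v = sV c (\<rho> x y v)"
    by (rule linearD[OF lin(1)])+
  show "\<rho> x (y + y') v = \<rho> x y v + \<rho> x y' v" "\<rho> x (sG c y) v = sV c (\<rho> x y v)"
    by (rule linearD[OF lin(2)])+
  show "\<rho> x y (v + v') = \<rho> x y v + \<rho> x y v'" "\<rho> x y (sV c v) = sV c (\<rho> x y v)"
    by (rule linearD[OF lin(3)])+
qed

lemma mu_fundamental: "\<mu> x1 x2 (\<mu> x3 x4 x5) =
    \<mu> (\<mu> x1 x2 x3) x4 x5 + \<mu> x3 (\<mu> x1 x2 x4) x5 + \<mu> x3 x4 (\<mu> x1 x2 x5)"
proof -
  have "\<forall>x1 x2 x3 x4 x5. \<mu> x1 x2 (\<mu> x3 x4 x5) =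
      \<mu> (\<mu> x1 x2 x3) x4 x5 + \<mu> x3 (\<mu> x1 x2 x4) x5 + \<mu> x3 x4 (\<mu> x1 x2 x5)"
    using three_Lie unfolding three_Lie_algebra_def by (elim conjE)
  then show ?thesis by blast
qed

lemma rho_fundamental: "\<rho> x1 x2 (\<rho> x3 x4 v) =
    \<rho> (\<mu> x1 x2 x3) x4 v + \<rho> x3 (\<mu> x1 x2 x4) v + \<rho> x3 x4 (\<rho> x1 x2 v)"
proof -
  have "\<forall>x1 x2 x3 x4 v. \<rho> x1 x2 (\<rho> x3 x4 v) =
      \<rho> (\<mu> x1 x2 x3) x4 v + \<rho> x3 (\<mu> x1 x2 x4) v + \<rho> x3 x4 (\<rho> x1 x2 v)"
    using rep unfolding three_Lie_representation_def by (elim conjE)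
  then show ?thesis by blast
qed

lemma boxplus_single [simp]:
  "\<Delta> [(a, b)] c = (\<mu> (fst a) (fst b) (fst c), \<rho> (fst a) (fst b) (snd c))"
  by (simp add: boxplus_def)

lemma boxplus_eq_0: "length Xs \<noteq> 1 \<Longrightarrow> \<Delta> Xs c = 0"
  by (auto simp: boxplus_def split: list.split)

lemma boxplus_cochain: "\<Delta> \<in> cochains sW sW 1"
proof -
  have "multilinear_cochain sW \<Delta>"
  proof (rule multilinear_cochainI)
    show "vector_space sW" by (rule W.vector_space_axioms)
    fix Xs x y c
    show "\<Delta> Xs (x + y) = \<Delta> Xs x + \<Delta> Xs y" "\<Delta> Xs (sW c x) = sW c (\<Delta> Xs x)"
      by (auto simp: boxplus_def mu_linear rho_linear prod_eq_iff split: list.split)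
  next
    fix As Bs a a' b c x
    show "\<Delta> (As @ (a + a', b) # Bs) x = \<Delta> (As @ (a, b) # Bs) x + \<Delta> (As @ (a', b) # Bs) x"
      by (cases "As = [] \<and> Bs = []") (auto simp: boxplus_eq_0 mu_linear rho_linear)
    show "\<Delta> (As @ (b, a + a') # Bs) x = \<Delta> (As @ (b, a) # Bs) x + \<Delta> (As @ (b, a') # Bs) x"
      by (cases "As = [] \<and> Bs = []") (auto simp: boxplus_eq_0 mu_linear rho_linear)
    show "\<Delta> (As @ (sW c a, b) # Bs) x = sW c (\<Delta> (As @ (a, b) # Bs) x)"
      by (cases "As = [] \<and> Bs = []") (auto simp: boxplus_eq_0 mu_linear rho_linear prod_eq_iff)
    show "\<Delta> (As @ (b, sW c a) # Bs) x = sW c (\<Delta> (As @ (b, a) # Bs) x)"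
      by (cases "As = [] \<and> Bs = []") (auto simp: boxplus_eq_0 mu_linear rho_linear prod_eq_iff)
  qed
  moreover have "homogeneous 1 \<Delta>" by (simp add: homogeneous_def boxplus_eq_0)
  ultimately show ?thesis by (simp add: mem_cochains multilinear_cochain_iff)
qed

lemma mu_0: "\<mu> 0 y z = 0"
  using mu_linear(1)[of 0 0 y z] by simp

lemma projP_boxplus: "projP \<Delta> = 0"
proof -
  have "fst (\<Delta> Xs x) = 0" if "set Xs \<subseteq> {w. fst w = 0} \<times> {w. fst w = 0}" for Xs x
    using that by (auto simp: boxplus_def mu_0 split: list.split)
  then show ?thesis by (simp add: projP_eq_0_iff preserves_V_def)
qed

text \<open>
  The four terms that remain of \<open>\<Delta> \<circ> \<Delta>\<close> are those of the fundamental identity of \<open>\<Delta>\<close>. Its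
  component in \<open>\<gg>\<close> is
  the identity for \<open>\<mu>\<close>, and its component in \<open>V\<close> is the rule for the commutator of \<open>\<rho> x1 x2\<close> and \<open>\<rho> x3 x4\<close>.
\<close>

lemma boxplus_insertion: "insertion 1 \<Delta> \<Delta> Xs x = 0"
proof (cases "length Xs = 2")
  case True
  then obtain a b a' b' where Xs: "Xs = [(a, b), (a', b')]"
    by (auto simp: length_Suc_conv numeral_eq_Suc)
  show ?thesis
    unfolding Xs
    by (simp add: boxplus_eq_0 prod_eq_iff
        mu_fundamental[of "fst a" "fst b" "fst a'" "fst b'" "fst x"]
        rho_fundamental[of "fst a" "fst b" "fst a'" "fst b'" "snd x"])
next
  case False
  then have "length Xs \<noteq> 1 + 1" by simp
  with homogeneous_insertion[OF cochainsD[OF boxplus_cochain] cochainsD(2)[OF boxplus_cochain]]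
  show ?thesis unfolding homogeneous_def by blast
qed

lemma boxplus_square: "leib_bracket sW \<Delta> \<Delta> = 0"
  unfolding leib_bracket_cochains[OF boxplus_cochain boxplus_cochain]
  by (simp only: boxplus_insertion fun_eq_iff) simp

text \<open>
  Weight \<open>2\<close>: three arguments and one value in \<open>\<gg>\<close> for \<open>\<mu>\<close>, two arguments in \<open>\<gg>\<close> for \<open>\<rho>\<close>.
\<close>

lemma rescales_boxplus: "rescales 4 \<Delta> \<Delta>"
proof -
  have 4: "sG 2 (sG 2 x) = sG 4 x" "sV 2 (sV 2 v) = sV 4 v" for x v by simp_all
  have "\<Delta> (map (map_prod dilate dilate) Xs) (dilate x) = sW 4 (dilate (\<Delta> Xs x))" for Xs x
  proof (cases "length Xs = 1")
    case True
    then obtain a b where "Xs = [(a, b)]" by (auto simp: length_Suc_conv)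
    then show ?thesis by (simp add: dilate_def mu_linear rho_linear prod_eq_iff)
  next
    case False
    then show ?thesis by (simp add: boxplus_eq_0 dilate_def prod_eq_iff)
  qed
  then show ?thesis by (simp add: rescales_def)
qed

text \<open>
  Weights add up under the bracket, and \<open>2 - 1 - 1 - 1 = -1\<close>.
\<close>

lemma triple_bracket_F:
  assumes "P \<in> F i" "Q \<in> F j" "R \<in> F k"
  shows "leib_bracket sW (leib_bracket sW (leib_bracket sW \<Delta> P) Q) R \<in> F (i + j + k + 1)"
proof -
  have \<Delta>: "\<Delta> \<in> L 1" using boxplus_cochain L_int[of 1] by simp
  have L: "P \<in> L i" "Q \<in> L j" "R \<in> L k" using assms F_subset_L by blast+
  have 1: "leib_bracket sW \<Delta> P \<in> L (1 + i)" by (rule br_degree[OF \<Delta> L(1)])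
  have 2: "leib_bracket sW (leib_bracket sW \<Delta> P) Q \<in> L (1 + i + j)" by (rule br_degree[OF 1 L(2)])
  have zero: "0 \<in> F (i + j + k + 1)" by (rule C.subspace_0[OF subspace_F])
  show ?thesis
  proof (cases "P = 0 \<or> Q = 0 \<or> R = 0")
    case True
    then show ?thesis
      using zero br_0_left br_0_right degree_imp_total[OF \<Delta>] degree_imp_total[OF 1]
        degree_imp_total[OF 2] L[THEN degree_imp_total] by auto
  next
    case False
    then obtain p f q g r h where
      P: "i = int p" "P = extend_cochain f" "f \<in> cochains sV sG p" and
      Q: "j = int q" "Q = extend_cochain g" "g \<in> cochains sV sG q" and
      R: "k = int r" "R = extend_cochain h" "h \<in> cochains sV sG r"
      using assms by (metis F_cases)
    have c: "P \<in> cochains sW sW p" "Q \<in> cochains sW sW q" "R \<in> cochains sW sW r"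
      using P Q R extend_cochains by blast+
    have w: "rescales (1 / 2) P P" "rescales (1 / 2) Q Q" "rescales (1 / 2) R R"
      using P Q R rescales_extend by blast+
    let ?t = "leib_bracket sW (leib_bracket sW (leib_bracket sW \<Delta> P) Q) R"
    note c1 = leib_bracket_in_cochains[OF boxplus_cochain c(1)]
    note c2 = leib_bracket_in_cochains[OF c1 c(2)]
    note c3 = leib_bracket_in_cochains[OF c2 c(3)]
    note w1 = rescales_leib_bracket[OF boxplus_cochain rescales_boxplus c(1) w(1)]
    note w2 = rescales_leib_bracket[OF c1 w1 c(2) w(2)]
    note w3 = rescales_leib_bracket[OF c2 w2 c(3) w(3)]
    have "projP ?t = ?t" by (rule projP_eq_if_rescales_half[OF c3]) (use w3 in simp)
    moreover have "?t \<in> L (i + j + k + 1)"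
      using c3 L_int[of "1 + p + q + r"] by (simp add: P(1) Q(1) R(1) add.commute add.left_commute)
    ultimately show ?thesis unfolding F_eq by blast
  qed
qed

sublocale derived_bracket sL L "leib_bracket sW" \<Delta> F
  by standard (use boxplus_cochain L_int[of 1] boxplus_square subspace_F F_subset_L leib_bracket_F
    triple_bracket_F in auto)

theorem V_data_boxplus: "V_data sL L (leib_bracket sW) (total sL F) projP \<Delta>"
  unfolding V_data_def
proof (intro conjI)
  show "graded_Lie_algebra sL L (leib_bracket sW)" by (rule graded_Lie_algebra)
  show "graded_Lie_subalgebra sL L (leib_bracket sW) (total sL F)" by (rule graded_Lie_subalgebra_F)
  show "\<forall>x\<in>total sL F. \<forall>y\<in>total sL F. leib_bracket sW x y = 0"
    by (intro ballI leib_bracket_total_F)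
  show "\<forall>x\<in>total sL L. \<forall>y\<in>total sL L. \<forall>c.
      projP (x + y) = projP x + projP y \<and> projP (sL c x) = sL c (projP x)"
    by (intro ballI allI conjI projP_add projP_scale)
  show "\<forall>x\<in>total sL L. projP x \<in> total sL L \<and> projP (projP x) = projP x"
  proof (intro ballI conjI)
    fix x assume "x \<in> total sL L"
    then have "projP x \<in> total sL F" by (rule projP_total_L)
    then show "projP x \<in> total sL L" "projP (projP x) = projP x"
      using total_F_subset projP_total_F by blast+
  qed
  show "projP ` total sL L = total sL F" by (rule projP_image)
  show "graded_Lie_subalgebra sL L (leib_bracket sW) {x \<in> total sL L. projP x = 0}"
    by (rule graded_Lie_subalgebra_ker_projP)
qed (rule \<Delta>(1) projP_boxplus boxplus_square)+

end

theorem proposition3p10: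
  fixes sG :: "'k::{alg_closed_field, field_char_0} \<Rightarrow> 'g::ab_group_add \<Rightarrow> 'g"
    and sV :: "'k \<Rightarrow> 'v::ab_group_add \<Rightarrow> 'v"
    and \<mu> :: "'g \<Rightarrow> 'g \<Rightarrow> 'g \<Rightarrow> 'g"
    and \<rho> :: "'g \<Rightarrow> 'g \<Rightarrow> 'v \<Rightarrow> 'v"
  defines "sW \<equiv> module_prod.scale sG sV"
  defines "sL \<equiv> cochain_scale sW"
  defines "L \<equiv> nonneg_grading (cochains sW sW)"
  defines "F \<equiv> nonneg_grading (\<lambda>n. extend_cochain ` cochains sV sG n)"
  defines "br \<equiv> leib_bracket sW"
  assumes "three_Lie_algebra sG \<mu>"
    and "three_Lie_representation sG \<mu> sV \<rho>"
  shows "V_data sL L br (total sL F) projP (boxplus \<mu> \<rho>) \<and>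
         Lie_3_algebra sL F (\<lambda>P Q R. br (br (br (boxplus \<mu> \<rho>) P) Q) R)"
proof -
  interpret representation sG sV \<mu> \<rho>
  proof (intro representation.intro direct_sum.intro representation_axioms.intro assms(6,7))
    show "vector_space sG" using assms(6) unfolding three_Lie_algebra_def by (rule conjunct1)
    show "vector_space sV" using assms(7) unfolding three_Lie_representation_def by (rule conjunct1)
  qed
  show ?thesis
    unfolding assms(1-5) scale_eq_sW
    by (rule conjI[OF V_data_boxplus derived_Lie_3_algebra])
qed

end
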